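(* The set $$E=\Big\{(x,y)\in\mathbb{R}^2:\ \limsup_{Q\to+\infty}\ Q\cdot\min_{1\le q\le Q}\langle qx\rangle\langle qy\rangle>0\Big\}$$ is hyperplane absolute winning (HAW) on $\mathbb{R}^2$. In particular, it has full Hausdorff dimension in $\mathbb{R}^2$, i.e. $\dim_H E=2$.
   Context: For $x\in\mathbb{R}$, $\langle x\rangle$ denotes the distance from $x$ to the nearest integer; $q$ ranges over positive integers. Hyperplane absolute winning (HAW) on $\mathbb{R}^d$: let $S\subset\mathbb{R}^d$ and $\beta\in(0,1/3)$. For an affine hyperplane $L\subset\mathbb{R}^d$ and $r>0$ put $L^{(r)}=\{z\in\mathbb{R}^d:\mathrm{dist}(z,L)\le r\}$. Bob first chooses a closed ball $B_0$ of radius $\rho_0>0$. After Bob chooses a closed ball $B_n$ of radius $\rho_n$, Alice chooses a hyperplane neighborhood $L_n^{(r_n)}$ with $r_n\le\beta\rho_n$, and then Bob chooses a closed ball $B_{n+1}\subset B_n\setminus L_n^{(r_n)}$ of radius $\rho_{n+1}\ge\beta\rho_n$. Alice wins by default if at any time Bob has no legal move, or if $\rho_n\not\to0$. Otherwise Alice wins if and only if $\bigcap_n B_n\cap S\ne\varnothing$. $S$ is $\beta$-HAW if Alice has a winning strategy, and HAW if it is $\beta$-HAW for every $\beta\in(0,1/3)$. *)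

theory Defs
  imports "HOL-Analysis.Analysis"
begin

definition dist_nearest_int :: "real \<Rightarrow> real" where
  "dist_nearest_int x = \<bar>x - of_int (round x)\<bar>"

(* At Q = 0 the minimum is taken over the empty set; this single value has no
   influence on the limsup. *)
definition E_set :: "(real \<times> real) set" where
  "E_set = {(x, y).
     limsup (\<lambda>Q::nat. ereal (real Q *
       Min ((\<lambda>q. dist_nearest_int (real q * x) * dist_nearest_int (real q * y)) ` {1..Q}))) > 0}"


section \<open>The hyperplane absolute game\<close>

definition affine_hyperplane :: "'a::euclidean_space set \<Rightarrow> bool" where
  "affine_hyperplane L \<longleftrightarrow> (\<exists>a b. a \<noteq> 0 \<and> L = {z. a \<bullet> z = b})"

definition hyperplane_nbhd :: "'a::euclidean_space set \<Rightarrow> real \<Rightarrow> 'a set" where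
  "hyperplane_nbhd L r = {z. infdist z L \<le> r}"

text \<open>
  A move (c, rho) of Bob stands for the closed ball with centre c and radius rho, a move
  (L, r) of Alice for the closed r-neighbourhood of L.  A strategy of Alice maps the list
  B(0), ..., B(n) of the moves made by Bob so far to her n-th move; her own earlier moves are
  determined by the strategy, so they need not be part of the argument.
\<close>

type_synonym 'a bob_move = "'a \<times> real"
type_synonym 'a alice_move = "'a set \<times> real"
type_synonym 'a alice_strategy = "'a bob_move list \<Rightarrow> 'a alice_move"

definition ball_of :: "'a::euclidean_space bob_move \<Rightarrow> 'a set" where
  "ball_of B = cball (fst B) (snd B)"

definition nbhd_of :: "'a::euclidean_space alice_move \<Rightarrow> 'a set" where
  "nbhd_of A = hyperplane_nbhd (fst A) (snd A)"

definition alice_legal :: "real \<Rightarrow> 'a::euclidean_space bob_move \<Rightarrow> 'a alice_move \<Rightarrow> bool" where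
  "alice_legal \<beta> B A \<longleftrightarrow> affine_hyperplane (fst A) \<and> 0 < snd A \<and> snd A \<le> \<beta> * snd B"

definition bob_legal ::
  "real \<Rightarrow> 'a::euclidean_space bob_move \<Rightarrow> 'a alice_move \<Rightarrow> 'a bob_move \<Rightarrow> bool" where
  "bob_legal \<beta> B A B' \<longleftrightarrow> ball_of B' \<subseteq> ball_of B - nbhd_of A \<and> snd B' \<ge> \<beta> * snd B"

definition alice_reply ::
  "'a::euclidean_space alice_strategy \<Rightarrow> (nat \<Rightarrow> 'a bob_move) \<Rightarrow> nat \<Rightarrow> 'a alice_move" where
  "alice_reply \<sigma> B n = \<sigma> (map B [0..<Suc n])"

definition play_upto ::
  "real \<Rightarrow> 'a::euclidean_space alice_strategy \<Rightarrow> (nat \<Rightarrow> 'a bob_move) \<Rightarrow> nat \<Rightarrow> bool" where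
  "play_upto \<beta> \<sigma> B n \<longleftrightarrow>
     0 < snd (B 0) \<and> (\<forall>k<n. bob_legal \<beta> (B k) (alice_reply \<sigma> B k) (B (Suc k)))"

text \<open>
  A winning strategy must always produce a legal move.  A play that ends because Bob has no
  legal move is won by Alice, so only the infinite plays impose a further condition.
\<close>

definition winning_strategy ::
  "real \<Rightarrow> 'a::euclidean_space set \<Rightarrow> 'a alice_strategy \<Rightarrow> bool" where
  "winning_strategy \<beta> S \<sigma> \<longleftrightarrow>
     (\<forall>B n. play_upto \<beta> \<sigma> B n \<longrightarrow> alice_legal \<beta> (B n) (alice_reply \<sigma> B n)) \<and>
     (\<forall>B. (\<forall>n. play_upto \<beta> \<sigma> B n) \<longrightarrow>
        \<not> ((\<lambda>n. snd (B n)) \<longlonglongrightarrow> 0) \<or> (\<Inter>n. ball_of (B n)) \<inter> S \<noteq> {})"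

definition beta_HAW :: "real \<Rightarrow> 'a::euclidean_space set \<Rightarrow> bool" where
  "beta_HAW \<beta> S \<longleftrightarrow> (\<exists>\<sigma>. winning_strategy \<beta> S \<sigma>)"

definition HAW :: "'a::euclidean_space set \<Rightarrow> bool" where
  "HAW S \<longleftrightarrow> (\<forall>\<beta>. 0 < \<beta> \<and> \<beta> < 1/3 \<longrightarrow> beta_HAW \<beta> S)"


section \<open>Hausdorff dimension\<close>

text \<open>
  The value of diam(U) to the power s, with the usual conventions for s = 0 (the empty set
  counts 0, every other set counts 1); note that \<^term>\<open>0 powr 0 = (0::real)\<close> in the library.
\<close>

definition diam_pow :: "real \<Rightarrow> 'a::metric_space set \<Rightarrow> ennreal" where
  "diam_pow s U = (if U = {} then 0 else if s = 0 then 1 else ennreal (diameter U powr s))"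

text \<open>
  Boundedness is required explicitly in the covers since \<^const>\<open>diameter\<close> is only meaningful
  for bounded sets.
\<close>

definition hausdorff_premeasure :: "real \<Rightarrow> real \<Rightarrow> 'a::metric_space set \<Rightarrow> ennreal" where
  "hausdorff_premeasure s \<delta> A =
     Inf {(\<Sum>i. diam_pow s (U i)) | U :: nat \<Rightarrow> 'a set.
            A \<subseteq> (\<Union>i. U i) \<and> (\<forall>i. bounded (U i) \<and> diameter (U i) \<le> \<delta>)}"

definition hausdorff_measure :: "real \<Rightarrow> 'a::metric_space set \<Rightarrow> ennreal" where
  "hausdorff_measure s A = (SUP \<delta>\<in>{0<..}. hausdorff_premeasure s \<delta> A)"

definition hausdorff_dim :: "'a::metric_space set \<Rightarrow> ereal" where
  "hausdorff_dim A = Inf (ereal ` {s. 0 \<le> s \<and> hausdorff_measure s A = 0})"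

end

(*
  Alice plays only against a sparse sequence of scales Q.  A point is bad at scale Q if
  <q x> <q y> < c/Q for some q <= Q, i.e. if it lies in a thin rectangle around a rational
  point (p/q, r/q); inside a small ball such a rectangle is a thin vertical or horizontal
  strip.  Besides these strips she also avoids neighbourhoods of the rational lines
  a x + b y = d for which |a b| <= Q and |a x + b y - d| is of order 1/Q.  Two rational points
  that are dangerous at the same time and of comparable height q span a line of this kind that
  comes much closer to the ball than allowed, and two dangerous lines meet in a rational point
  that comes too close; since these were removed at earlier, coarser stages, every class of
  obstacles contributes at most one strip to a given ball.  The widths decay geometrically in
  the height class, relative to the radius of the ball, so the total weight of the strips is
  summable and Alice wins by always removing a line neighbourhood that lowers the potential of
  the pending strips by a constant factor.

  For the dimension, Bob answers Alice's line by choosing one of n^2 well separated balls of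
  radius 1/(36 n) times the old one away from the line.  Expanding t in [0,1) in base n^2 gives
  a family of plays whose limit points lie in the target set, and the inverse map is Hoelder
  with exponent close to 2.
*)
theory Submission
  imports Defs
begin

section \<open>The potential game\<close>

text \<open>The line through two points and the point on two lines are both cross products of
  integer triples, so the two uniqueness statements are dual: each yields an object of the other
  kind that an earlier stage must have recorded. The loop closes because the constants enter with
  different powers. Points with threshold \<open>c\<close> give lines with error of order
  \<open>c\<close>, which must stay below \<open>e\<close>; lines with error of order
  \<open>e\<close> give points whose product of errors is of order \<open>e^2\<close>, which must
  stay below \<open>c\<close>. Hence \<open>c\<close> is a multiple of \<open>e^2\<close> with
  \<open>e\<close> small. Class \<open>j\<close> has widths smaller by \<open>2^j\<close>, which
  inflates the errors: two points of class \<open>j\<close> lose \<open>4^j\<close>, absorbed by the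
  threshold for lines; two lines of class \<open>i\<close> lose \<open>64^i\<close>, absorbed by the
  ratio 256 between classes. Weights are \<gamma>-th powers of widths for a small \<gamma>. A stage
  multiplies the old weight by at most 3/4 but the \<gamma>-th power of the radius by at least 7/8,
  which leaves room for new strips. That new strips are few depends in turn on the weight bound, so
  both go through one induction.\<close>

lemma infdist_hyperplane:
  fixes a z :: "'a::euclidean_space"
  assumes "a \<noteq> 0"
  shows "infdist z {x. a \<bullet> x = b} = \<bar>a \<bullet> z - b\<bar> / norm a"
proof (rule antisym)
  let ?H = "{x. a \<bullet> x = b}"
  let ?y = "z - ((a \<bullet> z - b) / (a \<bullet> a)) *\<^sub>R a"
  have y: "?y \<in> ?H" using assms by (simp add: inner_diff_right)
  have "infdist z ?H \<le> dist z ?y" by (rule infdist_le[OF y])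
  also have "\<dots> = \<bar>a \<bullet> z - b\<bar> / norm a"
    using assms by (simp add: dist_norm power2_norm_eq_inner[symmetric] power2_eq_square)
  finally show "infdist z ?H \<le> \<bar>a \<bullet> z - b\<bar> / norm a" .
  have ne: "?H \<noteq> {}" using y by blast
  show "\<bar>a \<bullet> z - b\<bar> / norm a \<le> infdist z ?H"
    unfolding infdist_notempty[OF ne]
  proof (rule cINF_greatest[OF ne])
    fix x assume x: "x \<in> ?H"
    have "\<bar>a \<bullet> z - b\<bar> = \<bar>a \<bullet> (z - x)\<bar>" using x by (simp add: inner_diff_right)
    also have "\<dots> \<le> norm a * dist z x"
      unfolding dist_norm by (rule Cauchy_Schwarz_ineq2)
    finally show "\<bar>a \<bullet> z - b\<bar> / norm a \<le> dist z x"
      using assms by (simp add: divide_le_eq mult.commute)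
  qed
qed

lemma in_hyperplane_nbhd_iff:
  fixes a z :: "'a::euclidean_space"
  assumes "a \<noteq> 0"
  shows "z \<in> hyperplane_nbhd {x. a \<bullet> x = b} r \<longleftrightarrow> \<bar>a \<bullet> z - b\<bar> \<le> r * norm a"
  using assms by (simp add: hyperplane_nbhd_def infdist_hyperplane divide_le_eq)

lemma affine_hyperplaneI: "a \<noteq> 0 \<Longrightarrow> affine_hyperplane {z. a \<bullet> z = b}"
  unfolding affine_hyperplane_def by blast

definition meets :: "'a::euclidean_space alice_move \<Rightarrow> 'a bob_move \<Rightarrow> bool" where
  "meets A D \<longleftrightarrow> ball_of D \<inter> nbhd_of A \<noteq> {}"

lemma meets_mono: "meets A D' \<Longrightarrow> ball_of D' \<subseteq> ball_of D \<Longrightarrow> meets A D"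
  unfolding meets_def by blast

text \<open>In the orthogonal basis \<open>m\<close>, \<open>m'\<close> (the rotated normal) both
  difference vectors have a component of size at most \<open>2 * h\<close> along \<open>m\<close>
  and at most \<open>2 * \<rho>\<close> along \<open>m'\<close>. The determinant is a difference of
  two products of such components.\<close>

lemma line_near_three_points:
  fixes m z1 z2 z3 :: "real \<times> real"
  assumes "m \<noteq> 0"
    and near: "\<bar>m \<bullet> z1 - b\<bar> \<le> h * norm m" "\<bar>m \<bullet> z2 - b\<bar> \<le> h * norm m" "\<bar>m \<bullet> z3 - b\<bar> \<le> h * norm m"
    and d: "dist z1 z2 \<le> 2 * \<rho>" "dist z1 z3 \<le> 2 * \<rho>"
  shows "\<bar>(fst z2 - fst z1) * (snd z3 - snd z1) - (snd z2 - snd z1) * (fst z3 - fst z1)\<bar> \<le> 8 * h * \<rho>"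
proof -
  define u v where "u = z2 - z1" and "v = z3 - z1"
  define m' where "m' = (- snd m, fst m)"
  have nm': "norm m' = norm m" by (simp add: m'_def norm_prod_def add.commute)
  have nm: "norm m > 0" using assms by simp
  have mu: "\<bar>m \<bullet> u\<bar> \<le> 2 * h * norm m" and mv: "\<bar>m \<bullet> v\<bar> \<le> 2 * h * norm m"
    using near by (auto simp: u_def v_def inner_diff_right)
  have m'u: "\<bar>m' \<bullet> u\<bar> \<le> norm m * (2 * \<rho>)" and m'v: "\<bar>m' \<bullet> v\<bar> \<le> norm m * (2 * \<rho>)"
    using Cauchy_Schwarz_ineq2[of m' u] Cauchy_Schwarz_ineq2[of m' v] d nm
    by (auto simp: nm' u_def v_def dist_norm norm_minus_commute
        elim!: order_trans intro!: mult_left_mono)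
  have h: "0 \<le> h * norm m" using near(1) by linarith
  have \<rho>: "0 \<le> \<rho> * norm m" using d(1) zero_le_dist[of z1 z2] by (intro mult_nonneg_nonneg) (linarith | simp)+
  let ?det = "fst u * snd v - snd u * fst v"
  have "norm m ^ 2 = fst m ^ 2 + snd m ^ 2" by (simp add: norm_prod_def)
  then have "norm m ^ 2 * ?det = (m \<bullet> u) * (m' \<bullet> v) - (m' \<bullet> u) * (m \<bullet> v)"
    by (simp only: inner_prod_def m'_def) (simp add: algebra_simps power2_eq_square)
  then have "norm m ^ 2 * \<bar>?det\<bar> = \<bar>(m \<bullet> u) * (m' \<bullet> v) - (m' \<bullet> u) * (m \<bullet> v)\<bar>"
    by (metis abs_mult abs_power2)
  also have "\<dots> \<le> \<bar>m \<bullet> u\<bar> * \<bar>m' \<bullet> v\<bar> + \<bar>m' \<bullet> u\<bar> * \<bar>m \<bullet> v\<bar>"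
    by (metis abs_mult abs_triangle_ineq4)
  also have "\<dots> \<le> (2 * h * norm m) * (norm m * (2 * \<rho>)) + (norm m * (2 * \<rho>)) * (2 * h * norm m)"
    using mu mv m'u m'v h \<rho> by (intro add_mono mult_mono) (auto simp: mult_ac)
  also have "\<dots> = norm m ^ 2 * (8 * h * \<rho>)" by (simp add: power2_eq_square)
  finally have "\<bar>?det\<bar> \<le> 8 * h * \<rho>" using nm by simp
  then show ?thesis by (simp add: u_def v_def)
qed

lemma near_centre_of_meets:
  fixes m :: "'a::euclidean_space"
  assumes "m \<noteq> 0" "meets ({z. m \<bullet> z = b}, r) D" "snd D \<le> h" "r \<le> h"
  shows "\<bar>m \<bullet> fst D - b\<bar> \<le> 2 * h * norm m"
proof -
  obtain w where w: "dist (fst D) w \<le> snd D" "\<bar>m \<bullet> w - b\<bar> \<le> r * norm m"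
    using assms(2) by (auto simp: meets_def ball_of_def nbhd_of_def in_hyperplane_nbhd_iff[OF assms(1)])
  have "\<bar>m \<bullet> fst D - b\<bar> \<le> \<bar>m \<bullet> w - b\<bar> + \<bar>m \<bullet> (fst D - w)\<bar>"
    by (simp add: inner_diff_right)
  also have "\<dots> \<le> r * norm m + norm m * snd D"
    using w Cauchy_Schwarz_ineq2[of m "fst D - w"]
      mult_left_mono[OF w(1), of "norm m"] by (simp add: dist_norm)
  also have "\<dots> \<le> h * norm m + norm m * h"
    using assms by (intro add_mono mult_left_mono mult_right_mono) auto
  finally show ?thesis by (simp add: mult_ac)
qed

lemma sum_Un_le:
  fixes f :: "'a \<Rightarrow> real"
  assumes "finite A" "finite B" "\<And>x. x \<in> A \<inter> B \<Longrightarrow> 0 \<le> f x"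
  shows "sum f (A \<union> B) \<le> sum f A + sum f B"
  using sum.union_inter[OF assms(1,2), of f] sum_nonneg[of "A \<inter> B" f, OF assms(3)] by linarith

text \<open>
  If every choice of the line failed, three successive failures would give three balls whose
  centres span a triangle of area bounded below although a common thin strip meets all of them.
\<close>

lemma potential_drop:
  fixes P :: "(real \<times> real) alice_move set" and w :: "(real \<times> real) alice_move \<Rightarrow> real"
  assumes fin: "finite P"
    and P: "\<And>A. A \<in> P \<Longrightarrow> affine_hyperplane (fst A) \<and> snd A \<le> \<beta>' * \<rho>"
    and w: "\<And>A. A \<in> P \<Longrightarrow> 0 \<le> w A"
    and pos: "0 < \<beta>" "0 < \<rho>" "0 < \<beta>'" "17 * \<beta>' \<le> \<beta>\<^sup>2"
  shows "\<exists>L. affine_hyperplane L \<and>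
    (\<forall>D. 0 < snd D \<longrightarrow> snd D \<le> \<beta>' * \<rho> \<longrightarrow> ball_of D \<subseteq> cball c \<rho> - hyperplane_nbhd L (\<beta> * \<rho>) \<longrightarrow>
      sum w {A \<in> P. meets A D} \<le> 3/4 * sum w P)"
proof (rule ccontr)
  assume contr: "\<not> ?thesis"
  have ex: "\<exists>D. 0 < snd D \<and> snd D \<le> \<beta>' * \<rho> \<and> fst D \<in> cball c \<rho>
      \<and> fst D \<notin> hyperplane_nbhd L (\<beta> * \<rho>)
      \<and> sum w {A \<in> P. meets A D} > 3/4 * sum w P" if L: "affine_hyperplane L" for L
  proof -
    obtain D where D: "0 < snd D" "snd D \<le> \<beta>' * \<rho>"
        "ball_of D \<subseteq> cball c \<rho> - hyperplane_nbhd L (\<beta> * \<rho>)"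
        "sum w {A \<in> P. meets A D} > 3/4 * sum w P"
      using contr L unfolding not_ex de_Morgan_conj not_all not_imp not_le by blast
    have "fst D \<in> ball_of D" using D by (simp add: ball_of_def)
    then show ?thesis using D by blast
  qed
  \<comment> \<open>The first line is arbitrary. The second is the vertical line through
    \<open>z1\<close>, which keeps \<open>z2\<close> farther than \<open>\<beta> * \<rho>\<close>
    from \<open>z1\<close>. The third is the line through \<open>z1\<close> and \<open>z2\<close>,
    so twice the area of the triangle exceeds the square of \<open>\<beta> * \<rho>\<close>.\<close>
  obtain D1 where D1: "0 < snd D1" "snd D1 \<le> \<beta>' * \<rho>" "fst D1 \<in> cball c \<rho>"
      "sum w {A \<in> P. meets A D1} > 3/4 * sum w P"
    using ex[OF affine_hyperplaneI[of "(1,0)" 0]] by (auto simp: zero_prod_def)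
  define z1 where "z1 = fst D1"
  obtain D2 where D2: "0 < snd D2" "snd D2 \<le> \<beta>' * \<rho>" "fst D2 \<in> cball c \<rho>"
      "fst D2 \<notin> hyperplane_nbhd {z. (1,0) \<bullet> z = (1,0) \<bullet> z1} (\<beta> * \<rho>)"
      "sum w {A \<in> P. meets A D2} > 3/4 * sum w P"
    using ex[OF affine_hyperplaneI[of "(1,0)" "(1,0) \<bullet> z1"]] by (auto simp: zero_prod_def)
  define z2 where "z2 = fst D2"
  have d12: "dist z1 z2 > \<beta> * \<rho>"
  proof -
    have "\<bar>(1,0) \<bullet> z2 - (1,0) \<bullet> z1\<bar> > \<beta> * \<rho>"
      using D2(4) by (subst (asm) in_hyperplane_nbhd_iff) (auto simp: zero_prod_def z2_def norm_prod_def)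
    moreover have "\<bar>(1,0) \<bullet> z2 - (1,0) \<bullet> z1\<bar> \<le> dist z1 z2"
      using Cauchy_Schwarz_ineq2[of "(1::real,0::real)" "z2 - z1"]
      by (simp add: inner_diff_right dist_norm norm_minus_commute)
    ultimately show ?thesis by linarith
  qed
  define n where "n = (snd z1 - snd z2, fst z2 - fst z1)"
  have nn: "norm n = dist z1 z2"
    using power2_commute[of "fst z1" "fst z2"]
    by (simp add: n_def norm_prod_def dist_prod_def dist_real_def add.commute)
  have n0: "n \<noteq> 0" using nn d12 pos by (metis mult_pos_pos norm_zero order_less_asym)
  obtain D3 where D3: "0 < snd D3" "snd D3 \<le> \<beta>' * \<rho>" "fst D3 \<in> cball c \<rho>"
      "fst D3 \<notin> hyperplane_nbhd {z. n \<bullet> z = n \<bullet> z1} (\<beta> * \<rho>)"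
      "sum w {A \<in> P. meets A D3} > 3/4 * sum w P"
    using ex[OF affine_hyperplaneI[OF n0, of "n \<bullet> z1"]] by auto
  define z3 where "z3 = fst D3"
  have "\<bar>n \<bullet> z3 - n \<bullet> z1\<bar> > \<beta> * \<rho> * norm n"
    using D3(4) by (simp add: in_hyperplane_nbhd_iff[OF n0] z3_def)
  moreover have "\<beta> * \<rho> * norm n \<ge> \<beta> * \<rho> * (\<beta> * \<rho>)"
    using pos d12 nn by (intro mult_left_mono) auto
  moreover have "n \<bullet> z3 - n \<bullet> z1 = (fst z2 - fst z1) * (snd z3 - snd z1) - (snd z2 - snd z1) * (fst z3 - fst z1)"
    by (simp add: n_def inner_prod_def algebra_simps)
  ultimately have big: "\<bar>(fst z2 - fst z1) * (snd z3 - snd z1) - (snd z2 - snd z1) * (fst z3 - fst z1)\<bar> > \<beta>\<^sup>2 * \<rho>\<^sup>2"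
    by (simp add: power2_eq_square mult_ac)
  have split: "sum w P = sum w {A \<in> P. meets A D} + sum w {A \<in> P. \<not> meets A D}" for D
    by (subst sum.union_disjoint[symmetric]) (auto intro!: sum.cong fin finite_subset[OF _ fin])
  \<comment> \<open>Each ball misses strips of less than a quarter of the total weight, so the three
    missed families cannot exhaust \<open>P\<close>.\<close>
  have "\<exists>A\<in>P. meets A D1 \<and> meets A D2 \<and> meets A D3"
  proof (rule ccontr)
    assume none: "\<not> ?thesis"
    let ?N = "\<lambda>D. {A \<in> P. \<not> meets A D}"
    have "sum w P \<le> sum w (?N D1 \<union> ?N D2 \<union> ?N D3)"
      using none by (intro sum_mono2) (auto simp: fin w)
    also have "\<dots> \<le> sum w (?N D1 \<union> ?N D2) + sum w (?N D3)"
      by (rule sum_Un_le) (auto simp: fin w)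
    also have "\<dots> \<le> sum w (?N D1) + sum w (?N D2) + sum w (?N D3)"
      using sum_Un_le[of "?N D1" "?N D2" w] by (auto simp: fin w)
    finally show False
      using split[of D1] split[of D2] split[of D3] D1(4) D2(5) D3(5) sum_nonneg[of P w, OF w] by linarith
  qed
  then obtain A where A: "A \<in> P" "meets A D1" "meets A D2" "meets A D3" by blast
  obtain m b where m: "m \<noteq> 0" "fst A = {z. m \<bullet> z = b}" and r: "snd A \<le> \<beta>' * \<rho>"
    using P[OF A(1)] by (auto simp: affine_hyperplane_def)
  have A': "A = ({z. m \<bullet> z = b}, snd A)" using m by (metis prod.collapse)
  have near: "\<bar>m \<bullet> fst D - b\<bar> \<le> 2 * (\<beta>' * \<rho>) * norm m" if "meets A D" "snd D \<le> \<beta>' * \<rho>" for D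
    using near_centre_of_meets[OF m(1) _ that(2) r, of b] that(1) A' by metis
  have dd: "dist x y \<le> 2 * \<rho>" if "x \<in> cball c \<rho>" "y \<in> cball c \<rho>" for x y
    using that dist_triangle3[of x y c] by (auto simp: dist_commute)
  have "\<bar>(fst z2 - fst z1) * (snd z3 - snd z1) - (snd z2 - snd z1) * (fst z3 - fst z1)\<bar>
      \<le> 8 * (2 * (\<beta>' * \<rho>)) * \<rho>"
    unfolding z1_def z2_def z3_def using A D1 D2 D3
    by (intro line_near_three_points[OF m(1), where b = b] dd near) auto
  also have "\<dots> = 16 * \<beta>' * \<rho>\<^sup>2" by (simp add: power2_eq_square)
  also have "\<dots> \<le> \<beta>\<^sup>2 * \<rho>\<^sup>2" using pos by (intro mult_right_mono) auto
  finally show False using big by linarith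
qed

text \<open>
  Stages are the moments at which Bob's radius has dropped below a fixed fraction of its value at
  the previous stage; in between, Alice's moves are irrelevant.
\<close>

definition stages :: "real \<Rightarrow> (nat \<Rightarrow> 'a::euclidean_space bob_move) \<Rightarrow> nat \<Rightarrow> bool" where
  "stages \<beta> D k \<longleftrightarrow> 0 < snd (D 0) \<and> (\<forall>j<k. ball_of (D (Suc j)) \<subseteq> ball_of (D j) \<and>
     \<beta>^3 / 17 * snd (D j) \<le> snd (D (Suc j)) \<and> snd (D (Suc j)) \<le> \<beta>\<^sup>2 / 17 * snd (D j))"

lemma stages_mono: "stages \<beta> D k \<Longrightarrow> j \<le> k \<Longrightarrow> stages \<beta> D j"
  by (auto simp: stages_def)

lemma stages_pos:
  assumes "stages \<beta> D k" "0 < \<beta>" "j \<le> k"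
  shows "0 < snd (D j)"
  using assms(3)
proof (induction j)
  case 0
  then show ?case using assms by (simp add: stages_def)
next
  case (Suc j)
  then have "0 < \<beta>^3 / 17 * snd (D j)" using assms by simp
  then show ?case using Suc assms(1) by (auto simp: stages_def Suc_le_eq intro: less_le_trans)
qed

lemma stages_subset:
  assumes "stages \<beta> D k" "j \<le> i" "i \<le> k"
  shows "ball_of (D i) \<subseteq> ball_of (D j)"
  using assms(2,3)
proof (induction i rule: dec_induct)
  case (step n)
  then have "ball_of (D (Suc n)) \<subseteq> ball_of (D n)" using assms(1) by (simp add: stages_def)
  then show ?case using step by simp
qed simp

primrec pending ::
  "('a::euclidean_space bob_move \<Rightarrow> 'a alice_move set) \<Rightarrow> (nat \<Rightarrow> 'a bob_move) \<Rightarrow> nat \<Rightarrow> 'a alice_move set"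
where
  "pending N D 0 = N (D 0)"
| "pending N D (Suc k) = {A \<in> pending N D k. meets A (D (Suc k))} \<union> N (D (Suc k))"

lemma mem_pending:
  assumes "stages \<beta> D k" "j \<le> k" "A \<in> N (D j)" "meets A (D k)"
  shows "A \<in> pending N D k"
  using assms(2,1,4)
proof (induction k rule: dec_induct)
  case base
  then show ?case using assms(3) by (cases j) auto
next
  case (step n)
  then have "meets A (D n)"
    by (meson meets_mono stages_subset le_SucI order_refl)
  then have "A \<in> pending N D n" using step stages_mono by (metis le_SucI order_refl)
  then show ?case using step by simp
qed

lemma pending_subset: "pending N D k \<subseteq> (\<Union>j\<le>k. N (D j))"
proof (induction k)
  case (Suc k)
  then show ?case unfolding pending.simps atMost_Suc by blast
qed simp

definition drop_line ::
  "real \<Rightarrow> real \<Rightarrow> 'a::euclidean_space bob_move \<Rightarrow> 'a alice_move set \<Rightarrow> 'a set \<Rightarrow> bool" where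
  "drop_line \<beta> \<gamma> D P L \<longleftrightarrow> (\<forall>D'. 0 < snd D' \<longrightarrow> snd D' \<le> \<beta>\<^sup>2 / 17 * snd D \<longrightarrow>
     ball_of D' \<subseteq> ball_of D - hyperplane_nbhd L (\<beta> * snd D) \<longrightarrow>
     (\<Sum>A\<in>{A \<in> P. meets A D'}. snd A powr \<gamma>) \<le> 3/4 * (\<Sum>A\<in>P. snd A powr \<gamma>))"

text \<open>The implication under \<open>SOME\<close> keeps the choice a hyperplane even if no line
  lowers the potential: legality is required in every play, whereas a lowering line is obtained only
  from the weight bound.\<close>

definition chosen_line ::
  "real \<Rightarrow> real \<Rightarrow> 'a::euclidean_space bob_move \<times> 'a alice_move set \<Rightarrow> 'a set" where
  "chosen_line \<beta> \<gamma> s = (SOME L. affine_hyperplane L \<and>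
     ((\<exists>L'. affine_hyperplane L' \<and> drop_line \<beta> \<gamma> (fst s) (snd s) L') \<longrightarrow> drop_line \<beta> \<gamma> (fst s) (snd s) L))"

lemma chosen_line:
  "affine_hyperplane (chosen_line \<beta> \<gamma> s)"
  "affine_hyperplane L' \<Longrightarrow> drop_line \<beta> \<gamma> (fst s) (snd s) L' \<Longrightarrow>
    drop_line \<beta> \<gamma> (fst s) (snd s) (chosen_line \<beta> \<gamma> s)"
proof -
  have hyp: "\<exists>L::'a set. affine_hyperplane L"
    using affine_hyperplaneI nonzero_Basis SOME_Basis by blast
  have "\<exists>L. affine_hyperplane L \<and>
     ((\<exists>L'. affine_hyperplane L' \<and> drop_line \<beta> \<gamma> (fst s) (snd s) L') \<longrightarrow> drop_line \<beta> \<gamma> (fst s) (snd s) L)"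
    using hyp by blast
  from someI_ex[OF this, folded chosen_line_def]
  show "affine_hyperplane (chosen_line \<beta> \<gamma> s)"
    "affine_hyperplane L' \<Longrightarrow> drop_line \<beta> \<gamma> (fst s) (snd s) L' \<Longrightarrow>
    drop_line \<beta> \<gamma> (fst s) (snd s) (chosen_line \<beta> \<gamma> s)"
    by blast+
qed

text \<open>
  Along the stages the total weight of the pending strips stays below a fixed multiple of the
  corresponding power of the radius, so a strip that is never discarded has width zero.
\<close>

lemma pending_weight:
  fixes D :: "nat \<Rightarrow> (real \<times> real) bob_move"
  assumes \<beta>: "0 < \<beta>" and \<gamma>: "0 < \<gamma>" "7/8 \<le> (\<beta>^3/17) powr \<gamma>"
    and \<eta>: "0 < \<eta>" "\<eta> \<le> (\<beta>\<^sup>2/17) powr \<gamma>" "\<eta> \<le> 1"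
    and D: "stages \<beta> D k"
    and avoid: "\<And>j. j < k \<Longrightarrow> ball_of (D (Suc j)) \<inter> hyperplane_nbhd (chosen_line \<beta> \<gamma> (D j, pending N D j)) (\<beta> * snd (D j)) = {}"
    and Npos: "\<And>D A. A \<in> N D \<Longrightarrow> affine_hyperplane (fst A) \<and> 0 < snd A"
    and N: "\<And>i. i \<le> k \<Longrightarrow> (\<And>j A. j < i \<Longrightarrow> A \<in> N (D j) \<Longrightarrow> meets A (D i) \<Longrightarrow> snd A < snd (D i)) \<Longrightarrow>
        finite (N (D i)) \<and> (\<Sum>A\<in>N (D i). snd A powr \<gamma>) \<le> \<eta> / 8 * snd (D i) powr \<gamma>"
  shows "finite (pending N D k) \<and> (\<Sum>A\<in>pending N D k. snd A powr \<gamma>) \<le> \<eta> * snd (D k) powr \<gamma>"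
  using D avoid N
proof (induction k)
  case 0
  then have "finite (N (D 0)) \<and> (\<Sum>A\<in>N (D 0). snd A powr \<gamma>) \<le> \<eta> / 8 * snd (D 0) powr \<gamma>" by simp
  moreover have "\<eta> / 8 * snd (D 0) powr \<gamma> \<le> \<eta> * snd (D 0) powr \<gamma>"
    using \<eta> by (intro mult_right_mono) auto
  ultimately show ?case by auto
next
  case (Suc k)
  let ?P = "pending N D k" and ?\<sigma> = "snd (D k)" and ?\<sigma>' = "snd (D (Suc k))"
  let ?w = "\<lambda>A :: (real \<times> real) alice_move. snd A powr \<gamma>"
  let ?O = "{A \<in> ?P. meets A (D (Suc k))}"
  have st: "stages \<beta> D k" using Suc.prems(1) stages_mono by (metis le_SucI order_refl)
  have IH: "finite ?P" "sum ?w ?P \<le> \<eta> * ?\<sigma> powr \<gamma>"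
    using Suc.IH[OF st] Suc.prems(2,3) by auto
  have \<sigma>: "0 < ?\<sigma>" "0 < ?\<sigma>'" using stages_pos[OF Suc.prems(1) \<beta>] by auto
  have step: "ball_of (D (Suc k)) \<subseteq> ball_of (D k)" "\<beta>^3/17 * ?\<sigma> \<le> ?\<sigma>'" "?\<sigma>' \<le> \<beta>\<^sup>2/17 * ?\<sigma>"
    using Suc.prems(1) by (auto simp: stages_def)
  have Ppos: "affine_hyperplane (fst A) \<and> 0 < snd A" if "A \<in> ?P" for A
    using that pending_subset[of N D k] Npos by blast
  \<comment> \<open>One strip weighs at most as much as all of them; the second bound on \<eta>
    converts this into the width limit that \<open>potential_drop\<close> requires.\<close>
  have thin: "snd A \<le> \<beta>\<^sup>2/17 * ?\<sigma>" if "A \<in> ?P" for A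
  proof (rule ccontr)
    assume "\<not> ?thesis"
    then have "(\<beta>\<^sup>2/17 * ?\<sigma>) powr \<gamma> < ?w A" using \<gamma> \<beta> \<sigma> by (intro powr_less_mono2) auto
    also have "?w A \<le> sum ?w ?P" using that IH(1) by (intro member_le_sum) simp_all
    also have "\<dots> \<le> (\<beta>\<^sup>2/17) powr \<gamma> * ?\<sigma> powr \<gamma>"
      using IH(2) \<eta> by (meson mult_right_mono order_trans powr_ge_zero)
    also have "\<dots> = (\<beta>\<^sup>2/17 * ?\<sigma>) powr \<gamma>" using \<beta> \<sigma> by (subst powr_mult) auto
    finally show False by simp
  qed
  have "\<exists>L. affine_hyperplane L \<and> drop_line \<beta> \<gamma> (D k) ?P L"
    using potential_drop[of ?P "\<beta>\<^sup>2/17" ?\<sigma> ?w \<beta> "fst (D k)"] IH Ppos thin \<beta> \<sigma>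
    by (auto simp: drop_line_def ball_of_def)
  then have drop: "drop_line \<beta> \<gamma> (D k) ?P (chosen_line \<beta> \<gamma> (D k, ?P))"
    using chosen_line(2)[of _ \<beta> \<gamma> "(D k, ?P)"] by auto
  have "sum ?w ?O \<le> 3/4 * sum ?w ?P"
  proof -
    have "ball_of (D (Suc k)) \<subseteq>
        ball_of (D k) - hyperplane_nbhd (chosen_line \<beta> \<gamma> (D k, ?P)) (\<beta> * ?\<sigma>)"
      using step(1) Suc.prems(2)[of k] by blast
    then show ?thesis using drop[unfolded drop_line_def, rule_format, of "D (Suc k)"] step \<sigma> by simp
  qed
  also have "\<dots> \<le> 3/4 * (\<eta> * ?\<sigma> powr \<gamma>)" using IH by simp
  \<comment> \<open>The \<gamma>-th power of the radius loses at most the factor 7/8 per stage, and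
    3/4 times 8/7 is 6/7. New strips may add 1/8, and 6/7 + 1/8 < 1.\<close>
  also have "\<dots> \<le> 6/7 * (\<eta> * ?\<sigma>' powr \<gamma>)"
  proof -
    have "7/8 * ?\<sigma> powr \<gamma> \<le> (\<beta>^3/17) powr \<gamma> * ?\<sigma> powr \<gamma>"
      using \<gamma> by (intro mult_right_mono) auto
    also have "\<dots> = (\<beta>^3/17 * ?\<sigma>) powr \<gamma>" using \<beta> \<sigma> by (subst powr_mult) auto
    also have "\<dots> \<le> ?\<sigma>' powr \<gamma>" using step \<gamma> \<beta> \<sigma> by (intro powr_mono2) auto
    finally have "\<eta> * (7/8 * ?\<sigma> powr \<gamma>) \<le> \<eta> * ?\<sigma>' powr \<gamma>" using \<eta> by (intro mult_left_mono) auto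
    then show ?thesis by simp
  qed
  finally have old: "sum ?w ?O \<le> 6/7 * (\<eta> * ?\<sigma>' powr \<gamma>)" .
  \<comment> \<open>This is the premise under which \<open>N\<close> bounds the new obstacles. It
    therefore has to come from the weight of the old strips alone, before the new ones are
    added.\<close>
  have small: "snd A < ?\<sigma>'" if "j < Suc k" "A \<in> N (D j)" "meets A (D (Suc k))" for j A
  proof (rule ccontr)
    assume thick: "\<not> ?thesis"
    have "meets A (D k)" using that(3) step(1) by (rule meets_mono)
    then have "A \<in> ?P" using that(1,2) by (intro mem_pending[OF st]) simp_all
    then have "A \<in> ?O" using that by simp
    then have "?w A \<le> sum ?w ?O" using IH(1) by (intro member_le_sum) simp_all
    also note old
    also have "6/7 * (\<eta> * ?\<sigma>' powr \<gamma>) \<le> 6/7 * (1 * ?\<sigma>' powr \<gamma>)"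
      using \<eta>(3) by (intro mult_left_mono mult_right_mono) auto
    also have "\<dots> < ?\<sigma>' powr \<gamma>" using \<sigma> by simp
    also have "\<dots> \<le> ?w A" using thick \<sigma> \<gamma> by (intro powr_mono2) auto
    finally show False by simp
  qed
  have new: "finite (N (D (Suc k)))" "sum ?w (N (D (Suc k))) \<le> \<eta> / 8 * ?\<sigma>' powr \<gamma>"
    using Suc.prems(3)[of "Suc k"] small by auto
  have "sum ?w (pending N D (Suc k)) \<le> sum ?w ?O + sum ?w (N (D (Suc k)))"
    using IH new by (auto intro!: sum_Un_le)
  also have "\<dots> \<le> 6/7 * (\<eta> * ?\<sigma>' powr \<gamma>) + 1/8 * (\<eta> * ?\<sigma>' powr \<gamma>)" using old new by simp
  also have "\<dots> \<le> \<eta> * ?\<sigma>' powr \<gamma>" using \<eta> by (simp add: field_simps)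
  finally show ?case using IH new by simp
qed

section \<open>The strategy of Alice as a function of the history\<close>

definition step ::
  "real \<Rightarrow> ('a::euclidean_space bob_move \<Rightarrow> 'a alice_move set) \<Rightarrow>
    'a bob_move \<times> 'a alice_move set \<Rightarrow> 'a bob_move \<Rightarrow> 'a bob_move \<times> 'a alice_move set" where
  "step \<beta> N s b = (if snd b \<le> \<beta>\<^sup>2 / 17 * snd (fst s)
     then (b, {A \<in> snd s. meets A b} \<union> N b) else s)"

text \<open>A strategy sees only the list of Bob's moves, so the current stage ball and its pending
  strips are recomputed by a fold; balls too large to open a new stage leave the state
  unchanged.\<close>

definition state ::
  "real \<Rightarrow> (real \<Rightarrow> 'a::euclidean_space bob_move \<Rightarrow> 'a alice_move set) \<Rightarrow>
    'a bob_move list \<Rightarrow> 'a bob_move \<times> 'a alice_move set" where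
  "state \<beta> N h = foldl (step \<beta> (N (snd (hd h)))) (hd h, N (snd (hd h)) (hd h)) (tl h)"

lemma state_play:
  "state \<beta> N (map B [0..<Suc 0]) = (B 0, N (snd (B 0)) (B 0))"
  "state \<beta> N (map B [0..<Suc (Suc n)]) =
    step \<beta> (N (snd (B 0))) (state \<beta> N (map B [0..<Suc n])) (B (Suc n))"
proof -
  show "state \<beta> N (map B [0..<Suc 0]) = (B 0, N (snd (B 0)) (B 0))"
    by (simp add: state_def)
  have "map B [0..<Suc (Suc n)] = map B [0..<Suc n] @ [B (Suc n)]" by simp
  moreover have "hd (map B [0..<Suc n]) = B 0" "map B [0..<Suc n] \<noteq> []"
    by (simp_all add: hd_map del: upt_Suc)
  ultimately show "state \<beta> N (map B [0..<Suc (Suc n)]) =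
    step \<beta> (N (snd (B 0))) (state \<beta> N (map B [0..<Suc n])) (B (Suc n))"
    by (simp add: state_def del: upt_Suc)
qed

definition potential_strategy ::
  "real \<Rightarrow> real \<Rightarrow> (real \<Rightarrow> 'a::euclidean_space bob_move \<Rightarrow> 'a alice_move set) \<Rightarrow> 'a alice_strategy" where
  "potential_strategy \<beta> \<gamma> N h = (chosen_line \<beta> \<gamma> (state \<beta> N h), \<beta> * snd (last h))"

primrec stage_time :: "real \<Rightarrow> (nat \<Rightarrow> 'a bob_move) \<Rightarrow> nat \<Rightarrow> nat" where
  "stage_time \<beta> B 0 = 0"
| "stage_time \<beta> B (Suc k) =
    (LEAST n. stage_time \<beta> B k < n \<and> snd (B n) \<le> \<beta>\<^sup>2 / 17 * snd (B (stage_time \<beta> B k)))"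

lemma play_pos:
  assumes "play_upto \<beta> \<sigma> B n" "0 < \<beta>" "j \<le> n"
  shows "0 < snd (B j)"
  using assms(3)
proof (induction j)
  case 0
  then show ?case using assms by (simp add: play_upto_def)
next
  case (Suc j)
  then have "0 < \<beta> * snd (B j)" using assms by simp
  also have "\<dots> \<le> snd (B (Suc j))"
    using Suc assms by (simp add: play_upto_def bob_legal_def Suc_le_eq)
  finally show ?case .
qed

text \<open>Let \<open>z\<close> be a common point of Bob's balls. A recorded neighbourhood
  containing \<open>z\<close> would meet every later stage ball and stay pending forever, although
  its weight is at most \<eta> times powers of radii that tend to 0. \<open>N\<close> receives the
  first radius because the scales to be watched depend on it.\<close>

lemma potential_game:
  fixes S :: "(real \<times> real) set"
  assumes \<beta>: "0 < \<beta>" "\<beta> < 1/3" and \<gamma>: "0 < \<gamma>" "7/8 \<le> (\<beta>^3/17) powr \<gamma>"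
    and \<eta>: "0 < \<eta>" "\<eta> \<le> (\<beta>\<^sup>2/17) powr \<gamma>" "\<eta> \<le> 1"
    and Npos: "\<And>\<rho> D A. 0 < \<rho> \<Longrightarrow> A \<in> N \<rho> D \<Longrightarrow> affine_hyperplane (fst A) \<and> 0 < snd A"
    and N: "\<And>D k. stages \<beta> D k \<Longrightarrow>
        (\<And>j A. j < k \<Longrightarrow> A \<in> N (snd (D 0)) (D j) \<Longrightarrow> meets A (D k) \<Longrightarrow> snd A < snd (D k)) \<Longrightarrow>
        finite (N (snd (D 0)) (D k)) \<and>
        (\<Sum>A\<in>N (snd (D 0)) (D k). snd A powr \<gamma>) \<le> \<eta> / 8 * snd (D k) powr \<gamma>"
    and S: "\<And>D z. (\<And>k. stages \<beta> D k) \<Longrightarrow> (\<And>k. z \<in> ball_of (D k)) \<Longrightarrow>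
        (\<And>k A. A \<in> N (snd (D 0)) (D k) \<Longrightarrow> z \<notin> nbhd_of A) \<Longrightarrow> z \<in> S"
  shows "beta_HAW \<beta> S"
proof -
  define \<sigma> where "\<sigma> = potential_strategy \<beta> \<gamma> N"
  have legal: "alice_legal \<beta> (B n) (alice_reply \<sigma> B n)" if "play_upto \<beta> \<sigma> B n" for B n
    using chosen_line(1) play_pos[OF that \<beta>(1) order_refl] \<beta>
    by (simp add: alice_legal_def alice_reply_def \<sigma>_def potential_strategy_def)
  have win: "(\<Inter>n. ball_of (B n)) \<inter> S \<noteq> {}"
    if play: "\<And>n. play_upto \<beta> \<sigma> B n" and lim: "(\<lambda>n. snd (B n)) \<longlonglongrightarrow> 0" for B
  proof -
    have pos: "0 < snd (B n)" for n using play_pos[OF play \<beta>(1) order_refl] .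
    have leg: "bob_legal \<beta> (B n) (alice_reply \<sigma> B n) (B (Suc n))" for n
      using play[of "Suc n"] by (simp add: play_upto_def)
    have sub1: "ball_of (B (Suc n)) \<subseteq> ball_of (B n)" for n using leg[of n] by (auto simp: bob_legal_def)
    have sub: "ball_of (B n) \<subseteq> ball_of (B m)" if "m \<le> n" for m n
      using that by (induction rule: dec_induct) (use sub1 in auto)
    have "\<exists>z. z \<in> \<Inter> (range (\<lambda>n. ball_of (B n)))"
    proof -
      have "\<Inter> (range (\<lambda>n. ball_of (B n))) \<noteq> {}"
        using sub pos[THEN less_imp_le] by (intro compact_nest) (auto simp: ball_of_def not_less)
      then show ?thesis by blast
    qed
    then obtain z where z: "\<And>n. z \<in> ball_of (B n)" by blast
    define t where "t = stage_time \<beta> B"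
    define D where "D k = B (t k)" for k
    define NN where "NN = N (snd (B 0))"
    have t0: "t 0 = 0" by (simp add: t_def)
    have ex: "\<exists>n. t k < n \<and> snd (B n) \<le> \<beta>\<^sup>2/17 * snd (B (t k))" for k
    proof -
      have "eventually (\<lambda>n. snd (B n) < \<beta>\<^sup>2/17 * snd (B (t k))) sequentially"
        using pos \<beta> by (intro order_tendstoD(2)[OF lim] mult_pos_pos) auto
      then obtain m where "\<And>n. m \<le> n \<Longrightarrow> snd (B n) < \<beta>\<^sup>2/17 * snd (B (t k))"
        by (auto simp: eventually_sequentially)
      from this[of "max m (Suc (t k))"] show ?thesis
        by (intro exI[of _ "max m (Suc (t k))"]) simp
    qed
    have tSuc: "t k < t (Suc k) \<and> snd (B (t (Suc k))) \<le> \<beta>\<^sup>2/17 * snd (B (t k))" for k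
      using LeastI_ex[OF ex[of k]] by (simp add: t_def)
    have tleast: "\<beta>\<^sup>2/17 * snd (B (t k)) < snd (B n)" if "t k < n" "n < t (Suc k)" for k n
      using not_less_Least[of n "\<lambda>n. t k < n \<and> snd (B n) \<le> \<beta>\<^sup>2/17 * snd (B (t k))"] that
      by (auto simp: t_def)
    \<comment> \<open>Between two stage times the fold is frozen at the current stage.\<close>
    have state: "state \<beta> N (map B [0..<Suc n]) = (D k, pending NN D k)"
      if "t k \<le> n" "n < t (Suc k)" for k n
      using that
    proof (induction n arbitrary: k)
      case 0
      then have "k = 0" using tSuc[of "k - 1"] by (cases k) auto
      then show ?case using state_play(1)[of \<beta> N B] by (simp add: D_def NN_def t0)
    next
      case (Suc n)
      show ?case
      proof (cases "t k = Suc n")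
        case False
        then have "t k \<le> n" using Suc by simp
        then have "state \<beta> N (map B [0..<Suc n]) = (D k, pending NN D k)"
          using Suc by simp
        then show ?thesis
          using tleast[of k "Suc n"] False Suc.prems
          by (simp add: state_play(2) step_def D_def[of k] del: upt_Suc)
      next
        case True
        then obtain l where k: "k = Suc l" using t0 by (cases k) auto
        then have "state \<beta> N (map B [0..<Suc n]) = (D l, pending NN D l)"
          using Suc.IH[of l] tSuc[of l] True by simp
        then show ?thesis
          using tSuc[of l] True k
          by (simp add: state_play(2) step_def D_def[of l] D_def[of "Suc l"] NN_def del: upt_Suc)
      qed
    qed
    have stages: "stages \<beta> D k" for k
      unfolding stages_def
    proof (intro conjI allI impI)
      show "0 < snd (D 0)" using pos by (simp add: D_def)
      fix j
      show "ball_of (D (Suc j)) \<subseteq> ball_of (D j)" unfolding D_def using tSuc[of j] by (intro sub) simp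
      show "snd (D (Suc j)) \<le> \<beta>\<^sup>2 / 17 * snd (D j)" unfolding D_def using tSuc by simp
      \<comment> \<open>The ball just before a new stage has not passed the threshold
        \<open>\<beta>\<^sup>2 / 17\<close>, and one move of Bob loses at most a factor \<beta>;
        hence the cube in the lower bound.\<close>
      obtain n where n: "t (Suc j) = Suc n" "t j \<le> n" using tSuc[of j] by (metis Suc_leI less_imp_Suc_add less_Suc_eq_le)
      have "\<beta>\<^sup>2/17 * snd (B (t j)) \<le> snd (B n)"
      proof (cases "n = t j")
        case True
        have "\<beta>\<^sup>2 \<le> 1" using \<beta> by (simp add: power_le_one)
        then have "\<beta>\<^sup>2/17 * snd (B (t j)) \<le> 1 * snd (B (t j))" using pos[of "t j"] by (intro mult_right_mono) auto
        then show ?thesis using True by simp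
      qed (use tleast[of j n] n in simp)
      then have "\<beta> * (\<beta>\<^sup>2/17 * snd (B (t j))) \<le> \<beta> * snd (B n)" using \<beta> by simp
      also have "\<dots> \<le> snd (B (Suc n))" using leg[of n] by (simp add: bob_legal_def)
      finally show "\<beta>^3 / 17 * snd (D j) \<le> snd (D (Suc j))"
        by (simp add: D_def n power3_eq_cube power2_eq_square mult_ac)
    qed
    have D0: "snd (D 0) = snd (B 0)" by (simp add: D_def t0)
    \<comment> \<open>Only Alice's answer to the first ball of a stage is used: all later balls lie
      in Bob's next move, which avoids it.\<close>
    have avoid: "ball_of (D (Suc j)) \<inter> hyperplane_nbhd (chosen_line \<beta> \<gamma> (D j, pending NN D j)) (\<beta> * snd (D j)) = {}" for j
    proof -
      have "alice_reply \<sigma> B (t j) = (chosen_line \<beta> \<gamma> (D j, pending NN D j), \<beta> * snd (D j))"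
        using state[of j "t j"] tSuc[of j]
        by (simp add: alice_reply_def \<sigma>_def potential_strategy_def D_def[of j] last_map del: upt_Suc)
      moreover have "ball_of (D (Suc j)) \<subseteq> ball_of (B (Suc (t j)))"
        unfolding D_def using tSuc[of j] by (intro sub) simp
      ultimately show ?thesis using leg[of "t j"] by (auto simp: bob_legal_def nbhd_of_def)
    qed
    have weight: "finite (pending NN D k) \<and>
        (\<Sum>A\<in>pending NN D k. snd A powr \<gamma>) \<le> \<eta> * snd (D k) powr \<gamma>" for k
    proof (rule pending_weight[OF \<beta>(1) \<gamma> \<eta> stages avoid])
      show "affine_hyperplane (fst A) \<and> 0 < snd A" if "A \<in> NN D'" for D' A
        using Npos[OF pos] that by (simp add: NN_def)
      show "finite (NN (D i)) \<and> (\<Sum>A\<in>NN (D i). snd A powr \<gamma>) \<le> \<eta> / 8 * snd (D i) powr \<gamma>"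
        if "\<And>j A. j < i \<Longrightarrow> A \<in> NN (D j) \<Longrightarrow> meets A (D i) \<Longrightarrow> snd A < snd (D i)" for i
        using N[OF stages, of i] that by (simp add: NN_def D0)
    qed
    have "z \<notin> nbhd_of A" if A: "A \<in> NN (D k)" for k A
    proof
      assume zA: "z \<in> nbhd_of A"
      have bound: "snd A powr \<gamma> \<le> \<eta> * snd (D i) powr \<gamma>" if "k \<le> i" for i
      proof -
        have "meets A (D i)" using zA z by (auto simp: meets_def D_def)
        then have "A \<in> pending NN D i" using A that by (intro mem_pending[OF stages])
        then have "snd A powr \<gamma> \<le> (\<Sum>A\<in>pending NN D i. snd A powr \<gamma>)"
          using weight[of i] by (intro member_le_sum) auto
        then show ?thesis using weight[of i] by linarith
      qed
      have "strict_mono t" using tSuc by (simp add: strict_mono_Suc_iff)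
      then have "(\<lambda>i. snd (D i)) \<longlonglongrightarrow> 0"
        using LIMSEQ_subseq_LIMSEQ[OF lim] by (simp add: D_def o_def)
      then have "(\<lambda>i. \<eta> * snd (D i) powr \<gamma>) \<longlonglongrightarrow> \<eta> * 0"
        using \<gamma> stages_pos[OF stages \<beta>(1)]
        by (intro tendsto_mult tendsto_const tendsto_zero_powrI[where b = \<gamma>]) (auto intro!: always_eventually less_imp_le)
      then have "snd A powr \<gamma> \<le> \<eta> * 0"
        using bound by (intro tendsto_lowerbound[where F = sequentially]) (auto simp: eventually_sequentially)
      moreover have "0 < snd A" using Npos[OF pos] A by (auto simp: NN_def)
      ultimately show False by simp
    qed
    then have "z \<in> S" using S[OF stages, of z] z by (auto simp: D_def NN_def t0)
    then show ?thesis using z by blast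
  qed
  show ?thesis
    unfolding beta_HAW_def winning_strategy_def using legal win by blast
qed

section \<open>Dangerous rational points and lines\<close>

text \<open>
  The boolean selects which coordinate plays the role of the first one, so that the two
  symmetric halves of the argument are treated at once.
\<close>

definition cx :: "bool \<Rightarrow> real \<times> real \<Rightarrow> real" where
  "cx s z = (if s then fst z else snd z)"

definition strip :: "bool \<Rightarrow> int \<Rightarrow> int \<Rightarrow> int \<Rightarrow> real \<Rightarrow> (real \<times> real) alice_move" where
  "strip s a b d r = ({z. a * cx s z + b * cx (\<not> s) z = d}, r)"

lemma strip_line:
  "{z. a * cx s z + b * cx (\<not> s) z = d} = {z. (if s then (a, b) else (b, a)) \<bullet> z = (d::real)}"
  by (auto simp: cx_def inner_prod_def)

lemma affine_hyperplane_strip: "a \<noteq> 0 \<Longrightarrow> affine_hyperplane (fst (strip s a b d r))"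
  unfolding strip_def fst_conv strip_line by (rule affine_hyperplaneI) (auto simp: zero_prod_def)

lemma snd_strip [simp]: "snd (strip s a b d r) = r"
  by (simp add: strip_def)

text \<open>The coefficient |a| is at most the norm of the normal vector, so a bound for the linear
  form by |a| r gives distance at most r. This is why obstacles are phrased with |a| instead of the
  norm.\<close>

lemma mem_strip:
  assumes "a \<noteq> 0" "0 \<le> r" "\<bar>a * cx s z + b * cx (\<not> s) z - d\<bar> \<le> \<bar>real_of_int a\<bar> * r"
  shows "z \<in> nbhd_of (strip s a b d r)"
proof -
  let ?n = "if s then (real_of_int a, real_of_int b) else (real_of_int b, real_of_int a)"
  have n: "?n \<noteq> 0" using assms by (auto simp: zero_prod_def)
  have "\<bar>real_of_int a\<bar> \<le> norm ?n"
    by (auto simp: norm_prod_def real_le_rsqrt)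
  then have "\<bar>real_of_int a\<bar> * r \<le> r * norm ?n"
    using assms(2) by (simp add: mult.commute mult_left_mono)
  moreover have "?n \<bullet> z = a * cx s z + b * cx (\<not> s) z" by (simp add: cx_def inner_prod_def)
  ultimately show ?thesis
    unfolding nbhd_of_def strip_def fst_conv snd_conv strip_line in_hyperplane_nbhd_iff[OF n]
    using assms(3) by simp
qed

text \<open>Proportional triples define the same line. Uniqueness of obstacles is needed only up to
  this, so the triples need not be primitive.\<close>

lemma strip_eqI:
  assumes "a \<noteq> 0" "a' \<noteq> 0" "a * b' = a' * b" "a * d' = a' * d"
  shows "strip s a b d r = strip s a' b' d' r"
proof -
  have "a * x + b * y = d \<longleftrightarrow> a' * x + b' * y = d'" for x y :: real
  proof -
    have e: "real_of_int a * real_of_int b' = real_of_int a' * real_of_int b"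
      "real_of_int a * real_of_int d' = real_of_int a' * real_of_int d"
      using assms(3,4) by (metis of_int_mult)+
    have "a * x + b * y = d \<longleftrightarrow> real_of_int a' * (a * x + b * y) = real_of_int a' * real_of_int d"
      using assms by simp
    also have "real_of_int a' * (a * x + b * y) = real_of_int a * (a' * x + b' * y)"
      using e(1) by (simp add: algebra_simps)
    also have "real_of_int a * (a' * x + b' * y) = real_of_int a' * real_of_int d \<longleftrightarrow>
        real_of_int a * (a' * x + b' * y) = real_of_int a * real_of_int d'"
      by (simp only: e(2))
    also have "\<dots> \<longleftrightarrow> a' * x + b' * y = d'" using assms by simp
    finally show ?thesis .
  qed
  then show ?thesis by (simp add: strip_def)
qed

lemma cx_diff_le:
  assumes "z \<in> ball_of D"
  shows "\<bar>cx s (fst D) - cx s z\<bar> \<le> snd D"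
proof -
  have "\<bar>cx s (fst D) - cx s z\<bar> \<le> dist (fst D) z"
    using dist_fst_le[of "fst D" z] dist_snd_le[of "fst D" z]
    by (cases s) (simp_all add: cx_def dist_real_def)
  then show ?thesis using assms by (simp add: ball_of_def)
qed

lemma class_index:
  fixes x y :: real
  assumes "0 < x" "x \<le> y"
  obtains j where "x * 256 ^ j \<le> y" "y < 256 * (x * 256 ^ j)"
proof -
  obtain n where "y / x < 256 ^ n" using real_arch_pow[of 256 "y / x"] by auto
  then have "y < x * 256 ^ n" using assms by (simp add: divide_less_eq mult.commute)
  then have L: "y < x * 256 ^ (LEAST n. y < x * 256 ^ n)" by (rule LeastI)
  then obtain m where m: "(LEAST n. y < x * 256 ^ n) = Suc m"
    using assms by (cases "LEAST n. y < x * 256 ^ n") auto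
  have "\<not> y < x * 256 ^ m" using not_less_Least[of m "\<lambda>n. y < x * 256 ^ n"] m by simp
  then show ?thesis using that[of m] L m by (simp add: mult_ac)
qed

text \<open>The radius shrinks at most by the factor \<open>R\<close> from one stage to the next, so
  it cannot jump over a window whose ends have ratio \<open>R\<close>.\<close>

lemma stage_hits_window:
  assumes st: "stages \<beta> D k" and \<beta>: "0 < \<beta>" and R: "R = 17 / \<beta>^3" and "0 < m"
    and "\<psi> \<le> m * snd (D 0)" "m * snd (D k) \<le> R * \<psi>"
  obtains l where "l \<le> k" "\<psi> \<le> m * snd (D l)" "m * snd (D l) \<le> R * \<psi>"
proof -
  define l where "l = (LEAST l. m * snd (D l) \<le> R * \<psi>)"
  have l: "m * snd (D l) \<le> R * \<psi>" unfolding l_def by (rule LeastI[of _ k]) fact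
  have lk: "l \<le> k" unfolding l_def by (rule Least_le) fact
  have "\<psi> \<le> m * snd (D l)"
  proof (cases l)
    case (Suc i)
    then have "R * \<psi> < m * snd (D i)"
      using not_less_Least[of i "\<lambda>l. m * snd (D l) \<le> R * \<psi>"] by (simp add: l_def)
    then have "\<beta>^3 / 17 * (R * \<psi>) \<le> \<beta>^3 / 17 * (m * snd (D i))"
      using \<beta> by (intro mult_left_mono) auto
    moreover have "\<beta>^3 / 17 * snd (D i) \<le> snd (D l)" using st Suc lk by (simp add: stages_def)
    then have "m * (\<beta>^3 / 17 * snd (D i)) \<le> m * snd (D l)" using \<open>0 < m\<close> by simp
    moreover have "\<psi> = \<beta>^3 / 17 * (R * \<psi>)" using \<beta> R by simp
    moreover have "\<beta>^3 / 17 * (m * snd (D i)) = m * (\<beta>^3 / 17 * snd (D i))" by simp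
    ultimately show ?thesis by linarith
  qed (use assms in simp)
  then show ?thesis using that lk l by blast
qed

lemma abs_minus_le_of_le:
  fixes a b c d :: real
  assumes "\<bar>a\<bar> \<le> a'" "\<bar>b\<bar> \<le> b'" "\<bar>c\<bar> \<le> c'" "\<bar>d\<bar> \<le> d'"
  shows "\<bar>a * b - c * d\<bar> \<le> a' * b' + c' * d'"
proof -
  have "\<bar>a * b - c * d\<bar> \<le> \<bar>a\<bar> * \<bar>b\<bar> + \<bar>c\<bar> * \<bar>d\<bar>"
    by (metis abs_mult abs_triangle_ineq4)
  also have "\<dots> \<le> a' * b' + c' * d'"
    using assms by (intro add_mono mult_mono) (auto intro: order_trans[OF abs_ge_zero])
  finally show ?thesis .
qed

text \<open>\<open>c\<close> becomes the lower bound in the limsup and \<open>e\<close> is the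
  threshold for lines. The condition with \<open>2^22\<close> keeps the line through two dangerous
  points low enough in height to have been recorded, \<open>ce\<close> bounds its error by the
  threshold for lines. \<open>12 * R * e * K \<le> 1\<close> makes an integer vanish when two lines
  are parallel, and \<open>ec\<close> bounds the errors of their intersection point
  otherwise.\<close>

locale obstacles =
  fixes \<beta> R K c e :: real
  assumes \<beta>: "0 < \<beta>" "\<beta> < 1/3" and R: "R = 17 / \<beta>^3" and K: "2 \<le> K"
    and c: "0 < c" "2^22 * R^4 * K\<^sup>2 * c \<le> 1"
    and e: "0 < e" "12 * R * e * K \<le> 1"
    and ce: "2^19 * R\<^sup>2 * K\<^sup>2 * c \<le> e" and ec: "18 * R\<^sup>2 * K\<^sup>2 * e\<^sup>2 \<le> c"
begin

text \<open>The power of 2 makes the \<gamma>-th powers of the widths a geometric series for every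
  \<gamma> > 0; \<open>K\<close> makes its sum as small as the weight bound requires.\<close>

definition width :: "nat \<Rightarrow> (real \<times> real) bob_move \<Rightarrow> real" where
  "width j D = snd D / (K * 2^j)"

text \<open>
  Here \<open>Q = 256^N\<close>.  The rational point \<open>(p/q, r/q)\<close> belongs to class \<open>j\<close> if \<open>q\<close> is comparable to
  \<open>Q/256^j\<close>; it is discarded when the ball has the radius for which \<open>width j D\<close> exceeds
  the width of its dangerous rectangle by a factor at most \<open>R\<close>.  The line with coefficients
  \<open>(a, b, d)\<close> is treated in the same way with \<open>|a| max(1, |b|)\<close> instead of \<open>q\<close>.  The factor \<open>4^i\<close>
  in its threshold gives the room needed for the rational points in \<open>vec_unique\<close> below.
\<close>

definition vec_obstacle :: "nat \<Rightarrow> bool \<Rightarrow> nat \<Rightarrow> (real \<times> real) bob_move \<Rightarrow> int \<Rightarrow> int \<Rightarrow> int \<Rightarrow> bool" where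
  "vec_obstacle N s j D p r q \<longleftrightarrow> 0 < q \<and> real_of_int q * 256^j \<le> (256::real)^N \<and> (256::real)^N < 256 * (real_of_int q * 256^j) \<and>
     c / 256^N \<le> q * width j D \<and> (q * width j D)\<^sup>2 \<le> R\<^sup>2 * c / 256^N \<and>
     (\<exists>z\<in>ball_of D. \<bar>q * cx s z - p\<bar> \<le> q * width j D \<and>
        \<bar>q * cx (\<not> s) z - r\<bar> * (q * width j D) \<le> R * c / 256^N \<and> \<bar>q * cx (\<not> s) z - r\<bar> \<le> 1)"

definition cov_obstacle :: "nat \<Rightarrow> bool \<Rightarrow> nat \<Rightarrow> (real \<times> real) bob_move \<Rightarrow> int \<Rightarrow> int \<Rightarrow> int \<Rightarrow> bool" where
  "cov_obstacle N s i D a b d \<longleftrightarrow> a \<noteq> 0 \<and> \<bar>b\<bar> \<le> \<bar>a\<bar> \<and>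
     2 * R * (\<bar>real_of_int a\<bar> * max 1 \<bar>real_of_int b\<bar>) * 256^i \<le> (256::real)^N \<and>
     (256::real)^N < 256 * (2 * R * (\<bar>real_of_int a\<bar> * max 1 \<bar>real_of_int b\<bar>) * 256^i) \<and>
     e * 4^i / 256^N \<le> \<bar>a\<bar> * width i D \<and> \<bar>a\<bar> * width i D \<le> R * (e * 4^i / 256^N) \<and>
     (\<exists>z\<in>ball_of D. \<bar>a * cx s z + b * cx (\<not> s) z - d\<bar> \<le> \<bar>a\<bar> * width i D)"

definition obst :: "nat \<Rightarrow> (real \<times> real) bob_move \<Rightarrow> (real \<times> real) alice_move set" where
  "obst N D = {strip s q 0 p (width j D) | s j p r q. vec_obstacle N s j D p r q} \<union>
     {strip s a b d (width i D) | s i a b d. cov_obstacle N s i D a b d}"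

lemma R_ge: "1 \<le> R"
proof -
  have "\<beta>^3 \<le> 1" using \<beta> by (simp add: power_le_one)
  then show ?thesis using \<beta> by (simp add: R)
qed

lemma c_le_1: "c \<le> 1" and e_le_1: "e \<le> 1" and c_le_e: "c \<le> e"
proof -
  have R2: "1 \<le> R\<^sup>2" and R4: "1 \<le> R^4" and K2: "1 \<le> K\<^sup>2" using R_ge K by (simp_all add: one_le_power)
  have m: "1 * 1 \<le> R\<^sup>2 * K\<^sup>2" "1 * 1 \<le> R^4 * K\<^sup>2" using R2 R4 K2 by (intro mult_mono; simp)+
  have "1 * c \<le> (2^22 * R^4 * K\<^sup>2) * c" using c m(2) by (intro mult_right_mono) (simp_all add: mult.assoc)
  then show "c \<le> 1" using c(2) by linarith
  have "1 * c \<le> (2^19 * R\<^sup>2 * K\<^sup>2) * c" using c m(1) by (intro mult_right_mono) (simp_all add: mult.assoc)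
  then show "c \<le> e" using ce by linarith
  have "1 * 1 \<le> R * K" using R_ge K by (intro mult_mono) auto
  then have "1 * e \<le> (12 * (R * K)) * e" using e by (intro mult_right_mono) linarith+
  moreover have "(12 * (R * K)) * e = 12 * R * e * K" by simp
  ultimately show "e \<le> 1" using e(2) by linarith
qed

text \<open>The region where the product of the two errors is at most \<open>c / 256^N\<close> is
  covered by boxes, one for each half-width \<psi>. On its way down, the radius passes the window
  where \<open>q * width\<close> lies between \<psi> and \<open>R * \<psi>\<close>, and there the
  rational point is recorded. Ball \<open>k\<close> has radius at most \<psi>/q, so this happened
  earlier, with a strip at least as wide as ball \<open>k\<close>.\<close>

lemma capture_vec:
  fixes p r q :: int and D :: "nat \<Rightarrow> (real \<times> real) bob_move"
  assumes st: "stages \<beta> D k" and start: "K \<le> 8^N * snd (D 0)" and z: "z \<in> ball_of (D k)"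
    and q: "0 < q" "q \<le> (256::real)^N"
    and \<psi>: "c / 256^N \<le> \<psi>" "\<psi>\<^sup>2 \<le> c / 256^N"
    and p: "\<bar>q * cx s z - p\<bar> \<le> \<psi>"
    and r: "\<bar>q * cx (\<not> s) z - r\<bar> * \<psi> \<le> c / 256^N" "\<bar>q * cx (\<not> s) z - r\<bar> \<le> 1"
    and k: "q * snd (D k) \<le> \<psi>"
  shows "\<exists>l<k. \<exists>A\<in>obst N (D l). z \<in> nbhd_of A \<and> snd (D k) \<le> snd A"
proof -
  let ?Q = "(256::real)^N"
  have q1: "1 \<le> real_of_int q" using q by simp
  have \<psi>0: "0 < \<psi>" using \<psi>(1) c by (metis divide_pos_pos less_le_trans zero_less_numeral zero_less_power)
  obtain j where j: "real_of_int q * 256^j \<le> ?Q" "?Q < 256 * (real_of_int q * 256^j)"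
    using class_index[of "real_of_int q" ?Q] q by auto
  have "1 * (256::real)^j \<le> real_of_int q * 256^j" using q1 by (intro mult_right_mono) auto
  then have "(256::real)^j \<le> 256^N" using j by linarith
  then have jN: "j \<le> N" by simp
  define m where "m = q / (K * 2^j)"
  have m0: "0 < m" using q K by (simp add: m_def)
  have m_w: "m * snd (D l) = q * width j (D l)" for l by (simp add: m_def width_def)
  \<comment> \<open>At stage 0 the window has not been passed: \<psi> is at most the square root of
    \<open>1 / 256^N\<close>, and the class costs at most \<open>2^N\<close>, which leaves the
    \<open>8^N\<close> of \<open>start\<close>.\<close>
  have "\<psi> \<le> 1 / 16^N"
  proof (rule power2_le_imp_le)
    have "\<psi>\<^sup>2 \<le> 1 / 256^N" using \<psi>(2) c_le_1 by (smt (verit) divide_right_mono zero_le_power)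
    also have "(1::real) / 256^N = (1 / 16^N)\<^sup>2"
      by (simp add: power_divide power_mult[symmetric] mult.commute[of N] power_mult)
    finally show "\<psi>\<^sup>2 \<le> (1 / 16^N)\<^sup>2" .
  qed simp
  also have "1 / 16^N = (1::real) / (8^N * 2^N)" by (simp add: power_mult_distrib[symmetric])
  also have "\<dots> = (K / 8^N) / (K * 2^N)" using K by (simp add: field_simps)
  also have "\<dots> \<le> snd (D 0) / (K * 2^N)"
    using start K by (intro divide_right_mono) (auto simp: divide_le_eq mult.commute)
  also have "\<dots> \<le> snd (D 0) / (K * 2^j)"
    using jN K stages_pos[OF st \<beta>(1), of 0] by (intro divide_left_mono mult_left_mono mult_pos_pos) auto
  also have "\<dots> \<le> m * snd (D 0)"
    using q1 K stages_pos[OF st \<beta>(1), of 0]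
      mult_right_mono[OF q1, of "snd (D 0) / (K * 2^j)"] by (simp add: m_def)
  finally have m1: "\<psi> \<le> m * snd (D 0)" .
  have kpos: "0 < snd (D k)" using stages_pos[OF st \<beta>(1)] by simp
  have "1 * 1 < K * 2^j" using K by (intro mult_less_le_imp_less) auto
  then have mk: "m * snd (D k) < q * snd (D k)"
    using kpos q by (simp add: m_def divide_less_eq)
  also have "\<dots> \<le> 1 * \<psi>" using k by simp
  also have "\<dots> \<le> R * \<psi>" using R_ge \<psi>0 by (intro mult_right_mono) auto
  finally have "m * snd (D k) \<le> R * \<psi>" by simp
  from stage_hits_window[OF st \<beta>(1) R m0 m1 this]
  obtain l where l: "l \<le> k" "\<psi> \<le> m * snd (D l)" "m * snd (D l) \<le> R * \<psi>" .
  have "l \<noteq> k" using l(2) mk k by auto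
  then have lk: "l < k" using l by simp
  have zl: "z \<in> ball_of (D l)" using stages_subset[OF st l(1) order_refl] z by blast
  have lower: "\<psi> \<le> q * width j (D l)" and upper: "q * width j (D l) \<le> R * \<psi>"
    using l by (simp_all add: m_w)
  have "(q * width j (D l))\<^sup>2 \<le> (R * \<psi>)\<^sup>2" using upper lower \<psi>0 by (intro power_mono) auto
  also have "\<dots> \<le> R\<^sup>2 * (c / 256^N)"
    unfolding power_mult_distrib using \<psi> by (intro mult_left_mono) auto
  finally have v1: "(q * width j (D l))\<^sup>2 \<le> R\<^sup>2 * c / 256^N" by simp
  have "\<bar>q * cx (\<not> s) z - r\<bar> * (q * width j (D l)) \<le> \<bar>q * cx (\<not> s) z - r\<bar> * (R * \<psi>)"
    using upper by (intro mult_left_mono) auto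
  also have "\<dots> = R * (\<bar>q * cx (\<not> s) z - r\<bar> * \<psi>)" by simp
  also have "\<dots> \<le> R * (c / 256^N)" using r R_ge by (intro mult_left_mono) auto
  finally have v2: "\<bar>q * cx (\<not> s) z - r\<bar> * (q * width j (D l)) \<le> R * c / 256^N" by simp
  have "vec_obstacle N s j (D l) p r q"
    unfolding vec_obstacle_def using q j \<psi> lower v1 v2 p r zl
    by (intro conjI bexI[of _ z]) auto
  then have mem: "strip s q 0 p (width j (D l)) \<in> obst N (D l)" unfolding obst_def by blast
  have w0: "0 \<le> width j (D l)"
    using K stages_pos[OF st \<beta>(1) l(1)] by (simp add: width_def)
  have "z \<in> nbhd_of (strip s q 0 p (width j (D l)))"
    using q w0 p lower by (intro mem_strip) auto
  moreover have "q * snd (D k) \<le> q * width j (D l)" using k lower by linarith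
  then have "snd (D k) \<le> width j (D l)" using q by simp
  ultimately show ?thesis using mem lk by (intro exI[of _ l] conjI bexI[OF _ mem]) auto
qed

text \<open>The argument is that of \<open>capture_vec\<close>. Only a lower bound \<open>j\<close>
  for the class is needed: the true class \<open>i\<close> is at least \<open>j\<close>, and the
  threshold grows with the class.\<close>

lemma capture_cov:
  fixes a b d :: int and D :: "nat \<Rightarrow> (real \<times> real) bob_move"
  assumes st: "stages \<beta> D k" and start: "K \<le> 8^N * snd (D 0)" and z: "z \<in> ball_of (D k)"
    and ab: "a \<noteq> 0" "\<bar>b\<bar> \<le> \<bar>a\<bar>"
    and j: "2 * R * (\<bar>real_of_int a\<bar> * max 1 \<bar>real_of_int b\<bar>) * 256^j \<le> (256::real)^N"
    and d: "\<bar>a * cx s z + b * cx (\<not> s) z - d\<bar> \<le> e * 4^j / 256^N"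
    and k: "\<bar>a\<bar> * snd (D k) \<le> e * 4^j / 256^N"
  shows "\<exists>l<k. \<exists>A\<in>obst N (D l). z \<in> nbhd_of A \<and> snd (D k) \<le> snd A"
proof -
  let ?Q = "(256::real)^N"
  define X where "X = 2 * R * (\<bar>real_of_int a\<bar> * max 1 \<bar>real_of_int b\<bar>)"
  have a1: "1 \<le> \<bar>real_of_int a\<bar>" using ab by linarith
  have "1 * 1 \<le> \<bar>real_of_int a\<bar> * max 1 \<bar>real_of_int b\<bar>" using a1 by (intro mult_mono) auto
  then have "1 * 1 \<le> (2 * R) * (\<bar>real_of_int a\<bar> * max 1 \<bar>real_of_int b\<bar>)"
    using R_ge by (intro mult_mono) auto
  then have X1: "1 \<le> X" by (simp add: X_def)
  have jX: "X * 256^j \<le> ?Q" using j by (simp add: X_def)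
  have "X * 1 \<le> X * 256^j" using X1 by (intro mult_left_mono) auto
  then have XQ: "X \<le> ?Q" using jX by linarith
  obtain i where i: "X * 256^i \<le> ?Q" "?Q < 256 * (X * 256^i)"
    using class_index[of X ?Q] X1 XQ by auto
  have "X * 256^j < X * 256^(Suc i)" using i jX by (simp add: mult_ac)
  then have "(256::real)^j < 256^(Suc i)" using X1 by simp
  then have ji: "j \<le> i" by (simp add: power_strict_increasing_iff less_Suc_eq_le del: power_Suc)
  have "1 * (256::real)^i \<le> X * 256^i" using X1 by (intro mult_right_mono) auto
  then have "(256::real)^i \<le> 256^N" using i by linarith
  then have iN: "i \<le> N" by simp
  define \<omega> where "\<omega> = e * 4^i / 256^N"
  have \<omega>0: "0 < \<omega>" using e by (simp add: \<omega>_def)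
  have \<omega>j: "e * 4^j / 256^N \<le> \<omega>"
    unfolding \<omega>_def using e ji by (intro divide_right_mono mult_left_mono power_increasing) auto
  define m where "m = \<bar>a\<bar> / (K * 2^i)"
  have m0: "0 < m" using ab K by (simp add: m_def)
  have m_w: "m * snd (D l) = \<bar>a\<bar> * width i (D l)" for l by (simp add: m_def width_def)
  have s0: "0 < snd (D 0)" using stages_pos[OF st \<beta>(1), of 0] by simp
  have "\<omega> * (2^i * 8^N) \<le> 1"
  proof -
    have "\<omega> * (2^i * 8^N) = e * (4^i * 2^i * 8^N / 256^N)" by (simp add: \<omega>_def)
    also have "(4::real)^i * 2^i * 8^N / 256^N = 8^i * 8^N / 256^N" by (simp add: power_mult_distrib[symmetric])
    finally have \<omega>: "\<omega> * (2^i * 8^N) = e * (8^i * 8^N / 256^N)" .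
    have "(8::real)^i * 8^N \<le> 8^N * 8^N" using iN by (intro mult_right_mono power_increasing) auto
    also have "(8::real)^N * 8^N = 64^N" by (simp add: power_mult_distrib[symmetric])
    also have "(64::real)^N \<le> 256^N" by (intro power_mono) auto
    finally have "e * (8^i * 8^N / 256^N) \<le> e * 1" using e by (intro mult_left_mono) auto
    then show ?thesis using e_le_1 \<omega> by linarith
  qed
  then have "\<omega> \<le> 1 / (2^i * 8^N)" by (simp add: field_simps)
  also have "\<dots> = (K / 8^N) / (K * 2^i)" using K by (simp add: field_simps)
  also have "\<dots> \<le> snd (D 0) / (K * 2^i)"
    using start K by (intro divide_right_mono) (auto simp: divide_le_eq mult.commute)
  also have "\<dots> \<le> m * snd (D 0)"
    using K s0 mult_right_mono[OF a1, of "snd (D 0) / (K * 2^i)"] by (simp add: m_def)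
  finally have m1: "\<omega> \<le> m * snd (D 0)" .
  have kpos: "0 < snd (D k)" using stages_pos[OF st \<beta>(1)] by simp
  have "1 * 1 < K * 2^i" using K by (intro mult_less_le_imp_less) auto
  then have mk: "m * snd (D k) < \<bar>a\<bar> * snd (D k)"
    using kpos ab by (simp add: m_def divide_less_eq)
  also have "\<dots> \<le> 1 * \<omega>" using k \<omega>j by simp
  also have "\<dots> \<le> R * \<omega>" using R_ge \<omega>0 by (intro mult_right_mono) auto
  finally have "m * snd (D k) \<le> R * \<omega>" by simp
  from stage_hits_window[OF st \<beta>(1) R m0 m1 this]
  obtain l where l: "l \<le> k" "\<omega> \<le> m * snd (D l)" "m * snd (D l) \<le> R * \<omega>" .
  have "l \<noteq> k" using l(2) mk k \<omega>j by auto
  then have lk: "l < k" using l by simp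
  have zl: "z \<in> ball_of (D l)" using stages_subset[OF st l(1) order_refl] z by blast
  have lower: "\<omega> \<le> \<bar>a\<bar> * width i (D l)" and upper: "\<bar>a\<bar> * width i (D l) \<le> R * \<omega>"
    using l by (simp_all add: m_w)
  have "cov_obstacle N s i (D l) a b d"
    unfolding cov_obstacle_def using ab i lower upper d \<omega>j zl
    by (intro conjI bexI[of _ z]) (auto simp: X_def \<omega>_def)
  then have mem: "strip s a b d (width i (D l)) \<in> obst N (D l)" unfolding obst_def by blast
  have w0: "0 \<le> width i (D l)"
    using K stages_pos[OF st \<beta>(1) l(1)] by (simp add: width_def)
  have "z \<in> nbhd_of (strip s a b d (width i (D l)))"
    using ab w0 d lower \<omega>j by (intro mem_strip) auto
  moreover have "\<bar>a\<bar> * snd (D k) \<le> \<bar>a\<bar> * width i (D l)" using k lower \<omega>j by linarith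
  then have "snd (D k) \<le> width i (D l)" using ab by simp
  ultimately show ?thesis using mem lk by (intro exI[of _ l] conjI bexI[OF _ mem]) auto
qed

lemma width_le:
  assumes "0 \<le> snd D"
  shows "width j D \<le> snd D" "0 \<le> width j D" "K * 2^j * width j D = snd D"
proof -
  have "1 * 1 \<le> K * 2^j" using K by (intro mult_mono) auto
  then show "width j D \<le> snd D" "0 \<le> width j D" "K * 2^j * width j D = snd D"
    using assms K by (auto simp: width_def divide_le_eq mult_le_cancel_left1)
qed

text \<open>Moves the estimates from the witness to the centre of the ball. \<open>U\<close> bounds
  the variation of \<open>q x\<close> over the ball for every \<open>q\<close> of the class. The
  error \<open>t\<close> of the second coordinate stays a parameter, since it is the product with
  \<open>U\<close> that is small.\<close>

lemma vec_obstacle_bounds: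
  fixes p r q :: int
  assumes v: "vec_obstacle N s j D p r q" and S: "0 < snd D"
  defines "q0 \<equiv> 256^N / 256^j"
  defines "U \<equiv> q0 * snd D"
  shows "real_of_int q \<le> q0" "\<bar>q * cx s (fst D) - p\<bar> \<le> 2 * U"
    "\<exists>t. 0 \<le> t \<and> t \<le> 1 \<and> \<bar>q * cx (\<not> s) (fst D) - r\<bar> \<le> t + U \<and> t * U \<le> 256 * K * 2^j * (R * c / 256^N)"
    "U\<^sup>2 \<le> 65536 * K\<^sup>2 * 4^j * (R\<^sup>2 * c / 256^N)"
proof -
  define w where "w = width j D"
  have w: "w \<le> snd D" "0 \<le> w" "K * 2^j * w = snd D" using width_le[of D j] S by (simp_all add: w_def)
  obtain z where z: "z \<in> ball_of D" "\<bar>q * cx s z - p\<bar> \<le> q * w"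
        "\<bar>q * cx (\<not> s) z - r\<bar> * (q * w) \<le> R * c / 256^N" "\<bar>q * cx (\<not> s) z - r\<bar> \<le> 1"
    and q: "0 < q" "real_of_int q * 256^j \<le> 256^N" "256^N < 256 * (real_of_int q * 256^j)"
      "(q * w)\<^sup>2 \<le> R\<^sup>2 * c / 256^N"
    using v by (auto simp: vec_obstacle_def w_def)
  show qq0: "real_of_int q \<le> q0" using q by (simp add: q0_def le_divide_eq)
  have q0q: "q0 \<le> 256 * q" using q by (simp add: q0_def divide_le_eq)
  have qS: "q * snd D \<le> U" using qq0 S by (simp add: U_def)
  have dev: "\<bar>q * cx s' (fst D) - q * cx s' z\<bar> \<le> U" for s'
  proof -
    have "\<bar>q * cx s' (fst D) - q * cx s' z\<bar> = q * \<bar>cx s' (fst D) - cx s' z\<bar>"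
      using q by (simp add: right_diff_distrib[symmetric] abs_mult)
    also have "\<dots> \<le> q * snd D" using cx_diff_le[OF z(1)] q by (intro mult_left_mono) auto
    finally show ?thesis using qS by linarith
  qed
  have "q * w \<le> q * snd D" using w q by (intro mult_left_mono) auto
  then show "\<bar>q * cx s (fst D) - p\<bar> \<le> 2 * U" using dev[of s] z(2) qS by linarith
  have Uw: "U \<le> 256 * K * 2^j * (q * w)"
  proof -
    have "U \<le> 256 * q * snd D" unfolding U_def using q0q S by (intro mult_right_mono) auto
    also have "\<dots> = 256 * K * 2^j * (q * w)" unfolding w(3)[symmetric] by simp
    finally show ?thesis .
  qed
  have U0: "0 \<le> U" using S by (simp add: U_def q0_def)
  show "\<exists>t. 0 \<le> t \<and> t \<le> 1 \<and> \<bar>q * cx (\<not> s) (fst D) - r\<bar> \<le> t + U \<and> t * U \<le> 256 * K * 2^j * (R * c / 256^N)"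
  proof (intro exI conjI)
    let ?t = "\<bar>q * cx (\<not> s) z - r\<bar>"
    show "0 \<le> ?t" "?t \<le> 1" using z by auto
    show "\<bar>q * cx (\<not> s) (fst D) - r\<bar> \<le> ?t + U" using dev[of "\<not> s"] by linarith
    have "?t * U \<le> ?t * (256 * K * 2^j * (q * w))" using Uw by (intro mult_left_mono) auto
    also have "\<dots> = 256 * K * 2^j * (?t * (q * w))" by simp
    also have "\<dots> \<le> 256 * K * 2^j * (R * c / 256^N)" using z K by (intro mult_left_mono) auto
    finally show "?t * U \<le> 256 * K * 2^j * (R * c / 256^N)" .
  qed
  have "U\<^sup>2 \<le> (256 * K * 2^j * (q * w))\<^sup>2" using Uw U0 by (intro power_mono)
  also have "\<dots> = 65536 * K\<^sup>2 * 4^j * (q * w)\<^sup>2"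
  proof -
    have "((2::real)^j)\<^sup>2 = 4^j" by (simp add: power2_eq_square flip: power_mult_distrib)
    then show ?thesis by (simp add: power_mult_distrib)
  qed
  also have "\<dots> \<le> 65536 * K\<^sup>2 * 4^j * (R\<^sup>2 * c / 256^N)" using q by (intro mult_left_mono) auto
  finally show "U\<^sup>2 \<le> 65536 * K\<^sup>2 * 4^j * (R\<^sup>2 * c / 256^N)" .
qed

text \<open>
  Two rational points with different abscissae would span a line so close to the ball that a much
  wider neighbourhood of it has been recorded at an earlier stage.
\<close>

lemma vec_unique:
  fixes p1 r1 q1 p2 r2 q2 :: int and D :: "nat \<Rightarrow> (real \<times> real) bob_move"
  assumes st: "stages \<beta> D k" and start: "K \<le> 8^N * snd (D 0)"
    and thin: "\<And>l A. l < k \<Longrightarrow> A \<in> obst N (D l) \<Longrightarrow> meets A (D k) \<Longrightarrow> snd A < snd (D k)"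
    and v1: "vec_obstacle N s j (D k) p1 r1 q1" and v2: "vec_obstacle N s j (D k) p2 r2 q2"
  shows "q1 * p2 = q2 * p1"
proof (rule ccontr)
  assume ne: "q1 * p2 \<noteq> q2 * p1"
  define Q where "Q = (256::real)^N"
  define q0 where "q0 = Q / 256^j"
  define S where "S = snd (D k)"
  define U where "U = q0 * S"
  define x0 where "x0 = cx s (fst (D k))"
  define y0 where "y0 = cx (\<not> s) (fst (D k))"
  have S: "0 < S" using stages_pos[OF st \<beta>(1)] by (simp add: S_def)
  have Q: "0 < Q" by (simp add: Q_def)
  have q0: "0 < q0" by (simp add: q0_def Q)
  have U: "0 < U" using q0 S by (simp add: U_def)
  note b1 = vec_obstacle_bounds[OF v1, folded S_def Q_def, folded q0_def, folded U_def, folded x0_def y0_def, OF S]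
  note b2 = vec_obstacle_bounds[OF v2, folded S_def Q_def, folded q0_def, folded U_def, folded x0_def y0_def, OF S]
  obtain t1 where t1: "0 \<le> t1" "t1 \<le> 1" "\<bar>q1 * y0 - r1\<bar> \<le> t1 + U" "t1 * U \<le> 256 * K * 2^j * (R * c / Q)"
    using b1(3) by blast
  obtain t2 where t2: "0 \<le> t2" "t2 \<le> 1" "\<bar>q2 * y0 - r2\<bar> \<le> t2 + U" "t2 * U \<le> 256 * K * 2^j * (R * c / Q)"
    using b2(3) by blast
  have qpos: "0 < q1" "0 < q2" using v1 v2 by (auto simp: vec_obstacle_def)
  define T where "T = max t1 t2"
  have T: "0 \<le> T" "\<bar>q1 * y0 - r1\<bar> \<le> T + U" "\<bar>q2 * y0 - r2\<bar> \<le> T + U"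
      "T * U \<le> 256 * K * 2^j * (R * c / Q)"
    using t1 t2 by (auto simp: T_def max_def)
  define P where "P = K\<^sup>2 * R\<^sup>2 * c * (4^j / Q)"
  have TU: "T * U \<le> 256 * P"
  proof -
    have "K * 2^j * R \<le> K\<^sup>2 * 4^j * R\<^sup>2"
      using K R_ge by (intro mult_mono power_mono) (auto simp: power2_eq_square)
    then have "(256 * (c / Q)) * (K * 2^j * R) \<le> (256 * (c / Q)) * (K\<^sup>2 * 4^j * R\<^sup>2)"
      using c Q by (intro mult_left_mono) auto
    then show ?thesis using T(4) by (simp add: P_def mult_ac)
  qed
  have UU: "U\<^sup>2 \<le> 65536 * P" using b1(4) by (simp add: P_def mult_ac)
  have P0: "0 \<le> P" using c Q by (simp add: P_def)
  have PE: "524288 * P \<le> e * 4^j / Q"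
    using mult_right_mono[OF ce, of "4^j / Q"] Q by (simp add: P_def mult_ac)
  have sum: "U * (T + U) \<le> 65792 * P" using TU UU by (simp add: algebra_simps power2_eq_square)
  \<comment> \<open>The cross product of the two triples, that is, the line through both points. Its
    value at the centre is a determinant in the errors of the points; its coefficients are
    determinants in heights and errors.\<close>
  define a b d where "a = q2 * r1 - q1 * r2" and "b = q1 * p2 - q2 * p1" and "d = p2 * r1 - p1 * r2"
  have b0: "b \<noteq> 0" using ne by (simp add: b_def)
  have w: "\<bar>a * x0 + b * y0 - d\<bar> \<le> e * 4^j / Q"
  proof -
    have "a * x0 + b * y0 - d = (q1 * x0 - p1) * (q2 * y0 - r2) - (q2 * x0 - p2) * (q1 * y0 - r1)"
      by (simp add: a_def b_def d_def algebra_simps)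
    also have "\<bar>\<dots>\<bar> \<le> 2 * U * (T + U) + 2 * U * (T + U)"
      using b1(2) b2(2) T by (intro abs_minus_le_of_le)
    also have "\<dots> = 4 * (U * (T + U))" by simp
    also have "\<dots> \<le> e * 4^j / Q" using sum PE P0 by linarith
    finally show ?thesis .
  qed
  have a_le: "\<bar>real_of_int a\<bar> \<le> 2 * q0 * (T + U)"
  proof -
    have "a = q1 * (q2 * y0 - r2) - q2 * (q1 * y0 - r1)" by (simp add: a_def algebra_simps)
    also have "\<bar>\<dots>\<bar> \<le> q0 * (T + U) + q0 * (T + U)"
      using b1(1) b2(1) T qpos by (intro abs_minus_le_of_le) auto
    finally show ?thesis by simp
  qed
  have b_le: "\<bar>real_of_int b\<bar> \<le> 4 * q0 * U"
  proof -
    have "b = q2 * (q1 * x0 - p1) - q1 * (q2 * x0 - p2)" by (simp add: b_def algebra_simps)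
    also have "\<bar>\<dots>\<bar> \<le> q0 * (2 * U) + q0 * (2 * U)"
      using b1(1,2) b2(1,2) qpos by (intro abs_minus_le_of_le) auto
    finally show ?thesis by (simp add: mult_ac)
  qed
  have aS: "\<bar>a\<bar> * S \<le> e * 4^j / Q"
  proof -
    have "\<bar>a\<bar> * S \<le> 2 * q0 * (T + U) * S" using a_le S by (intro mult_right_mono) auto
    also have "\<dots> = 2 * (U * (T + U))" by (simp add: U_def)
    finally show ?thesis using sum PE P0 by linarith
  qed
  have bS: "\<bar>b\<bar> * S \<le> e * 4^j / Q"
  proof -
    have "\<bar>b\<bar> * S \<le> 4 * q0 * U * S" using b_le S by (intro mult_right_mono) auto
    also have "\<dots> = 4 * U\<^sup>2" by (simp add: U_def power2_eq_square)
    finally show ?thesis using UU PE P0 by linarith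
  qed
  have "1 * (256::real)^j \<le> real_of_int q1 * 256^j" using qpos by (intro mult_right_mono) auto
  moreover have "real_of_int q1 * 256^j \<le> Q" using v1 by (simp add: vec_obstacle_def Q_def)
  ultimately have jQ: "256^j \<le> Q" by linarith
  have "(4::real)^j \<le> 256^j" by (intro power_mono) auto
  then have jQ4: "4^j / Q \<le> 1" using jQ Q by simp
  have RK: "0 < R\<^sup>2 * K\<^sup>2 * c" using R_ge K c by simp
  \<comment> \<open>Here 64 times the 65536 in the bound for the square of \<open>U\<close> gives
    the \<open>2^22\<close> in the assumption on \<open>c\<close>.\<close>
  have U8: "8 * R * U \<le> 1"
  proof (rule power2_le_imp_le)
    have "(8 * R * U)\<^sup>2 = 64 * R\<^sup>2 * U\<^sup>2" by (simp add: power_mult_distrib)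
    also have "\<dots> \<le> 64 * R\<^sup>2 * (65536 * P)" using UU by (intro mult_left_mono) auto
    also have "\<dots> = 2^22 * R^4 * K\<^sup>2 * c * (4^j / Q)" by (simp add: P_def)
    also have "\<dots> \<le> 1 * 1" using c(2) jQ4 Q by (intro mult_mono) auto
    finally show "(8 * R * U)\<^sup>2 \<le> 1\<^sup>2" by simp
  qed simp
  have Rb: "2 * R * \<bar>b\<bar> \<le> q0"
  proof -
    have "2 * R * \<bar>b\<bar> \<le> 2 * R * (4 * q0 * U)" using b_le R_ge by (intro mult_left_mono) auto
    also have "\<dots> = q0 * (8 * R * U)" by simp
    also have "\<dots> \<le> q0 * 1" using U8 q0 by (intro mult_left_mono) auto
    finally show ?thesis by simp
  qed
  \<comment> \<open>The loss \<open>4^j\<close> in \<open>P\<close> is absorbed by the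
    \<open>256^j\<close> in \<open>q0\<close>, so the line has height of class at least
    \<open>j\<close>.\<close>
  have Rab: "2 * R * (\<bar>real_of_int a\<bar> * \<bar>real_of_int b\<bar>) \<le> q0"
  proof -
    have q0P: "q0 * P \<le> K\<^sup>2 * R\<^sup>2 * c"
    proof -
      have "q0 * P = (K\<^sup>2 * R\<^sup>2 * c) * (4^j / 256^j)" using Q by (simp add: q0_def P_def)
      also have "\<dots> \<le> (K\<^sup>2 * R\<^sup>2 * c) * 1"
        using RK \<open>(4::real)^j \<le> 256^j\<close> by (intro mult_left_mono) (auto simp: mult_ac)
      finally show ?thesis by simp
    qed
    have "\<bar>real_of_int a\<bar> * \<bar>real_of_int b\<bar> \<le> (2 * q0 * (T + U)) * (4 * q0 * U)"
      using a_le b_le T U q0 by (intro mult_mono) auto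
    also have "\<dots> = 8 * q0 * (q0 * (U * (T + U)))" by simp
    also have "\<dots> \<le> 8 * q0 * (q0 * (65792 * P))" using sum q0 by (intro mult_left_mono) auto
    also have "\<dots> = 526336 * q0 * (q0 * P)" by simp
    also have "\<dots> \<le> 526336 * q0 * (K\<^sup>2 * R\<^sup>2 * c)" using q0P q0 by (intro mult_left_mono) auto
    finally have "2 * R * (\<bar>real_of_int a\<bar> * \<bar>real_of_int b\<bar>) \<le> 2 * R * (526336 * q0 * (K\<^sup>2 * R\<^sup>2 * c))"
      using R_ge by (intro mult_left_mono) auto
    also have "\<dots> = q0 * (1052672 * (R^3 * (K\<^sup>2 * c)))" by (simp add: power3_eq_cube power2_eq_square)
    also have "\<dots> \<le> q0 * (2^22 * (R^4 * (K\<^sup>2 * c)))"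
      using q0 R_ge c by (intro mult_left_mono mult_mono mult_right_mono power_increasing) auto
    also have "\<dots> \<le> q0 * 1" using q0 c(2) by (intro mult_left_mono) (auto simp: mult_ac)
    finally show ?thesis by simp
  qed
  have centre: "fst (D k) \<in> ball_of (D k)" using S by (simp add: ball_of_def S_def)
  have cap: "\<exists>l<k. \<exists>A\<in>obst N (D l). fst (D k) \<in> nbhd_of A \<and> snd (D k) \<le> snd A"
  \<comment> \<open>\<open>cov_obstacle\<close> wants the larger coefficient first, so the
    coordinates are exchanged if |b| > |a|. Here \<open>b\<close> is nonzero but \<open>a\<close>
    may vanish, which is the reason for the maximum with 1 in the height of a line.\<close>
  proof (cases "\<bar>b\<bar> \<le> \<bar>a\<bar>")
    case True
    have "max 1 \<bar>real_of_int b\<bar> = \<bar>real_of_int b\<bar>" using b0 by linarith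
    then have "2 * R * (\<bar>real_of_int a\<bar> * max 1 \<bar>real_of_int b\<bar>) * 256^j \<le> 256^N"
      using Rab by (simp add: q0_def Q_def le_divide_eq)
    then show ?thesis using True b0 w aS
      by (intro capture_cov[OF st start centre, of a b j s d]) (auto simp: x0_def y0_def S_def Q_def)
  next
    case False
    have "2 * R * (\<bar>real_of_int b\<bar> * max 1 \<bar>real_of_int a\<bar>) * 256^j \<le> 256^N"
    proof (cases "a = 0")
      case True
      then show ?thesis using Rb by (simp add: q0_def Q_def le_divide_eq)
    next
      case False
      then have "max 1 \<bar>real_of_int a\<bar> = \<bar>real_of_int a\<bar>" by linarith
      then show ?thesis using Rab by (simp add: q0_def Q_def le_divide_eq mult_ac)
    qed
    then show ?thesis using False b0 w bS
      by (intro capture_cov[OF st start centre, of b a j "\<not> s" d])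
        (auto simp: x0_def y0_def S_def Q_def add.commute)
  qed
  then obtain l A where "l < k" "A \<in> obst N (D l)" "fst (D k) \<in> nbhd_of A" "snd (D k) \<le> snd A" by blast
  moreover from this centre have "meets A (D k)" by (auto simp: meets_def)
  ultimately show False using thin[of l A] by simp
qed

end

lemma sum_UNION_le:
  fixes f :: "'a \<Rightarrow> real"
  assumes "finite I" "\<And>x. 0 \<le> f x"
    and "\<And>i. i \<in> I \<Longrightarrow> finite (F i) \<and> sum f (F i) \<le> v i"
  shows "finite (\<Union>i\<in>I. F i) \<and> sum f (\<Union>i\<in>I. F i) \<le> sum v I"
  using assms(1,3)
proof (induction I rule: finite_induct)
  case (insert i I)
  then have IH: "finite (\<Union>i\<in>I. F i) \<and> sum f (\<Union>i\<in>I. F i) \<le> sum v I"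
    and i: "finite (F i) \<and> sum f (F i) \<le> v i" by simp_all
  have "sum f (F i \<union> (\<Union>i\<in>I. F i)) \<le> sum f (F i) + sum f (\<Union>i\<in>I. F i)"
    using i IH assms(2) by (intro sum_Un_le) simp_all
  then show ?case using i IH insert.hyps by simp
qed simp

lemma sum_subsingleton_le:
  fixes f :: "'a \<Rightarrow> real"
  assumes "\<And>x y. x \<in> F \<Longrightarrow> y \<in> F \<Longrightarrow> x = y" "\<And>x. x \<in> F \<Longrightarrow> f x \<le> v" "0 \<le> v"
  shows "finite F \<and> sum f F \<le> v"
proof (cases "F = {}")
  case False
  then obtain x where "F = {x}" using assms(1) by blast
  then show ?thesis using assms(2) by simp
qed (use assms in simp)

context obstacles
begin

text \<open>
  Two such lines would meet in a rational point that is so close to the ball that a strip wider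
  than the ball has been recorded around it at an earlier stage.
\<close>

lemma cov_unique:
  fixes a1 b1 d1 a2 b2 d2 :: int and D :: "nat \<Rightarrow> (real \<times> real) bob_move"
  assumes st: "stages \<beta> D k" and start: "K \<le> 8^N * snd (D 0)"
    and thin: "\<And>l A. l < k \<Longrightarrow> A \<in> obst N (D l) \<Longrightarrow> meets A (D k) \<Longrightarrow> snd A < snd (D k)"
    and v1: "cov_obstacle N s i (D k) a1 b1 d1" and v2: "cov_obstacle N s i (D k) a2 b2 d2"
  shows "a1 * b2 = a2 * b1 \<and> a1 * d2 = a2 * d1"
proof (rule ccontr)
  assume ne: "\<not> ?thesis"
  define Q where "Q = (256::real)^N"
  define q0 where "q0 = Q / 256^i"
  define S where "S = snd (D k)"
  define w where "w = width i (D k)"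
  define \<omega> where "\<omega> = e * 4^i / Q"
  define x0 where "x0 = cx s (fst (D k))"
  define y0 where "y0 = cx (\<not> s) (fst (D k))"
  have S: "0 < S" using stages_pos[OF st \<beta>(1)] by (simp add: S_def)
  have Q: "0 < Q" by (simp add: Q_def)
  have q0: "0 < q0" by (simp add: q0_def Q)
  have w: "w \<le> S" "0 \<le> w" "K * 2^i * w = S" using width_le[of "D k" i] S by (simp_all add: w_def S_def)
  then have w0: "0 < w" using S K by (metis less_eq_real_def less_irrefl mult_zero_right)
  have facts: "a \<noteq> 0 \<and> \<bar>b\<bar> \<le> \<bar>a\<bar> \<and> 2 * R * (\<bar>real_of_int a\<bar> * max 1 \<bar>real_of_int b\<bar>) \<le> q0 \<and>
      \<omega> \<le> \<bar>real_of_int a\<bar> * w \<and> \<bar>real_of_int a\<bar> * w \<le> R * \<omega> \<and>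
      \<bar>a * x0 + b * y0 - d\<bar> \<le> 3 * \<bar>real_of_int a\<bar> * S"
    if v: "cov_obstacle N s i (D k) a b d" for a b d
  proof -
    obtain z where z: "z \<in> ball_of (D k)" "\<bar>a * cx s z + b * cx (\<not> s) z - d\<bar> \<le> \<bar>real_of_int a\<bar> * w"
      using v by (auto simp: cov_obstacle_def w_def)
    have ab: "\<bar>real_of_int b\<bar> \<le> \<bar>real_of_int a\<bar>" using v unfolding cov_obstacle_def by linarith
    have x: "\<bar>x0 - cx s z\<bar> \<le> S" and y: "\<bar>y0 - cx (\<not> s) z\<bar> \<le> S"
      using cx_diff_le[OF z(1)] by (simp_all add: x0_def y0_def S_def)
    have "a * x0 + b * y0 - d = (a * cx s z + b * cx (\<not> s) z - d) + (a * (x0 - cx s z) + b * (y0 - cx (\<not> s) z))"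
      by (simp add: algebra_simps)
    also have "\<bar>\<dots>\<bar> \<le> \<bar>a * cx s z + b * cx (\<not> s) z - d\<bar> + (\<bar>a * (x0 - cx s z)\<bar> + \<bar>b * (y0 - cx (\<not> s) z)\<bar>)"
      by linarith
    also have "\<dots> \<le> \<bar>real_of_int a\<bar> * w + (\<bar>real_of_int a\<bar> * S + \<bar>real_of_int a\<bar> * S)"
      unfolding abs_mult using z(2) x y ab by (intro add_mono mult_mono) auto
    also have "\<dots> \<le> 3 * \<bar>real_of_int a\<bar> * S"
      using mult_left_mono[OF w(1), of "\<bar>real_of_int a\<bar>"] by (simp add: mult.commute)
    finally have dev: "\<bar>a * x0 + b * y0 - d\<bar> \<le> 3 * \<bar>real_of_int a\<bar> * S" .
    have v': "a \<noteq> 0" "\<bar>b\<bar> \<le> \<bar>a\<bar>"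
        "2 * R * (\<bar>real_of_int a\<bar> * max 1 \<bar>real_of_int b\<bar>) * 256^i \<le> Q"
        "\<omega> \<le> \<bar>real_of_int a\<bar> * w" "\<bar>real_of_int a\<bar> * w \<le> R * \<omega>"
      using v unfolding cov_obstacle_def Q_def w_def \<omega>_def by blast+
    then have "2 * R * (\<bar>real_of_int a\<bar> * max 1 \<bar>real_of_int b\<bar>) \<le> q0"
      by (simp add: q0_def le_divide_eq)
    then show ?thesis using v' dev by blast
  qed
  have f: "a1 \<noteq> 0" "a2 \<noteq> 0" "\<bar>b1\<bar> \<le> \<bar>a1\<bar>" "\<bar>b2\<bar> \<le> \<bar>a2\<bar>"
    and f_prods: "2 * R * (\<bar>real_of_int a1\<bar> * max 1 \<bar>real_of_int b1\<bar>) \<le> q0"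
      "2 * R * (\<bar>real_of_int a2\<bar> * max 1 \<bar>real_of_int b2\<bar>) \<le> q0"
    and f_w: "\<omega> \<le> \<bar>real_of_int a1\<bar> * w" "\<bar>real_of_int a1\<bar> * w \<le> R * \<omega>"
      "\<omega> \<le> \<bar>real_of_int a2\<bar> * w" "\<bar>real_of_int a2\<bar> * w \<le> R * \<omega>"
    and f_dev: "\<bar>a1 * x0 + b1 * y0 - d1\<bar> \<le> 3 * \<bar>real_of_int a1\<bar> * S"
      "\<bar>a2 * x0 + b2 * y0 - d2\<bar> \<le> 3 * \<bar>real_of_int a2\<bar> * S"
    using facts[OF v1] facts[OF v2] by blast+
  define A1 A2 B1 B2 where "A1 = \<bar>real_of_int a1\<bar>" and "A2 = \<bar>real_of_int a2\<bar>"
    and "B1 = max 1 \<bar>real_of_int b1\<bar>" and "B2 = max 1 \<bar>real_of_int b2\<bar>"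
  define A0 B0 where "A0 = max A1 A2" and "B0 = max B1 B2"
  have A: "1 \<le> A1" "1 \<le> A2" using f(1,2) unfolding A1_def A2_def by linarith+
  have B: "1 \<le> B1" "1 \<le> B2" by (simp_all add: B1_def B2_def)
  have BA: "B1 \<le> A1" "B2 \<le> A2"
  proof -
    have "\<bar>real_of_int b1\<bar> \<le> A1" "\<bar>real_of_int b2\<bar> \<le> A2"
      using f(3,4) unfolding A1_def A2_def by linarith+
    then show "B1 \<le> A1" "B2 \<le> A2" using A by (simp_all add: B1_def B2_def)
  qed
  then have B0A0: "B0 \<le> A0" by (auto simp: A0_def B0_def)
  have A0: "1 \<le> A0" and B0: "1 \<le> B0" using A B by (auto simp: A0_def B0_def)
  have prods: "2 * R * (A1 * B1) \<le> q0" "2 * R * (A2 * B2) \<le> q0"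
    unfolding A1_def A2_def B1_def B2_def by (fact f_prods)+
  have Aw: "\<omega> \<le> A1 * w" "A1 * w \<le> R * \<omega>" "\<omega> \<le> A2 * w" "A2 * w \<le> R * \<omega>"
    unfolding A1_def A2_def by (fact f_w)+
  have R0: "0 < R" using R_ge by simp
  \<comment> \<open>Both |a| lie in the same window for the same width, so they agree up to the
    factor \<open>R\<close>. This permits mixed products of coefficients of different lines; the
    factor \<open>2 * R\<close> in the class of a line pays for it and for the two terms of the
    determinant \<open>q\<close>.\<close>
  have ratio: "A1 \<le> R * A2" "A2 \<le> R * A1"
  proof -
    have "R * \<omega> \<le> R * (A1 * w)" "R * \<omega> \<le> R * (A2 * w)"
      using Aw R0 by (simp_all only: mult_le_cancel_left_pos)
    then have "A1 * w \<le> (R * A2) * w" "A2 * w \<le> (R * A1) * w"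
      using Aw by (simp_all add: mult.assoc)
    then show "A1 \<le> R * A2" "A2 \<le> R * A1" using w0 by simp_all
  qed
  have half: "A * B \<le> q0 / 2" if "2 * R * (A' * B) \<le> q0" "A \<le> R * A'" "0 \<le> B" for A A' B
    using mult_right_mono[OF that(2,3)] that(1) by (simp add: mult_ac)
  have AB: "A0 * B0 \<le> q0 / 2"
  proof -
    have "A1 * B1 \<le> q0 / 2" using half[OF prods(1)] A R_ge B by (simp add: mult_le_cancel_right1)
    moreover have "A2 * B2 \<le> q0 / 2" using half[OF prods(2)] A R_ge B by (simp add: mult_le_cancel_right1)
    moreover have "A1 * B2 \<le> q0 / 2" using half[OF prods(2) ratio(1)] B by simp
    moreover have "A2 * B1 \<le> q0 / 2" using half[OF prods(1) ratio(2)] B by simp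
    ultimately show ?thesis by (auto simp: A0_def B0_def max_def)
  qed
  define H where "H = R * e * K * (8^i / Q)"
  have A0S: "A0 * S \<le> H"
  proof -
    have "A0 * w \<le> R * \<omega>" using Aw by (auto simp: A0_def max_def)
    then have "K * 2^i * (A0 * w) \<le> K * 2^i * (R * \<omega>)" using K by (intro mult_left_mono) auto
    moreover have "(2::real)^i * 4^i = 8^i" by (simp flip: power_mult_distrib)
    then have "K * 2^i * (R * \<omega>) = H" by (simp add: H_def \<omega>_def mult_ac)
    ultimately show ?thesis unfolding w(3)[symmetric] by (simp add: mult_ac)
  qed
  have H0: "0 < H" using R0 e K Q by (simp add: H_def)
  have iQ: "1 \<le> q0"
  proof -
    have "1 * 1 \<le> A0 * B0" using A0 B0 by (intro mult_mono) auto
    then show ?thesis using AB by linarith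
  qed
  \<comment> \<open>By Cramer's rule the first error of the intersection point involves the
    coefficients \<open>b\<close> and the second the coefficients \<open>a\<close>; hence the
    different factors.\<close>
  define X Y where "X = 6 * B0 * (A0 * S)" and "Y = 6 * A0 * (A0 * S)"
  have XY: "X \<le> Y" using B0A0 A0 S by (simp add: X_def Y_def)
  have X0: "0 < X" "0 < Y" using A0 B0 S by (simp_all add: X_def Y_def)
  have Y1: "Y < 1"
  proof -
    have "A0 * 1 \<le> A0 * B0" using A0 B0 by (intro mult_left_mono) auto
    then have "A0 \<le> q0" using AB q0 by linarith
    then have "Y \<le> 6 * q0 * H" unfolding Y_def using A0S A0 S by (intro mult_mono) auto
    also have "\<dots> = (6 * R * e * K) * (8^i / 256^i)" using Q by (simp add: H_def q0_def)
    also have "\<dots> \<le> (6 * R * e * K) * 1"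
      using R0 e K power_mono[of "8::real" 256 i] by (intro mult_left_mono) auto
    finally show ?thesis using e R0 K by linarith
  qed
  \<comment> \<open>Each line loses \<open>2^i\<close> through its width and \<open>4^i\<close>
    through its threshold; the square \<open>64^i\<close> is absorbed by the \<open>256^i\<close> in
    \<open>q0\<close>.\<close>
  have XYc: "X * Y \<le> c / Q"
  proof -
    have "X * Y = 36 * (A0 * B0) * (A0 * S)\<^sup>2" by (simp add: X_def Y_def power2_eq_square)
    also have "\<dots> \<le> 36 * (q0 / 2) * H\<^sup>2"
      using AB A0S A0 B0 S q0 by (intro mult_mono power_mono) auto
    also have "\<dots> = 18 * R\<^sup>2 * K\<^sup>2 * e\<^sup>2 * ((8^i)\<^sup>2 / 256^i) / Q"
      using Q by (simp add: H_def q0_def power2_eq_square)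
    also have "\<dots> \<le> 18 * R\<^sup>2 * K\<^sup>2 * e\<^sup>2 * 1 / Q"
    proof -
      have "((8::real)^i)\<^sup>2 = 64^i" by (simp add: power2_eq_square flip: power_mult_distrib)
      then have "((8::real)^i)\<^sup>2 / 256^i \<le> 1" using power_mono[of "64::real" 256 i] by simp
      then show ?thesis using Q by (intro divide_right_mono mult_left_mono) auto
    qed
    also have "\<dots> \<le> c / Q" using ec Q by (intro divide_right_mono) auto
    finally show ?thesis .
  qed
  define q p r where "q = a1 * b2 - a2 * b1" and "p = d1 * b2 - d2 * b1" and "r = a1 * d2 - a2 * d1"
  have A0': "\<bar>real_of_int a1\<bar> \<le> A0" "\<bar>real_of_int a2\<bar> \<le> A0"
    "\<bar>real_of_int b1\<bar> \<le> B0" "\<bar>real_of_int b2\<bar> \<le> B0"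
    by (auto simp: A0_def A1_def A2_def B0_def B1_def B2_def)
  have W: "\<bar>a1 * x0 + b1 * y0 - d1\<bar> \<le> 3 * (A0 * S)" "\<bar>a2 * x0 + b2 * y0 - d2\<bar> \<le> 3 * (A0 * S)"
    using f_dev mult_right_mono[OF A0'(1), of S] mult_right_mono[OF A0'(2), of S] S by linarith+
  have q_le: "\<bar>real_of_int q\<bar> \<le> q0"
  proof -
    have "real_of_int q = real_of_int a1 * b2 - real_of_int a2 * b1" by (simp add: q_def)
    also have "\<bar>\<dots>\<bar> \<le> A0 * B0 + A0 * B0" using A0' by (intro abs_minus_le_of_le)
    finally show ?thesis using AB by linarith
  qed
  have px: "\<bar>q * x0 - p\<bar> \<le> X"
  proof -
    have "q * x0 - p = real_of_int b2 * (a1 * x0 + b1 * y0 - d1) - real_of_int b1 * (a2 * x0 + b2 * y0 - d2)"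
      by (simp add: q_def p_def algebra_simps)
    also have "\<bar>\<dots>\<bar> \<le> B0 * (3 * (A0 * S)) + B0 * (3 * (A0 * S))"
      using A0' W by (intro abs_minus_le_of_le)
    finally show ?thesis by (simp add: X_def mult_ac)
  qed
  have ry: "\<bar>q * y0 - r\<bar> \<le> Y"
  proof -
    have "q * y0 - r = real_of_int a1 * (a2 * x0 + b2 * y0 - d2) - real_of_int a2 * (a1 * x0 + b1 * y0 - d1)"
      by (simp add: q_def r_def algebra_simps)
    also have "\<bar>\<dots>\<bar> \<le> A0 * (3 * (A0 * S)) + A0 * (3 * (A0 * S))"
      using A0' W by (intro abs_minus_le_of_le)
    finally show ?thesis by (simp add: Y_def mult_ac)
  qed
  \<comment> \<open>For parallel lines \<open>r\<close> would be an integer of absolute value below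
    1, hence 0, and the two lines would coincide.\<close>
  have qn: "q \<noteq> 0"
  proof
    assume "q = 0"
    then have "\<bar>real_of_int r\<bar> < 1" using ry Y1 by simp
    then have "r = 0" by linarith
    then show False using ne \<open>q = 0\<close> by (simp add: q_def r_def)
  qed
  have centre: "fst (D k) \<in> ball_of (D k)" using S by (simp add: ball_of_def S_def)
  \<comment> \<open>The largest half-width compatible with the two upper bounds in
    \<open>capture_vec\<close>. That it is at least \<open>X\<close> follows from
    \<open>X \<le> Y\<close> and \<open>XYc\<close>.\<close>
  define \<psi> where "\<psi> = min (sqrt (c / Q)) (c / Q / Y)"
  have cQ: "0 < c / Q" using c Q by simp
  have \<psi>2: "\<psi>\<^sup>2 \<le> c / Q"
  proof -
    have "\<psi>\<^sup>2 \<le> (sqrt (c / Q))\<^sup>2" using c Q X0 by (intro power_mono) (auto simp: \<psi>_def)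
    then show ?thesis using cQ by simp
  qed
  have X\<psi>: "X \<le> \<psi>"
  proof -
    have "X\<^sup>2 \<le> X * Y" using XY X0 by (simp add: power2_eq_square)
    then have "X \<le> sqrt (c / Q)" using XYc by (intro real_le_rsqrt) linarith
    moreover have "X \<le> c / Q / Y" using XYc X0(2) by (simp only: pos_le_divide_eq)
    ultimately show ?thesis by (simp add: \<psi>_def)
  qed
  have Y\<psi>: "Y * \<psi> \<le> c / Q"
  proof -
    have "Y * \<psi> \<le> Y * (c / Q / Y)" using X0 by (intro mult_left_mono) (auto simp: \<psi>_def)
    then show ?thesis using X0 by simp
  qed
  have c\<psi>: "c / Q \<le> \<psi>"
  proof -
    have "c / Q \<le> 1"
    proof -
      have "1 \<le> Q" by (simp add: Q_def)
      then show ?thesis using c_le_1 by (simp add: divide_le_eq)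
    qed
    then have "(c / Q)\<^sup>2 \<le> c / Q" using mult_left_mono[of "c / Q" 1 "c / Q"] cQ
      by (simp only: power2_eq_square less_imp_le mult_1_right)
    then have "c / Q \<le> sqrt (c / Q)" by (rule real_le_rsqrt)
    moreover have "c / Q \<le> c / Q / Y" using mult_left_mono[of Y 1 "c / Q"] cQ Y1 X0(2)
      by (simp only: pos_le_divide_eq less_imp_le mult_1_right)
    ultimately show ?thesis by (simp add: \<psi>_def)
  qed
  have qS: "\<bar>real_of_int q\<bar> * S \<le> \<psi>"
  proof -
    have "real_of_int q = real_of_int a1 * b2 - real_of_int a2 * b1" by (simp add: q_def)
    also have "\<bar>\<dots>\<bar> \<le> A0 * B0 + A0 * B0" using A0' by (intro abs_minus_le_of_le)
    finally have "\<bar>real_of_int q\<bar> * S \<le> (A0 * B0 + A0 * B0) * S" using S by (intro mult_right_mono) auto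
    also have "\<dots> \<le> X" using A0 B0 S by (simp add: X_def algebra_simps)
    finally show ?thesis using X\<psi> by linarith
  qed
  have q0Q: "q0 \<le> Q" using Q by (simp add: q0_def divide_le_eq mult_le_cancel_left1)
  \<comment> \<open>\<open>capture_vec\<close> wants a positive denominator.\<close>
  define q' p' r' where "q' = sgn q * q" and "p' = sgn q * p" and "r' = sgn q * r"
  have q': "0 < q'" "real_of_int q' = \<bar>real_of_int q\<bar>" using qn by (auto simp: q'_def sgn_if)
  have p': "\<bar>q' * x0 - p'\<bar> = \<bar>q * x0 - p\<bar>" "\<bar>q' * y0 - r'\<bar> = \<bar>q * y0 - r\<bar>"
    using qn by (auto simp: q'_def p'_def r'_def sgn_if)
  have "\<bar>q * y0 - r\<bar> * \<psi> \<le> Y * \<psi>"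
    using ry X\<psi> X0 by (intro mult_right_mono) auto
  then have h: "\<bar>q' * x0 - p'\<bar> \<le> \<psi>" "\<bar>q' * y0 - r'\<bar> * \<psi> \<le> c / Q" "\<bar>q' * y0 - r'\<bar> \<le> 1"
    unfolding p' using px X\<psi> ry Y\<psi> Y1 by linarith+
  have h': "real_of_int q' \<le> Q" "q' * S \<le> \<psi>" using q_le q0Q qS by (simp_all add: q'(2))
  have "\<exists>l<k. \<exists>A\<in>obst N (D l). fst (D k) \<in> nbhd_of A \<and> snd (D k) \<le> snd A"
    by (rule capture_vec[OF st start centre q'(1) h'(1)[unfolded Q_def] c\<psi>[unfolded Q_def]
      \<psi>2[unfolded Q_def] h[unfolded Q_def x0_def y0_def] h'(2)[unfolded S_def]])
  then obtain l A where "l < k" "A \<in> obst N (D l)" "fst (D k) \<in> nbhd_of A" "snd (D k) \<le> snd A" by blast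
  moreover from this centre have "meets A (D k)" by (auto simp: meets_def)
  ultimately show False using thin[of l A] by simp
qed

text \<open>Each class has four families, by kind and by orientation, and each family has at most
  one strip. Classes are bounded by \<open>N\<close> because heights are at least 1, and the widths
  sum as a geometric series with ratio \<open>2 powr -\<gamma>\<close>.\<close>

lemma obst_weight:
  assumes st: "stages \<beta> D k" and start: "K \<le> 8^N * snd (D 0)" and \<gamma>: "0 < \<gamma>"
    and thin: "\<And>l A. l < k \<Longrightarrow> A \<in> obst N (D l) \<Longrightarrow> meets A (D k) \<Longrightarrow> snd A < snd (D k)"
  shows "finite (obst N (D k)) \<and>
    (\<Sum>A\<in>obst N (D k). snd A powr \<gamma>) \<le> 4 * K powr -\<gamma> / (1 - 2 powr -\<gamma>) * snd (D k) powr \<gamma>"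
proof -
  let ?D = "D k" and ?I = "(UNIV :: bool set) \<times> {..N} \<times> (UNIV :: bool set)"
  define F where "F = (\<lambda>(s, j, v). if v then {strip s q 0 p (width j ?D) | p r q. vec_obstacle N s j ?D p r q}
     else {strip s a b d (width j ?D) | a b d. cov_obstacle N s j ?D a b d})"
  define g where "g = (\<lambda>j. width j ?D powr \<gamma>)"
  define x where "x = (2::real) powr -\<gamma>"
  have S: "0 < snd ?D" using stages_pos[OF st \<beta>(1)] by simp
  have index: "j \<le> N" if "X * 256^j \<le> (256::real)^N" "1 \<le> X" for j X
  proof -
    have "1 * (256::real)^j \<le> X * 256^j" using that by (intro mult_right_mono) auto
    then have "(256::real)^j \<le> 256^N" using that by linarith
    then show ?thesis by simp
  qed
  have vj: "j \<le> N" if "vec_obstacle N s j ?D p r q" for s j p r q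
    using that by (intro index[of "real_of_int q"]) (auto simp: vec_obstacle_def)
  have cj: "j \<le> N" if v: "cov_obstacle N s j ?D a b d" for s j a b d
  proof -
    have "1 \<le> \<bar>real_of_int a\<bar>" using v unfolding cov_obstacle_def by linarith
    then have "1 * 1 \<le> \<bar>real_of_int a\<bar> * max 1 \<bar>real_of_int b\<bar>" by (intro mult_mono) auto
    then have "1 * 1 \<le> (2 * R) * (\<bar>real_of_int a\<bar> * max 1 \<bar>real_of_int b\<bar>)"
      using R_ge by (intro mult_mono) auto
    then show ?thesis using v by (intro index[of "2 * R * (\<bar>real_of_int a\<bar> * max 1 \<bar>real_of_int b\<bar>)"])
      (auto simp: cov_obstacle_def)
  qed
  have obst: "obst N ?D = (\<Union>i\<in>?I. F i)" (is "?L = ?U")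
  proof (intro equalityI subsetI)
    fix A assume "A \<in> ?L"
    then consider s j p r q where "A = strip s q 0 p (width j ?D)" "vec_obstacle N s j ?D p r q"
      | s j a b d where "A = strip s a b d (width j ?D)" "cov_obstacle N s j ?D a b d"
      unfolding obst_def by blast
    then show "A \<in> ?U"
    proof cases
      case 1
      then show ?thesis using vj[of s j p r q]
        by (intro UN_I[of "(s, j, True)"]) (auto simp: F_def)
    next
      case 2
      then show ?thesis using cj[of s j a b d]
        by (intro UN_I[of "(s, j, False)"]) (auto simp: F_def)
    qed
  next
    fix A assume "A \<in> ?U"
    then obtain s j v where "A \<in> F (s, j, v)" by blast
    then show "A \<in> ?L" unfolding F_def obst_def by (cases v) auto
  qed
  have "finite (\<Union>i\<in>?I. F i) \<and> (\<Sum>A\<in>(\<Union>i\<in>?I. F i). snd A powr \<gamma>) \<le> (\<Sum>(s, j, v)\<in>?I. g j)"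
  proof (rule sum_UNION_le)
    fix i :: "bool \<times> nat \<times> bool"
    obtain s j v where i: "i = (s, j, v)" by (cases i)
    have uniq: "A = A'" if A: "A \<in> F i" "A' \<in> F i" for A A'
    proof (cases v)
      case True
      then obtain p r q p' r' q' where v: "vec_obstacle N s j ?D p r q" "vec_obstacle N s j ?D p' r' q'"
        and AA: "A = strip s q 0 p (width j ?D)" "A' = strip s q' 0 p' (width j ?D)"
        using A by (auto simp: F_def i)
      have "q \<noteq> 0" "q' \<noteq> 0" using v by (simp_all add: vec_obstacle_def)
      then show ?thesis
        unfolding AA using vec_unique[OF st start thin v] by (intro strip_eqI) simp_all
    next
      case False
      then obtain a b d a' b' d' where v: "cov_obstacle N s j ?D a b d" "cov_obstacle N s j ?D a' b' d'"
        and AA: "A = strip s a b d (width j ?D)" "A' = strip s a' b' d' (width j ?D)"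
        using A by (auto simp: F_def i)
      have "a \<noteq> 0" "a' \<noteq> 0" using v by (simp_all add: cov_obstacle_def)
      then show ?thesis
        unfolding AA using cov_unique[OF st start thin v] by (intro strip_eqI) simp_all
    qed
    have "snd A powr \<gamma> \<le> g j" if "A \<in> F i" for A
      using that by (cases v) (auto simp: F_def i g_def)
    then show "finite (F i) \<and> (\<Sum>A\<in>F i. snd A powr \<gamma>) \<le> (case i of (s, j, v) \<Rightarrow> g j)"
      using uniq by (intro sum_subsingleton_le) (simp_all add: i g_def)
  qed simp_all
  moreover have "(\<Sum>(s, j, v)\<in>?I. g j) = 4 * (\<Sum>j\<le>N. g j)"
    by (simp add: sum.cartesian_product[symmetric] UNIV_bool sum_distrib_left)
  moreover have "(\<Sum>j\<le>N. g j) \<le> K powr -\<gamma> / (1 - x) * snd ?D powr \<gamma>"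
  proof -
    have x: "0 \<le> x" "x < 1" using \<gamma> by (auto simp: x_def powr_less_one)
    have "g j = (K powr -\<gamma> * snd ?D powr \<gamma>) * x^j" for j
    proof -
      have "g j = snd ?D powr \<gamma> / (K powr \<gamma> * (2^j) powr \<gamma>)"
        unfolding g_def width_def using S K by (subst powr_divide, simp, simp, subst powr_mult) auto
      also have "((2::real)^j) powr \<gamma> = (2 powr \<gamma>)^j"
        by (simp add: powr_power powr_realpow[symmetric] powr_powr mult.commute)
      finally show ?thesis by (simp add: x_def powr_minus power_inverse field_simps)
    qed
    then have "(\<Sum>j\<le>N. g j) = (K powr -\<gamma> * snd ?D powr \<gamma>) * (\<Sum>j\<le>N. x^j)"
      by (simp add: sum_distrib_left)
    also have "(\<Sum>j\<le>N. x^j) \<le> 1 / (1 - x)"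
      using sum_gp_basic[of x N] x by (simp add: le_divide_eq mult.commute)
    then have "(K powr -\<gamma> * snd ?D powr \<gamma>) * (\<Sum>j\<le>N. x^j) \<le> (K powr -\<gamma> * snd ?D powr \<gamma>) * (1 / (1 - x))"
      by (intro mult_left_mono) auto
    finally show ?thesis by simp
  qed
  ultimately show ?thesis unfolding obst x_def by simp
qed

end

section \<open>Combining the sparse scales\<close>

lemma stages_radius_le:
  assumes "stages \<beta> D k" "0 < \<beta>" "\<beta> < 1"
  shows "snd (D k) \<le> snd (D 0) / 17^k"
  using assms(1)
proof (induction k)
  case (Suc k)
  then have IH: "snd (D k) \<le> snd (D 0) / 17^k" using stages_mono[of \<beta> D "Suc k" k] by simp
  have "\<beta>\<^sup>2 \<le> 1" using assms by (simp add: power_le_one)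
  have "snd (D (Suc k)) \<le> \<beta>\<^sup>2 / 17 * snd (D k)" using Suc.prems by (simp add: stages_def)
  also have "\<dots> \<le> 1 / 17 * snd (D k)"
    using stages_pos[OF Suc.prems assms(2), of k] \<open>\<beta>\<^sup>2 \<le> 1\<close> by (intro mult_right_mono) auto
  finally show ?case using IH by simp
qed simp

lemma dist_nearest_int_bounds: "0 \<le> dist_nearest_int x" "dist_nearest_int x \<le> 1 / 2"
  using of_int_round_abs_le[of x] by (simp_all add: dist_nearest_int_def abs_minus_commute)

context obstacles
begin

text \<open>Heights lie between 1 and \<open>256^N\<close> and classes are at most \<open>N\<close>.
  The lower end of the window, at least \<open>c / 256^N\<close>, then bounds the radius below; the
  upper end, at most \<open>R / 16^N\<close> for points, bounds it above after losing
  \<open>2^N\<close> to the class. Lines satisfy the same bounds with room to spare.\<close>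

lemma obst_active:
  assumes A: "A \<in> obst N D" and S: "0 < snd D"
  shows "c \<le> 65536^N * snd D" "8^N * snd D \<le> R * K"
proof -
  let ?Q = "(256::real)^N"
  have QQ: "?Q * ?Q = 65536^N" by (simp flip: power_mult_distrib)
  have R0: "0 < R" using R_ge by simp
  have index: "j \<le> N" if "X * 256^j \<le> ?Q" "1 \<le> X" for j X
  proof -
    have "1 * (256::real)^j \<le> X * 256^j" using that by (intro mult_right_mono) auto
    then have "(256::real)^j \<le> 256^N" using that by linarith
    then show ?thesis by simp
  qed
  have le_Q: "X \<le> ?Q" if "X * 256^j \<le> ?Q" "0 \<le> X" for j X
    using mult_left_mono[of 1 "256^j" X] that by simp
  have main: "c \<le> 65536^N * snd D \<and> 8^N * snd D \<le> R * K"
    if j: "j \<le> N" and m: "1 \<le> m" "m \<le> ?Q" "c / ?Q \<le> m * width j D"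
      and up: "8^N * 2^j * (m * width j D) \<le> R" for m j
  proof -
    have w: "width j D \<le> snd D" "0 \<le> width j D" "K * 2^j * width j D = snd D"
      using width_le[of D j] S by simp_all
    have "c / ?Q \<le> ?Q * snd D"
      using m w mult_mono[of m ?Q "width j D" "snd D"] by simp
    then have "c \<le> 65536^N * snd D" using QQ by (simp add: divide_le_eq mult_ac)
    moreover have "8^N * snd D \<le> R * K"
    proof -
      have "8^N * snd D = K * (8^N * 2^j * (1 * width j D))" unfolding w(3)[symmetric] by simp
      also have "\<dots> \<le> K * (8^N * 2^j * (m * width j D))"
        using K w m by (intro mult_left_mono mult_right_mono) auto
      also have "\<dots> \<le> K * R" using up K by (intro mult_left_mono) auto
      finally show ?thesis by (simp add: mult.commute)
    qed
    ultimately show ?thesis ..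
  qed
  from A consider s j p r q where "vec_obstacle N s j D p r q" | s j a b d where "cov_obstacle N s j D a b d"
    unfolding obst_def by blast
  then have "c \<le> 65536^N * snd D \<and> 8^N * snd D \<le> R * K"
  proof cases
    case 1
    then have v: "1 \<le> real_of_int q" "real_of_int q * 256^j \<le> ?Q" "c / ?Q \<le> real_of_int q * width j D"
        "(real_of_int q * width j D)\<^sup>2 \<le> R\<^sup>2 * c / ?Q"
      by (auto simp: vec_obstacle_def)
    have jN: "j \<le> N" using index v by blast
    have "real_of_int q * width j D \<le> R / 16^N"
    proof (rule power2_le_imp_le)
      have "((16::real)^N)\<^sup>2 = 256^N" by (simp add: power2_eq_square flip: power_mult_distrib)
      then have "(R / 16^N)\<^sup>2 = R\<^sup>2 * 1 / ?Q" by (simp add: power_divide)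
      moreover have "R\<^sup>2 * c / ?Q \<le> R\<^sup>2 * 1 / ?Q"
        using c_le_1 by (intro divide_right_mono mult_left_mono) auto
      ultimately show "(real_of_int q * width j D)\<^sup>2 \<le> (R / 16^N)\<^sup>2" using v(4) by linarith
    qed (use R0 in simp)
    then have "8^N * 2^j * (real_of_int q * width j D) \<le> 8^N * 2^N * (R / 16^N)"
      using jN v(1) R0 width_le(2)[of D j] S by (intro mult_mono power_increasing) auto
    also have "(8::real)^N * 2^N = 16^N" by (simp flip: power_mult_distrib)
    finally show ?thesis using main[OF jN v(1) le_Q[OF v(2)] v(3)] v(1) by simp
  next
    case 2
    define X where "X = 2 * R * (\<bar>real_of_int a\<bar> * max 1 \<bar>real_of_int b\<bar>)"
    have v: "a \<noteq> 0" "X * 256^j \<le> ?Q" "e * 4^j / ?Q \<le> \<bar>real_of_int a\<bar> * width j D"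
        "\<bar>real_of_int a\<bar> * width j D \<le> R * (e * 4^j / ?Q)"
      using 2 unfolding cov_obstacle_def X_def by auto
    have a1: "1 \<le> \<bar>real_of_int a\<bar>" using v(1) by linarith
    have "\<bar>real_of_int a\<bar> * 1 \<le> \<bar>real_of_int a\<bar> * max 1 \<bar>real_of_int b\<bar>" using a1 by (intro mult_left_mono) auto
    then have "1 * \<bar>real_of_int a\<bar> \<le> (2 * R) * (\<bar>real_of_int a\<bar> * max 1 \<bar>real_of_int b\<bar>)"
      using R_ge by (intro mult_mono) auto
    then have aX: "\<bar>real_of_int a\<bar> \<le> X" by (simp add: X_def)
    then have jN: "j \<le> N" using index[OF v(2)] a1 by linarith
    have aQ: "\<bar>real_of_int a\<bar> \<le> ?Q" using le_Q[OF v(2)] aX a1 by linarith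
    have "c * 1 \<le> e * 4^j" using c_le_e c e by (intro mult_mono) auto
    then have "c / ?Q \<le> e * 4^j / ?Q" by (intro divide_right_mono) auto
    then have low: "c / ?Q \<le> \<bar>real_of_int a\<bar> * width j D" using v(3) by linarith
    have "8^N * 2^j * (\<bar>real_of_int a\<bar> * width j D) \<le> 8^N * 2^j * (R * (e * 4^j / ?Q))"
      using v(4) by (intro mult_left_mono) auto
    also have "\<dots> = R * (e * (8^N * (2^j * 4^j) / ?Q))" by simp
    also have "(2::real)^j * 4^j = 8^j" by (simp flip: power_mult_distrib)
    also have "R * (e * (8^N * 8^j / ?Q)) \<le> R * (1 * 1)"
    proof -
      have "(8::real)^N * 8^j \<le> 8^N * 8^N" using jN by (intro mult_left_mono power_increasing) auto
      also have "\<dots> = 64^N" by (simp flip: power_mult_distrib)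
      also have "\<dots> \<le> ?Q" by (intro power_mono) auto
      finally show ?thesis using R0 e e_le_1 by (intro mult_left_mono mult_mono) auto
    qed
    finally show ?thesis using main[OF jN a1 aQ low] by simp
  qed
  then show "c \<le> 65536^N * snd D" "8^N * snd D \<le> R * K" by blast+
qed

text \<open>
  This is the reason for using only the exponents \<open>M * 7^n\<close>: no ball meets obstacles of two of them.
\<close>

lemma obst_disjoint:
  assumes A: "A \<in> obst N D" "A' \<in> obst N' D" and S: "0 < snd D"
    and M: "R * K < 8^M * c" "M \<le> N"
  shows "N' < 7 * N"
proof (rule ccontr)
  assume "\<not> N' < 7 * N"
  then have "(8::real)^(7 * N) * snd D \<le> 8^N' * snd D"
    using S by (intro mult_right_mono power_increasing) auto
  also have "\<dots> \<le> R * K" by (rule obst_active(2)[OF A(2) S])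
  also have "\<dots> < 8^M * c" by fact
  also have "\<dots> \<le> 8^N * c" using M c by (intro mult_right_mono power_increasing) auto
  also have "\<dots> \<le> 8^N * (65536^N * snd D)" using obst_active(1)[OF A(1) S] by (intro mult_left_mono) auto
  \<comment> \<open>262144 is \<open>8^6\<close>; together with the leading \<open>8^N\<close> this
    produces the exponent 7.\<close>
  also have "\<dots> \<le> 8^N * (262144^N * snd D)" using S by (intro mult_left_mono mult_right_mono power_mono) auto
  also have "\<dots> = (8 * 262144)^N * snd D" by (simp only: power_mult_distrib mult.assoc)
  also have "((8::real) * 262144)^N = 8^(7 * N)" by (simp add: power_mult)
  finally show False by simp
qed

text \<open>A product that is too small puts \<open>z\<close> in a box around a rational point. The
  coordinate with the smaller error is taken first, and \<open>capture_vec\<close> at a sufficiently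
  late stage yields a recorded strip containing \<open>z\<close>.\<close>

lemma product_ge:
  fixes q :: nat
  assumes st: "\<And>k. stages \<beta> D k" and start: "K \<le> 8^N * snd (D 0)" and z: "\<And>k. z \<in> ball_of (D k)"
    and avoid: "\<And>k A. A \<in> obst N (D k) \<Longrightarrow> z \<notin> nbhd_of A"
    and q: "0 < q" "q \<le> 256^N"
  shows "c / 256^N \<le> dist_nearest_int (real q * fst z) * dist_nearest_int (real q * snd z)"
proof (rule ccontr)
  assume "\<not> ?thesis"
  then have lt: "dist_nearest_int (real q * cx s z) * dist_nearest_int (real q * cx (\<not> s) z) < c / 256^N" for s
    by (cases s) (simp_all add: cx_def mult.commute)
  define C where "C = c / 256^N"
  define f where "f s = dist_nearest_int (real q * cx s z)" for s
  have "f True \<le> f (\<not> True) \<or> f False \<le> f (\<not> False)" by auto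
  then obtain s where s: "f s \<le> f (\<not> s)" by blast
  define t \<sigma> where "t = f (\<not> s)" and "\<sigma> = sqrt C"
  have C: "0 < C" "C \<le> 1" using c c_le_1 one_le_power[of "256::real" N] by (auto simp: C_def divide_le_eq intro: order_trans)
  have \<sigma>: "0 < \<sigma>" "\<sigma> \<le> 1" "\<sigma> * \<sigma> = C" using C by (simp_all add: \<sigma>_def)
  have f: "0 \<le> f s" "f s \<le> t" "0 \<le> t" "t \<le> 1/2" "f s * t < C"
    using s lt[of s] dist_nearest_int_bounds by (simp_all add: f_def t_def C_def)
  \<comment> \<open>Raising the larger error to at least the square root of \<open>C\<close> keeps
    \<psi> below that root; \<open>t' \<le> 1\<close> gives \<open>C \<le> \<psi>\<close>.\<close>
  define t' where "t' = max t \<sigma>"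
  define \<psi> where "\<psi> = C / t'"
  have t': "0 < t'" "t' \<le> 1" "t \<le> t'" "\<sigma> \<le> t'" using f \<sigma> by (auto simp: t'_def)
  have \<psi>0: "0 < \<psi>" using C t' by (simp add: \<psi>_def)
  have "\<sigma> * \<sigma> \<le> \<sigma> * t'" using t' \<sigma> by (intro mult_left_mono) auto
  then have "\<psi> \<le> \<sigma>" using t' \<sigma>(3) by (simp add: \<psi>_def divide_le_eq)
  then have \<psi>2: "\<psi>\<^sup>2 \<le> C" using \<psi>0 \<sigma> mult_mono[of \<psi> \<sigma> \<psi> \<sigma>] by (simp add: power2_eq_square)
  have C\<psi>: "C \<le> \<psi>" using t' C by (simp add: \<psi>_def le_divide_eq mult_le_cancel_left2)
  have u: "f s \<le> \<psi>"
  proof -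
    have "f s * t' \<le> C"
    proof (cases "t \<le> \<sigma>")
      case True
      have "f s * \<sigma> \<le> \<sigma> * \<sigma>" using True f \<sigma> by (intro mult_right_mono) auto
      then show ?thesis using True \<sigma> by (simp add: t'_def)
    qed (use f in \<open>simp add: t'_def\<close>)
    then show ?thesis using t' by (simp add: \<psi>_def le_divide_eq)
  qed
  have t\<psi>: "t * \<psi> \<le> C"
    using mult_right_mono[OF t'(3), of \<psi>] \<psi>0 t' by (simp add: \<psi>_def)
  obtain k where k: "real q * snd (D 0) / \<psi> < 17^k" using real_arch_pow[of 17] by auto
  have "real q * snd (D k) \<le> real q * (snd (D 0) / 17^k)"
    using stages_radius_le[OF st] \<beta> by (intro mult_left_mono) auto
  also have "\<dots> \<le> \<psi>" using k \<psi>0 by (simp add: field_simps)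
  finally have k\<psi>: "real q * snd (D k) \<le> \<psi>" .
  have "real q \<le> 256^N" using q(2) by (metis of_nat_le_iff of_nat_numeral of_nat_power)
  then obtain l A where "A \<in> obst N (D l)" "z \<in> nbhd_of A"
    using capture_vec[OF st start z, where q = "int q" and s = s and \<psi> = \<psi>
        and p = "round (real q * cx s z)" and r = "round (real q * cx (\<not> s) z)", of k]
      q(1) C\<psi> \<psi>2 u t\<psi> f(4) k\<psi> by (auto simp: C_def f_def t_def dist_nearest_int_def)
  then show False using avoid by blast
qed

lemma in_E_set:
  fixes M :: "nat \<Rightarrow> nat"
  assumes M: "strict_mono M"
    and le: "\<And>n q::nat. 0 < q \<Longrightarrow> q \<le> 256^M n \<Longrightarrow>
      c / 256^M n \<le> dist_nearest_int (real q * fst z) * dist_nearest_int (real q * snd z)"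
  shows "z \<in> E_set"
proof -
  define X where "X Q = ereal (real Q * Min ((\<lambda>q. dist_nearest_int (real q * fst z) * dist_nearest_int (real q * snd z)) ` {1..Q}))" for Q :: nat
  define h where "h n = (256::nat)^M n" for n :: nat
  have h: "strict_mono h" using M by (auto simp: strict_mono_def h_def)
  have "ereal c \<le> (X \<circ> h) n" for n
  proof -
    have h0: "1 \<le> h n" by (simp add: h_def)
    have "c / real (h n) \<le> Min ((\<lambda>q. dist_nearest_int (real q * fst z) * dist_nearest_int (real q * snd z)) ` {1..h n})"
      using h0 le[of _ n] by (subst Min_ge_iff) (auto simp: h_def)
    then show ?thesis using h0 by (simp add: X_def divide_le_eq mult.commute)
  qed
  then have "ereal c \<le> limsup (X \<circ> h)" by (intro le_Limsup) auto
  also have "\<dots> \<le> limsup X" by (rule limsup_subseq_mono[OF h])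
  finally have "0 < limsup X" using c by (metis ereal_less(2) less_le_trans)
  then show ?thesis by (simp add: E_set_def X_def[abs_def] case_prod_beta)
qed

lemma beta_HAW_E_set:
  assumes \<gamma>: "0 < \<gamma>" "7/8 \<le> (\<beta>^3/17) powr \<gamma>"
    and K\<gamma>: "4 * K powr -\<gamma> / (1 - 2 powr -\<gamma>) \<le> (\<beta>\<^sup>2/17) powr \<gamma> / 8"
  shows "beta_HAW \<beta> E_set"
proof -
  \<comment> \<open>The first condition separates the scales in \<open>obst_disjoint\<close>; the
    second is the hypothesis \<open>start\<close> at every scale used.\<close>
  define M where "M \<rho> = (SOME m. R * K < 8^m * c \<and> K \<le> 8^m * \<rho>)" for \<rho>
  have M: "R * K < 8^M \<rho> * c" "K \<le> 8^M \<rho> * \<rho>" if "0 < \<rho>" for \<rho>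
  proof -
    obtain m where m: "R * K / c < 8^m" using real_arch_pow[of 8] by auto
    obtain n where n: "K / \<rho> < 8^n" using real_arch_pow[of 8] by auto
    have "(8::real)^m \<le> 8^(max m n)" "(8::real)^n \<le> 8^(max m n)" by (intro power_increasing; simp)+
    then have "R * K / c < 8^(max m n)" "K / \<rho> < 8^(max m n)" using m n by linarith+
    then have "\<exists>m. R * K < 8^m * c \<and> K \<le> 8^m * \<rho>"
      using c that by (intro exI[of _ "max m n"]) (simp add: divide_less_eq mult.commute)
    from someI_ex[OF this, folded M_def] show "R * K < 8^M \<rho> * c" "K \<le> 8^M \<rho> * \<rho>" by auto
  qed
  have M0: "0 < M \<rho>" if "0 < \<rho>" for \<rho>
  proof (rule ccontr)
    assume "\<not> ?thesis"
    then have "R * K < 1" using M(1)[OF that] c_le_1 by simp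
    moreover have "1 * 1 \<le> R * K" using R_ge K by (intro mult_mono) auto
    ultimately show False by simp
  qed
  define NN where "NN \<rho> D = (\<Union>n. obst (M \<rho> * 7^n) D)" for \<rho> D
  show ?thesis
  \<comment> \<open>The guard is there because strips must have positive width for every
    \<open>D\<close>, including pairs with nonpositive radius that occur in no play.\<close>
  proof (rule potential_game[OF \<beta> \<gamma>, where \<eta> = "(\<beta>\<^sup>2/17) powr \<gamma>" and N = "\<lambda>\<rho> D. if 0 < snd D then NN \<rho> D else {}"])
    show "0 < (\<beta>\<^sup>2/17) powr \<gamma>" using \<beta> by simp
    have "\<beta>\<^sup>2 \<le> 1" using \<beta> by (simp add: power_le_one)
    then show "(\<beta>\<^sup>2/17) powr \<gamma> \<le> 1" using \<beta> \<gamma> by (intro powr_le1) auto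
    show "affine_hyperplane (fst A) \<and> 0 < snd A" if A: "A \<in> (if 0 < snd D then NN \<rho> D else {})" for \<rho> D A
    proof -
      have S: "0 < snd D" using A by (auto split: if_splits)
      have w: "0 < width j D" for j using S K by (simp add: width_def)
      obtain N where "A \<in> obst N D" using A by (auto simp: NN_def split: if_splits)
      then show ?thesis
        by (auto simp: obst_def vec_obstacle_def cov_obstacle_def w intro!: affine_hyperplane_strip)
    qed
  next
    fix D k
    assume st: "stages \<beta> D k" and thin': "\<And>j A. j < k \<Longrightarrow> A \<in> (if 0 < snd (D j) then NN (snd (D 0)) (D j) else {}) \<Longrightarrow>
      meets A (D k) \<Longrightarrow> snd A < snd (D k)"
    have pos: "0 < snd (D j)" if "j \<le> k" for j using stages_pos[OF st \<beta>(1) that] .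
    have thin: "snd A < snd (D k)" if "j < k" "A \<in> NN (snd (D 0)) (D j)" "meets A (D k)" for j A
      using thin'[of j A] pos[of j] that by simp
    let ?M = "M (snd (D 0))"
    have "finite (NN (snd (D 0)) (D k)) \<and>
      (\<Sum>A\<in>NN (snd (D 0)) (D k). snd A powr \<gamma>) \<le> (\<beta>\<^sup>2/17) powr \<gamma> / 8 * snd (D k) powr \<gamma>"
    proof (cases "NN (snd (D 0)) (D k) = {}")
      case False
      then obtain n A where A: "A \<in> obst (?M * 7^n) (D k)" by (auto simp: NN_def)
      have uniq: "m = n" if "A' \<in> obst (?M * 7^m) (D k)" for m A'
      proof -
        have less: "\<not> i < j" if "A \<in> obst (?M * 7^i) (D k)" "A' \<in> obst (?M * 7^j) (D k)" for i j A A'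
        proof
          assume "i < j"
          then have "(7::nat)^(Suc i) \<le> 7^j" by (intro power_increasing) auto
          then have "7 * (?M * 7^i) \<le> ?M * 7^j" by simp
          moreover have "?M * 7^j < 7 * (?M * 7^i)"
            by (rule obst_disjoint[OF that pos M(1)]) (use pos[of 0] in auto)
          ultimately show False by simp
        qed
        show ?thesis using less[OF A that] less[OF that A] by simp
      qed
      have eq: "NN (snd (D 0)) (D k) = obst (?M * 7^n) (D k)"
        unfolding NN_def using uniq by blast
      have "?M \<le> ?M * 7^n" by simp
      then have "(8::real)^?M * snd (D 0) \<le> 8^(?M * 7^n) * snd (D 0)"
        using pos[of 0] by (intro mult_right_mono power_increasing) auto
      then have start: "K \<le> 8^(?M * 7^n) * snd (D 0)" using M(2)[OF pos[OF le0]] by (rule order_trans[rotated])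
      have "finite (obst (?M * 7^n) (D k)) \<and> (\<Sum>A\<in>obst (?M * 7^n) (D k). snd A powr \<gamma>)
          \<le> 4 * K powr -\<gamma> / (1 - 2 powr -\<gamma>) * snd (D k) powr \<gamma>"
        using thin by (intro obst_weight[OF st start \<gamma>(1)]) (auto simp: NN_def)
      moreover have "4 * K powr -\<gamma> / (1 - 2 powr -\<gamma>) * snd (D k) powr \<gamma> \<le> (\<beta>\<^sup>2/17) powr \<gamma> / 8 * snd (D k) powr \<gamma>"
        using K\<gamma> by (intro mult_right_mono) auto
      ultimately show ?thesis unfolding eq by linarith
    qed simp
    then show "finite (if 0 < snd (D k) then NN (snd (D 0)) (D k) else {}) \<and>
      (\<Sum>A\<in>(if 0 < snd (D k) then NN (snd (D 0)) (D k) else {}). snd A powr \<gamma>) \<le> (\<beta>\<^sup>2/17) powr \<gamma> / 8 * snd (D k) powr \<gamma>"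
      using pos[of k] by simp
  next
    fix D z
    assume st: "\<And>k. stages \<beta> D k" and z: "\<And>k. z \<in> ball_of (D k)"
      and avoid': "\<And>k A. A \<in> (if 0 < snd (D k) then NN (snd (D 0)) (D k) else {}) \<Longrightarrow> z \<notin> nbhd_of A"
    have pos: "0 < snd (D j)" for j using stages_pos[OF st \<beta>(1), of j j] by simp
    let ?M = "M (snd (D 0))"
    show "z \<in> E_set"
    proof (rule in_E_set[of "\<lambda>n. ?M * 7^n"])
      show "strict_mono (\<lambda>n. ?M * 7^n)" using M0[OF pos] by (simp add: strict_mono_def)
      fix n q :: nat
      assume q: "0 < q" "q \<le> 256^(?M * 7^n)"
      have "?M \<le> ?M * 7^n" by simp
      then have "(8::real)^?M * snd (D 0) \<le> 8^(?M * 7^n) * snd (D 0)"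
        using pos[of 0] by (intro mult_right_mono power_increasing) auto
      then have start: "K \<le> 8^(?M * 7^n) * snd (D 0)" using M(2)[OF pos] by (rule order_trans[rotated])
      have "z \<notin> nbhd_of A" if "A \<in> obst (?M * 7^n) (D k)" for k A
        using avoid'[of A k] pos[of k] that by (auto simp: NN_def)
      then show "c / 256^(?M * 7^n) \<le> dist_nearest_int (real q * fst z) * dist_nearest_int (real q * snd z)"
        by (rule product_ge[OF st start z _ q])
    qed
  qed simp
qed

end

lemma HAW_E_set: "HAW E_set"
  unfolding HAW_def
proof (intro allI impI)
  fix \<beta> :: real
  assume "0 < \<beta> \<and> \<beta> < 1/3"
  then have \<beta>: "0 < \<beta>" "\<beta> < 1/3" by auto
  have \<beta>3: "\<beta>^3 \<le> 1" using \<beta> by (simp add: power_le_one)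
  \<comment> \<open>Chosen so that the greatest loss per stage is exactly 7/8.\<close>
  define \<gamma> where "\<gamma> = ln (7/8) / ln (\<beta>^3/17)"
  have \<gamma>0: "0 < \<gamma>" unfolding \<gamma>_def using \<beta> \<beta>3 by (intro divide_neg_neg) (auto simp: ln_less_zero_iff)
  have \<gamma>: "7/8 \<le> (\<beta>^3/17) powr \<gamma>"
  proof -
    have "ln (\<beta>^3/17) \<noteq> 0" using \<beta> \<beta>3 by simp
    then have "(\<beta>^3/17) powr \<gamma> = 7/8" using \<beta> by (simp add: \<gamma>_def powr_def)
    then show ?thesis by simp
  qed
  \<comment> \<open>The value of \<open>K powr \<gamma>\<close> at which the bound of
    \<open>obst_weight\<close> equals the admissible weight of new strips.\<close>
  define X where "X = 32 / ((\<beta>\<^sup>2/17) powr \<gamma> * (1 - 2 powr -\<gamma>))"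
  define K where "K = max 2 (X powr (1 / \<gamma>))"
  have x: "2 powr -\<gamma> < (1::real)" using \<gamma>0 by (simp add: powr_less_one)
  have B0: "0 < (\<beta>\<^sup>2/17) powr \<gamma>" using \<beta> by simp
  have X0: "0 < X" using x B0 by (simp add: X_def)
  have "X = (X powr (1 / \<gamma>)) powr \<gamma>" using X0 \<gamma>0 by (simp add: powr_powr)
  also have "\<dots> \<le> K powr \<gamma>" using \<gamma>0 by (intro powr_mono2) (auto simp: K_def)
  finally have "1 / K powr \<gamma> \<le> 1 / X" using X0 by (intro divide_left_mono) (auto simp: K_def)
  then have "K powr -\<gamma> \<le> 1 / X" by (simp add: powr_minus divide_inverse)
  then have "4 * K powr -\<gamma> \<le> (1 - 2 powr -\<gamma>) * ((\<beta>\<^sup>2/17) powr \<gamma> / 8)" by (simp add: X_def mult_ac)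
  then have K\<gamma>: "4 * K powr -\<gamma> / (1 - 2 powr -\<gamma>) \<le> (\<beta>\<^sup>2/17) powr \<gamma> / 8"
    using x by (simp add: divide_le_eq mult_ac)
  define R where "R = 17 / \<beta>^3"
  have R1: "1 \<le> R" using \<beta> \<beta>3 by (simp add: R_def)
  have K2: "2 \<le> K" by (simp add: K_def)
  define T where "T = R * K"
  have T1: "1 \<le> T" using R1 K2 mult_mono[of 1 R 1 K] by (simp add: T_def)
  \<comment> \<open>With this \<open>c\<close> the condition \<open>ec\<close> is an equality. The
    other conditions on \<open>c\<close> and \<open>e\<close> are bounded through factors
    \<open>T^4 * e\<close>, which equals \<open>1 / 2^30\<close>.\<close>
  define e where "e = 1 / (2^30 * T^4)"
  define c where "c = 18 * R\<^sup>2 * K\<^sup>2 * e\<^sup>2"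
  have e0: "0 < e" using T1 by (simp add: e_def)
  have eT: "T^4 * e = 1 / 2^30" using T1 by (simp add: e_def)
  interpret obstacles \<beta> R K c e
  proof
    show "0 < \<beta>" "\<beta> < 1/3" "R = 17 / \<beta>^3" "2 \<le> K" "0 < e" by (fact \<beta> R_def K2 e0)+
    show "0 < c" using R1 K2 e0 by (simp add: c_def)
    show "18 * R\<^sup>2 * K\<^sup>2 * e\<^sup>2 \<le> c" by (simp add: c_def)
    have "12 * R * e * K = 12 * (T^1 * e)" by (simp add: T_def)
    also have "\<dots> \<le> 12 * (T^4 * e)" using T1 e0 by (intro mult_left_mono mult_right_mono power_increasing) auto
    also have "\<dots> \<le> 1" unfolding eT by simp
    finally show "12 * R * e * K \<le> 1" .
    have "2^19 * R\<^sup>2 * K\<^sup>2 * c = 2^19 * 18 * (T^4 * e) * e"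
      by (simp add: c_def T_def power_mult_distrib power2_eq_square power4_eq_xxxx)
    also have "\<dots> \<le> e" using e0 unfolding eT by simp
    finally show "2^19 * R\<^sup>2 * K\<^sup>2 * c \<le> e" .
    have "2^22 * R^4 * K\<^sup>2 * c = 2^22 * 18 * e\<^sup>2 * (R^6 * K^4)"
      by (simp add: c_def power_add[symmetric] mult_ac)
    also have "\<dots> \<le> 2^22 * 18 * e\<^sup>2 * (R^8 * K^8)"
      using R1 K2 by (intro mult_left_mono mult_mono power_increasing) auto
    also have "\<dots> = 2^22 * 18 * (T^4 * e)\<^sup>2" by (simp add: T_def power_mult_distrib)
    also have "\<dots> \<le> 1" unfolding eT by (simp add: power2_eq_square)
    finally show "2^22 * R^4 * K\<^sup>2 * c \<le> 1" .
  qed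
  show "beta_HAW \<beta> E_set" by (rule beta_HAW_E_set[OF \<gamma>0 \<gamma> K\<gamma>])
qed

section \<open>Hausdorff dimension\<close>

lemma powr_square_cells:
  fixes s \<epsilon> \<delta> :: real
  assumes "2 < s" "0 < \<epsilon>" "0 < \<delta>"
  obtains N :: nat where "0 < N" "2 / N \<le> \<delta>" "real N ^ 2 * (2 / N) powr s \<le> \<epsilon>"
proof -
  have "((\<lambda>x::real. 2 powr s * x powr (2 - s)) \<longlongrightarrow> 2 powr s * 0) at_top"
    using assms by (intro tendsto_mult tendsto_const tendsto_neg_powr filterlim_ident) auto
  then have "\<forall>\<^sub>F x in at_top. 2 powr s * x powr (2 - s) < \<epsilon>"
    using assms by (simp add: order_tendstoD(2))
  then have "\<forall>\<^sub>F n in sequentially. 2 powr s * real n powr (2 - s) < \<epsilon>"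
    by (rule eventually_compose_filterlim[OF _ filterlim_real_sequentially])
  moreover have "\<forall>\<^sub>F n in sequentially. 2 / \<delta> \<le> real n"
    by (rule eventually_compose_filterlim[OF eventually_ge_at_top filterlim_real_sequentially])
  moreover have "\<forall>\<^sub>F n in sequentially. 0 < n" by (rule eventually_gt_at_top)
  ultimately have "\<forall>\<^sub>F n in sequentially. 2 powr s * real n powr (2 - s) < \<epsilon> \<and> 2 / \<delta> \<le> real n \<and> 0 < n"
    by (intro eventually_conj)
  from eventually_happens[OF this]
  obtain N where N: "2 powr s * real N powr (2 - s) < \<epsilon>" "2 / \<delta> \<le> real N" "0 < N" by auto
  have "real N ^ 2 * (2 / N) powr s = 2 powr s * real N powr (2 - s)"
    using N(3) by (simp add: powr_divide powr_diff powr_numeral)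
  then show ?thesis using that[OF N(3)] N assms by (simp add: field_simps)
qed

definition cell :: "int \<times> int \<Rightarrow> nat \<Rightarrow> nat \<Rightarrow> (real \<times> real) set" where
  "cell p N l = {fst p + real (l mod N) / N .. fst p + real (l mod N) / N + 1 / N} \<times>
     {snd p + real (l div N) / N .. snd p + real (l div N) / N + 1 / N}"

lemma cell_diameter: "bounded (cell p N l)" "diameter (cell p N l) \<le> 2 / N"
proof -
  show "bounded (cell p N l)" unfolding cell_def by (intro bounded_Times bounded_closed_interval)
  have "dist z w \<le> 2 / N" if "z \<in> cell p N l" "w \<in> cell p N l" for z w
  proof -
    have "\<bar>fst z - fst w\<bar> \<le> 1 / N" "\<bar>snd z - snd w\<bar> \<le> 1 / N"
      using that by (auto simp: cell_def)
    moreover have "dist z w \<le> \<bar>fst z - fst w\<bar> + \<bar>snd z - snd w\<bar>"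
      by (simp add: dist_prod_def dist_real_def sqrt_sum_squares_le_sum_abs)
    ultimately show ?thesis by simp
  qed
  then show "diameter (cell p N l) \<le> 2 / N"
    by (intro diameter_le) (auto simp: dist_norm)
qed

lemma mem_cell:
  assumes "0 < N"
  obtains l where "l < N\<^sup>2" "z \<in> cell (\<lfloor>fst z\<rfloor>, \<lfloor>snd z\<rfloor>) N l"
proof -
  define i where "i x = nat \<lfloor>frac x * N\<rfloor>" for x :: real
  have i: "i x < N" "\<lfloor>x\<rfloor> + real (i x) / N \<le> x" "x \<le> \<lfloor>x\<rfloor> + real (i x) / N + 1 / N" for x
  proof -
    have x: "x = \<lfloor>x\<rfloor> + frac x" by (simp add: frac_def)
    have f: "0 \<le> frac x * N" "frac x * N < N" using assms frac_lt_1[of x] by auto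
    then have "real (i x) = of_int \<lfloor>frac x * N\<rfloor>" by (simp add: i_def)
    then have "real (i x) \<le> frac x * N" "frac x * N < real (i x) + 1" by linarith+
    then show "i x < N" using f by linarith
    have "real (i x) / N \<le> frac x" "frac x \<le> real (i x) / N + 1 / N"
      using \<open>real (i x) \<le> frac x * N\<close> \<open>frac x * N < real (i x) + 1\<close> assms by (simp_all add: field_simps)
    then show "\<lfloor>x\<rfloor> + real (i x) / N \<le> x" "x \<le> \<lfloor>x\<rfloor> + real (i x) / N + 1 / N" using x by linarith+
  qed
  define l where "l = i (snd z) * N + i (fst z)"
  have "l < (i (snd z) + 1) * N" using i(1)[of "fst z"] by (simp add: l_def)
  also have "\<dots> \<le> N * N" using i(1)[of "snd z"] by (intro mult_right_mono) auto
  finally have "l < N\<^sup>2" by (simp add: power2_eq_square)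
  moreover have "l mod N = i (fst z)" "l div N = i (snd z)" using i(1)[of "fst z"] by (simp_all add: l_def)
  then have "z \<in> cell (\<lfloor>fst z\<rfloor>, \<lfloor>snd z\<rfloor>) N l"
    using i[of "fst z"] i[of "snd z"] by (cases z) (auto simp: cell_def)
  ultimately show ?thesis by (rule that)
qed

text \<open>The plane is a countable union of unit squares. As s > 2, the i-th can be cut into a
  grid so fine that it contributes at most \<open>\<epsilon> * (1/2)^Suc i\<close>.\<close>

lemma hausdorff_measure_eq_0:
  fixes A :: "(real \<times> real) set"
  assumes "2 < s"
  shows "hausdorff_measure s A = 0"
proof -
  have pre: "hausdorff_premeasure s \<delta> A \<le> ennreal \<epsilon>" if "0 < \<delta>" "0 < \<epsilon>" for \<delta> \<epsilon>
  proof -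
    have "\<exists>N::nat. 0 < N \<and> 2 / N \<le> \<delta> \<and> real N ^ 2 * (2 / N) powr s \<le> \<epsilon> * (1/2)^Suc i" for i
      using powr_square_cells[of s "\<epsilon> * (1/2)^Suc i" \<delta>] assms that by (metis zero_less_mult_iff zero_less_power half_gt_zero zero_less_one)
    then obtain N :: "nat \<Rightarrow> nat" where N: "\<And>i. 0 < N i" "\<And>i. 2 / N i \<le> \<delta>"
      "\<And>i. real (N i) ^ 2 * (2 / N i) powr s \<le> \<epsilon> * (1/2)^Suc i" by metis
    define corner where "corner i = map_prod int_decode int_decode (prod_decode i)" for i
    have corner: "\<exists>i. corner i = p" for p
      by (intro exI[of _ "prod_encode (map_prod int_encode int_encode p)"]) (cases p, simp add: corner_def)
    \<comment> \<open>Surplus indices get the empty set, which contributes 0 to the sum for every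
      exponent.\<close>
    define V where "V = (\<lambda>(i, l). if l < (N i)\<^sup>2 then cell (corner i) (N i) l else {})"
    define U where "U n = V (prod_decode n)" for n
    have V: "bounded (V (i, l)) \<and> diameter (V (i, l)) \<le> 2 / N i" for i l
      using cell_diameter by (simp add: V_def)
    have "A \<subseteq> (\<Union>n. U n)"
    proof (rule subsetI)
      fix z :: "real \<times> real"
      obtain i where i: "corner i = (\<lfloor>fst z\<rfloor>, \<lfloor>snd z\<rfloor>)" using corner by blast
      obtain l where "l < (N i)\<^sup>2" "z \<in> cell (corner i) (N i) l"
        using mem_cell[OF N(1)[of i], of z] i by auto
      then have "z \<in> U (prod_encode (i, l))" by (simp add: U_def V_def)
      then show "z \<in> (\<Union>n. U n)" by blast
    qed
    moreover have "bounded (U n) \<and> diameter (U n) \<le> \<delta>" for n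
      using V N(2) by (cases "prod_decode n") (auto simp: U_def intro: order_trans)
    ultimately have "hausdorff_premeasure s \<delta> A \<le> (\<Sum>n. diam_pow s (U n))"
      unfolding hausdorff_premeasure_def by (intro Inf_lower) blast
    also have "\<dots> = (\<Sum>i. \<Sum>l. diam_pow s (V (i, l)))"
      unfolding U_def using suminf_ennreal_2dimen[of "\<lambda>i. \<Sum>l. diam_pow s (V (i, l))" "\<lambda>x. diam_pow s (V x)"] by simp
    also have "\<dots> \<le> (\<Sum>i. ennreal (\<epsilon> * (1/2)^Suc i))"
    proof (intro suminf_le summableI)
      fix i
      have "(\<Sum>l. diam_pow s (V (i, l))) = (\<Sum>l<(N i)\<^sup>2. diam_pow s (V (i, l)))"
        by (intro suminf_finite) (auto simp: V_def diam_pow_def)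
      also have "\<dots> \<le> (\<Sum>l<(N i)\<^sup>2. ennreal ((2 / N i) powr s))"
      proof (rule sum_mono)
        fix l
        have "diameter (V (i, l)) powr s \<le> (2 / N i) powr s"
          using V[of i l] assms by (intro powr_mono2 diameter_ge_0) auto
        then show "diam_pow s (V (i, l)) \<le> ennreal ((2 / N i) powr s)"
          using assms by (simp add: diam_pow_def ennreal_leI)
      qed
      also have "\<dots> = ennreal (real (N i) ^ 2 * (2 / N i) powr s)"
        by (simp add: ennreal_mult ennreal_of_nat_eq_real_of_nat)
      also have "\<dots> \<le> ennreal (\<epsilon> * (1/2)^Suc i)" using N(3) by (rule ennreal_leI)
      finally show "(\<Sum>l. diam_pow s (V (i, l))) \<le> ennreal (\<epsilon> * (1/2)^Suc i)" .
    qed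
    also have "\<dots> = ennreal (\<epsilon> * 1)"
      using that power_half_series by (intro suminf_ennreal_eq sums_mult) auto
    finally show ?thesis by simp
  qed
  have "hausdorff_premeasure s \<delta> A = 0" if "0 < \<delta>" for \<delta>
  proof -
    have "hausdorff_premeasure s \<delta> A \<le> 0"
      by (rule ennreal_le_epsilon) (use pre[OF that] in simp)
    then show ?thesis by simp
  qed
  then show ?thesis unfolding hausdorff_measure_def by (simp add: SUP_constant)
qed

section \<open>Lower bound: a Cantor family of plays\<close>

lemma ball_avoiding_hyperplane:
  fixes c :: "'a::euclidean_space"
  assumes "affine_hyperplane L" "0 < \<rho>" "r < \<rho> / 4"
  shows "\<exists>c'. cball c' (\<rho> / 4) \<subseteq> cball c \<rho> - hyperplane_nbhd L r"
proof -
  obtain a b where ab: "a \<noteq> 0" "L = {z. a \<bullet> z = b}" using assms by (auto simp: affine_hyperplane_def)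
  \<comment> \<open>The centre is pushed by half the radius along the normal, to the side where it
    already lies; a quarter of the radius then separates the small ball from the hyperplane.\<close>
  define s :: real where "s = (if a \<bullet> c - b \<ge> 0 then 1 else -1)"
  define c' where "c' = c + (s * \<rho> / 2 / norm a) *\<^sub>R a"
  have s: "\<bar>s\<bar> = 1" "s * s = 1" "0 \<le> s * (a \<bullet> c - b)" by (auto simp: s_def)
  have dc: "dist c c' = \<rho> / 2" using ab s assms by (simp add: c'_def dist_norm abs_mult)
  have "s * (a \<bullet> c' - b) = s * (a \<bullet> c - b) + s * s * (\<rho> / 2 * norm a)"
    using ab by (simp add: c'_def inner_add_right power2_norm_eq_inner[symmetric] power2_eq_square algebra_simps)
  then have c'b: "\<rho> / 2 * norm a \<le> s * (a \<bullet> c' - b)" using s by simp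
  show ?thesis
  proof (intro exI subsetI)
    fix z assume "z \<in> cball c' (\<rho> / 4)"
    then have z: "dist c' z \<le> \<rho> / 4" by simp
    have "dist c z \<le> \<rho>" using dist_triangle[of c z c'] dc z assms by linarith
    moreover have "\<bar>a \<bullet> (z - c')\<bar> \<le> norm a * (\<rho> / 4)"
      using Cauchy_Schwarz_ineq2[of a "z - c'"] mult_left_mono[OF z, of "norm a"]
      by (simp add: dist_norm norm_minus_commute)
    have "s * (a \<bullet> z - b) = s * (a \<bullet> c' - b) + s * (a \<bullet> (z - c'))"
      by (simp add: inner_diff_right algebra_simps)
    moreover have "\<bar>s * (a \<bullet> (z - c'))\<bar> \<le> norm a * (\<rho> / 4)"
      using \<open>\<bar>a \<bullet> (z - c')\<bar> \<le> norm a * (\<rho> / 4)\<close> s by (simp add: abs_mult)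
    ultimately have "\<rho> / 4 * norm a \<le> s * (a \<bullet> z - b)" using c'b by (simp add: field_simps)
    also have "\<dots> \<le> \<bar>a \<bullet> z - b\<bar>" using s by (metis abs_ge_self abs_mult mult_1)
    finally have "\<rho> / 4 * norm a \<le> \<bar>a \<bullet> z - b\<bar>" .
    moreover have "r * norm a < \<rho> / 4 * norm a" using assms ab by simp
    ultimately have "z \<notin> hyperplane_nbhd L r"
      unfolding ab(2) in_hyperplane_nbhd_iff[OF ab(1)] by linarith
    then show "z \<in> cball c \<rho> - hyperplane_nbhd L r" using \<open>dist c z \<le> \<rho>\<close> by simp
  qed
qed

text \<open>The constant 36 gives \<open>8 * n * \<beta> + \<beta> \<le> 1 / 4\<close>: a grid of n
  by n centres with step 4 \<beta>, together with its balls, fits into the free ball of a quarter of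
  the radius.\<close>

locale cantor_play =
  fixes n :: nat and \<beta> :: real and A :: "(real \<times> real) set" and \<sigma> :: "(real \<times> real) alice_strategy"
  assumes n: "0 < n" and \<beta>: "\<beta> = 1 / (36 * n)" and \<sigma>: "winning_strategy \<beta> A \<sigma>"
begin

lemma \<beta>_bounds: "0 < \<beta>" "\<beta> \<le> 1 / 36" "8 * n * \<beta> + \<beta> \<le> 1 / 4"
  using n by (simp_all add: \<beta> field_simps)

definition safe_centre :: "(real \<times> real) bob_move list \<Rightarrow> real \<times> real" where
  "safe_centre h = (SOME c'. cball c' (snd (last h) / 4) \<subseteq> ball_of (last h) - nbhd_of (\<sigma> h))"

definition move :: "(real \<times> real) bob_move list \<Rightarrow> nat \<Rightarrow> (real \<times> real) bob_move" where
  "move h k = (safe_centre h + (4 * \<beta> * snd (last h)) *\<^sub>R (real (k mod n), real (k div n)), \<beta> * snd (last h))"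

primrec history :: "(nat \<Rightarrow> nat) \<Rightarrow> nat \<Rightarrow> (real \<times> real) bob_move list" where
  "history d 0 = [(0, 1)]"
| "history d (Suc m) = history d m @ [move (history d m) (d m)]"

definition play :: "(nat \<Rightarrow> nat) \<Rightarrow> nat \<Rightarrow> (real \<times> real) bob_move" where
  "play d m = last (history d m)"

lemma play_0: "play d 0 = (0, 1)" by (simp add: play_def)

lemma play_Suc: "play d (Suc m) = move (history d m) (d m)" by (simp add: play_def)

lemma history_eq: "history d m = map (play d) [0..<Suc m]"
proof (induction m)
  case 0
  then show ?case by (simp add: play_0)
next
  case (Suc m)
  have "history d (Suc m) = history d m @ [play d (Suc m)]" by (simp add: play_Suc)
  then show ?case using Suc by simp
qed

lemma history_cong: "(\<And>k. k < m \<Longrightarrow> d k = d' k) \<Longrightarrow> history d m = history d' m"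
  by (induction m) auto

lemma radius: "snd (play d m) = \<beta>^m"
proof (induction m)
  case (Suc m)
  then show ?case by (simp add: play_Suc move_def play_def)
qed (simp add: play_0)

lemma move_legal:
  assumes A: "alice_legal \<beta> (last h) (\<sigma> h)" and pos: "0 < snd (last h)" and k: "k < n\<^sup>2"
  shows "bob_legal \<beta> (last h) (\<sigma> h) (move h k)"
proof -
  let ?\<rho> = "snd (last h)"
  have "\<beta> * ?\<rho> < ?\<rho> / 4" using \<beta>_bounds(2) pos by simp
  then have "snd (\<sigma> h) < ?\<rho> / 4" using A by (simp add: alice_legal_def)
  then have "\<exists>c'. cball c' (?\<rho> / 4) \<subseteq> ball_of (last h) - nbhd_of (\<sigma> h)"
    unfolding ball_of_def nbhd_of_def
    using A pos by (intro ball_avoiding_hyperplane) (auto simp: alice_legal_def)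
  from someI_ex[OF this, folded safe_centre_def]
  have safe: "cball (safe_centre h) (?\<rho> / 4) \<subseteq> ball_of (last h) - nbhd_of (\<sigma> h)" .
  let ?v = "(real (k mod n), real (k div n))"
  have "k mod n < n" "k div n < n"
    using n k by (simp_all add: power2_eq_square less_mult_imp_div_less)
  then have "real (k mod n + k div n) \<le> real (2 * n)" unfolding of_nat_le_iff by linarith
  then have "norm ?v \<le> 2 * n"
    using sqrt_sum_squares_le_sum[of "real (k mod n)" "real (k div n)"] by (simp add: norm_prod_def)
  then have "(4 * \<beta> * ?\<rho>) * norm ?v \<le> (4 * \<beta> * ?\<rho>) * (2 * n)"
    using \<beta>_bounds(1) pos by (intro mult_left_mono) auto
  then have d: "dist (fst (move h k)) (safe_centre h) \<le> (4 * \<beta> * ?\<rho>) * (2 * n)"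
    using \<beta>_bounds(1) pos by (simp add: move_def dist_norm abs_mult del: scaleR_Pair)
  have "(8 * n * \<beta> + \<beta>) * ?\<rho> \<le> 1 / 4 * ?\<rho>"
    using \<beta>_bounds(3) pos by (intro mult_right_mono) auto
  then have "(4 * \<beta> * ?\<rho>) * (2 * n) + \<beta> * ?\<rho> \<le> ?\<rho> / 4" by (simp add: algebra_simps)
  then have "ball_of (move h k) \<subseteq> cball (safe_centre h) (?\<rho> / 4)"
    unfolding ball_of_def using d by (subst cball_subset_cball_iff) (simp add: move_def)
  then show ?thesis using safe by (auto simp: bob_legal_def move_def)
qed

lemma play_upto:
  assumes "\<And>k. d k < n\<^sup>2"
  shows "play_upto \<beta> \<sigma> (play d) m"
proof (induction m)
  case 0
  then show ?case by (simp add: play_upto_def play_0)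
next
  case (Suc m)
  have reply: "alice_reply \<sigma> (play d) m = \<sigma> (history d m)" by (simp add: alice_reply_def history_eq)
  have "alice_legal \<beta> (play d m) (alice_reply \<sigma> (play d) m)"
    using \<sigma> Suc by (auto simp: winning_strategy_def)
  then have "bob_legal \<beta> (play d m) (alice_reply \<sigma> (play d) m) (play d (Suc m))"
    unfolding reply play_Suc unfolding play_def
    using assms \<beta>_bounds(1) radius[of d m] by (intro move_legal) (auto simp: play_def)
  then show ?case using Suc by (auto simp: play_upto_def less_Suc_eq)
qed

definition limit :: "(nat \<Rightarrow> nat) \<Rightarrow> real \<times> real" where
  "limit d = (SOME z. z \<in> A \<and> (\<forall>m. z \<in> ball_of (play d m)))"

lemma limit:
  assumes "\<And>k. d k < n\<^sup>2"
  shows "limit d \<in> A" "limit d \<in> ball_of (play d m)"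
proof -
  have "(\<lambda>m. snd (play d m)) \<longlonglongrightarrow> 0"
    unfolding radius using \<beta>_bounds by (intro LIMSEQ_power_zero) auto
  then have "(\<Inter>m. ball_of (play d m)) \<inter> A \<noteq> {}"
    using \<sigma> play_upto[of d] assms unfolding winning_strategy_def by blast
  then have "\<exists>z. z \<in> A \<and> (\<forall>m. z \<in> ball_of (play d m))" by blast
  from someI_ex[OF this, folded limit_def]
  show "limit d \<in> A" "limit d \<in> ball_of (play d m)" by auto
qed

text \<open>Equal histories get equal answers from Alice, so both next centres belong to the same
  grid and are at least four new radii apart; each limit is within one radius of its centre.\<close>

lemma limit_separated:
  assumes d: "\<And>k. d k < n\<^sup>2" and d': "\<And>k. d' k < n\<^sup>2"
    and eq: "\<And>k. k < m \<Longrightarrow> d k = d' k" and ne: "d m \<noteq> d' m"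
  shows "2 * \<beta>^Suc m \<le> dist (limit d) (limit d')"
proof -
  have hist: "history d m = history d' m" using eq by (rule history_cong)
  let ?x = "fst (play d (Suc m))" and ?y = "fst (play d' (Suc m))"
  let ?v = "\<lambda>k. (real (k mod n), real (k div n))"
  have "1 \<le> norm (?v (d m) - ?v (d' m))"
  proof -
    have "d m mod n \<noteq> d' m mod n \<or> d m div n \<noteq> d' m div n"
      using ne by (metis div_mult_mod_eq)
    then have "1 \<le> \<bar>real (d m mod n) - real (d' m mod n)\<bar> \<or> 1 \<le> \<bar>real (d m div n) - real (d' m div n)\<bar>"
      by linarith
    then show ?thesis
      using norm_fst_le[of "real (d m mod n) - real (d' m mod n)" "real (d m div n) - real (d' m div n)"]
        norm_snd_le[of "real (d m div n) - real (d' m div n)" "real (d m mod n) - real (d' m mod n)"]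
      by (simp) linarith
  qed
  moreover have "dist ?x ?y = (4 * \<beta> * \<beta>^m) * norm (?v (d m) - ?v (d' m))"
  proof -
    have "?x - ?y = (4 * \<beta> * \<beta>^m) *\<^sub>R (?v (d m) - ?v (d' m))"
      using radius[of d' m] by (simp add: play_Suc move_def hist play_def algebra_simps del: scaleR_Pair diff_Pair)
    then show ?thesis using \<beta>_bounds(1) by (simp only: dist_norm norm_scaleR) (simp add: abs_mult)
  qed
  ultimately have "4 * \<beta>^Suc m \<le> dist ?x ?y"
    using mult_left_mono[of 1 "norm (?v (d m) - ?v (d' m))" "4 * \<beta> * \<beta>^m"] \<beta>_bounds(1) by simp
  moreover have "dist ?x (limit d) \<le> \<beta>^Suc m" "dist ?y (limit d') \<le> \<beta>^Suc m"
    using limit(2)[of d "Suc m"] limit(2)[of d' "Suc m"] d d' radius[of d "Suc m"] radius[of d' "Suc m"]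
    by (simp_all add: ball_of_def)
  moreover have "dist ?x ?y \<le> dist ?x (limit d) + dist (limit d) (limit d') + dist ?y (limit d')"
    using dist_triangle[of ?x ?y "limit d"] dist_triangle[of "limit d" ?y "limit d'"]
    by (simp add: dist_commute)
  ultimately show ?thesis by simp
qed

definition digit :: "real \<Rightarrow> nat \<Rightarrow> nat" where
  "digit t k = nat (\<lfloor>t * real (n\<^sup>2) ^ Suc k\<rfloor> mod int (n\<^sup>2))"

lemma digit_less: "digit t k < n\<^sup>2"
  using n by (simp add: digit_def nat_less_iff)

lemma floor_eq_of_digits:
  assumes "\<lfloor>t\<rfloor> = \<lfloor>t'\<rfloor>" "\<And>k. k < m \<Longrightarrow> digit t k = digit t' k"
  shows "\<lfloor>t * real (n\<^sup>2) ^ m\<rfloor> = \<lfloor>t' * real (n\<^sup>2) ^ m\<rfloor>"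
  using assms(2)
proof (induction m)
  case (Suc m)
  let ?M = "int (n\<^sup>2)"
  have M: "0 < ?M" using n by simp
  have fl: "\<lfloor>t * real (n\<^sup>2) ^ Suc m\<rfloor> div ?M = \<lfloor>t * real (n\<^sup>2) ^ m\<rfloor>" for t
    using floor_divide_real_eq_div[of ?M "t * real (n\<^sup>2) ^ Suc m"] n by simp
  have "digit t m = digit t' m" using Suc.prems by simp
  then have "\<lfloor>t * real (n\<^sup>2) ^ Suc m\<rfloor> mod ?M = \<lfloor>t' * real (n\<^sup>2) ^ Suc m\<rfloor> mod ?M"
    using M unfolding digit_def by (subst (asm) eq_nat_nat_iff) auto
  moreover have "\<lfloor>t * real (n\<^sup>2) ^ Suc m\<rfloor> div ?M = \<lfloor>t' * real (n\<^sup>2) ^ Suc m\<rfloor> div ?M"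
    unfolding fl using Suc by simp
  ultimately show ?case by (metis div_mult_mod_eq)
qed (use assms in simp)

definition point :: "real \<Rightarrow> real \<times> real" where
  "point t = limit (digit t)"

lemma close_of_dist_less:
  assumes t: "t \<in> {0..<1}" "t' \<in> {0..<1}" and dist: "dist (point t) (point t') < 2 * \<beta>^m"
  shows "\<bar>t - t'\<bar> \<le> 1 / real (n\<^sup>2)^m"
proof -
  have agree: "digit t k = digit t' k" if "k < m" for k
    using that
  proof (induction k rule: less_induct)
    case (less k)
    show ?case
    proof (rule ccontr)
      assume "digit t k \<noteq> digit t' k"
      then have "2 * \<beta>^Suc k \<le> dist (point t) (point t')"
        unfolding point_def using less digit_less by (intro limit_separated) auto
      moreover have "\<beta>^m \<le> \<beta>^Suc k" using less(2) \<beta>_bounds by (intro power_decreasing) auto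
      ultimately show False using dist by linarith
    qed
  qed
  have "\<lfloor>t\<rfloor> = 0" "\<lfloor>t'\<rfloor> = 0" using t by (auto simp: floor_eq_iff)
  then have "\<lfloor>t * real (n\<^sup>2) ^ m\<rfloor> = \<lfloor>t' * real (n\<^sup>2) ^ m\<rfloor>"
    using agree by (intro floor_eq_of_digits) auto
  then have "\<bar>t * real (n\<^sup>2) ^ m - t' * real (n\<^sup>2) ^ m\<bar> \<le> 1" by linarith
  then have "\<bar>t - t'\<bar> * real (n\<^sup>2) ^ m \<le> 1"
    by (simp add: left_diff_distrib[symmetric] abs_mult del: of_nat_power)
  then show ?thesis using n by (simp add: le_divide_eq del: of_nat_power)
qed

text \<open>The Hoelder estimate. If the diameter lies between \<open>2 * \<beta>^Suc m\<close> and
  \<open>2 * \<beta>^m\<close>, the parameters share \<open>m\<close> digits, and the assumption on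
  \<open>s\<close> bounds the length \<open>1 / real (n\<^sup>2)^m\<close> by
  \<open>(\<beta>^m) powr s\<close>. An interval replaces the preimage of \<open>U\<close>, whose
  measurability is not known.\<close>

lemma interval_of_small_set:
  assumes s: "0 \<le> s" "(1 / \<beta>) powr s \<le> real (n\<^sup>2)"
    and U: "bounded U" "diameter U \<le> 1"
  obtains I where "I \<in> sets lborel" "{t \<in> {0..<1}. point t \<in> U} \<subseteq> I"
    "emeasure lborel I \<le> ennreal (2 * (1 / \<beta>) powr s) * diam_pow s U"
proof (cases "{t \<in> {0..<1}. point t \<in> U} = {}")
  case True
  then show ?thesis using that[of "{}"] by simp
next
  case False
  then obtain t0 where t0: "t0 \<in> {0..<1}" "point t0 \<in> U" by blast
  define D where "D = diameter U"
  have D: "0 \<le> D" "D \<le> 1" using U diameter_ge_0 by (auto simp: D_def)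
  have Une: "U \<noteq> {}" using t0 by blast
  have dist: "dist (point t0) (point t) \<le> D" if "point t \<in> U" for t
    unfolding D_def using diameter_bounded_bound[OF U(1) t0(2) that] .
  have near: "{t \<in> {0..<1}. point t \<in> U} \<subseteq> {t0 - 1 / real (n\<^sup>2)^m .. t0 + 1 / real (n\<^sup>2)^m}"
    if "D < 2 * \<beta>^m" for m
  proof
    fix t assume "t \<in> {t \<in> {0..<1}. point t \<in> U}"
    then have "\<bar>t0 - t\<bar> \<le> 1 / real (n\<^sup>2)^m"
      using dist[of t] that t0 by (intro close_of_dist_less) auto
    then show "t \<in> {t0 - 1 / real (n\<^sup>2)^m .. t0 + 1 / real (n\<^sup>2)^m}" by (simp add: abs_le_iff)
  qed
  consider "s = 0" | "0 < s" "D = 0" | "0 < s" "0 < D" using s D by linarith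
  then show ?thesis
  proof cases
    case 1
    have "{t \<in> {0..<1}. point t \<in> U} \<subseteq> {0..1}" by auto
    then show ?thesis using that[of "{0..1}"] 1 Une \<beta>_bounds by (simp add: diam_pow_def)
  next
    case 2
    \<comment> \<open>For s > 0 a single point has \<open>diam_pow\<close> equal to 0, so a null set
      is required. The assumption on \<open>s\<close> forces \<open>n\<^sup>2\<close> above 1, which
      makes \<open>point\<close> injective.\<close>
    have "t = t0" if t: "t \<in> {0..<1}" "point t \<in> U" for t
    proof (rule ccontr)
      assume "t \<noteq> t0"
      then have "point t = point t0" using dist[of t] 2 t by simp
      have all: "\<bar>t - t0\<bar> \<le> 1 / real (n\<^sup>2)^m" for m
        using t t0 \<beta>_bounds \<open>point t = point t0\<close> by (intro close_of_dist_less) auto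
      have "1 < (1 / \<beta>) powr s" using 2 \<beta>_bounds by (intro gr_one_powr) (auto simp: less_divide_eq)
      then have "1 < real (n\<^sup>2)" using s by linarith
      then obtain m where "1 / \<bar>t - t0\<bar> < real (n\<^sup>2)^m" using real_arch_pow by blast
      then have "1 / real (n\<^sup>2)^m < \<bar>t - t0\<bar>" using \<open>t \<noteq> t0\<close> n by (simp add: field_simps)
      then show False using all[of m] by linarith
    qed
    then show ?thesis using that[of "{t0}"] by auto
  next
    case 3
    define m where "m = (LEAST m. 2 * \<beta>^Suc m \<le> D)"
    obtain m0 where "\<beta>^m0 < D / 2" using real_arch_pow_inv[of "D / 2" \<beta>] 3 \<beta>_bounds by auto
    moreover have "\<beta>^Suc m0 \<le> \<beta>^m0" using \<beta>_bounds by (intro power_decreasing) auto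
    ultimately have "2 * \<beta>^Suc m0 \<le> D" by linarith
    then have m: "2 * \<beta>^Suc m \<le> D" unfolding m_def by (rule LeastI)
    have Dm: "D < 2 * \<beta>^m"
    proof (cases m)
      case 0
      then show ?thesis using D by simp
    next
      case (Suc l)
      then show ?thesis using not_less_Least[of l "\<lambda>m. 2 * \<beta>^Suc m \<le> D"] by (simp add: m_def)
    qed
    let ?I = "{t0 - 1 / real (n\<^sup>2)^m .. t0 + 1 / real (n\<^sup>2)^m}"
    have "1 / real (n\<^sup>2)^m \<le> (1 / \<beta>) powr s * D powr s"
    proof -
      have b0: "0 < (1 / \<beta>) powr s" using \<beta>_bounds by simp
      have "((1 / \<beta>) powr s)^m \<le> real (n\<^sup>2)^m" using s b0 by (intro power_mono) auto
      then have "1 / real (n\<^sup>2)^m \<le> 1 / ((1 / \<beta>) powr s)^m" using b0 n by (intro divide_left_mono mult_pos_pos zero_less_power) auto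
      also have "1 / ((1 / \<beta>) powr s)^m = (\<beta>^m) powr s"
        using \<beta>_bounds by (simp add: powr_divide power_divide powr_power powr_realpow[symmetric] powr_powr mult.commute)
      also have "\<beta>^m = (1 / \<beta>) * \<beta>^Suc m" using \<beta>_bounds by simp
      also have "((1 / \<beta>) * \<beta>^Suc m) powr s \<le> ((1 / \<beta>) * D) powr s"
      proof (rule powr_mono2)
        have "\<beta>^Suc m \<le> D" using m \<beta>_bounds(1) zero_le_power[of \<beta> "Suc m"] by linarith
        then show "(1 / \<beta>) * \<beta>^Suc m \<le> (1 / \<beta>) * D" using \<beta>_bounds by (intro mult_left_mono) auto
      qed (use s \<beta>_bounds in auto)
      also have "\<dots> = (1 / \<beta>) powr s * D powr s" using \<beta>_bounds D by (subst powr_mult) auto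
      finally show ?thesis .
    qed
    then have "emeasure lborel ?I \<le> ennreal (2 * (1 / \<beta>) powr s * D powr s)"
      using n by (subst emeasure_lborel_Icc) (auto intro!: ennreal_leI)
    also have "\<dots> = ennreal (2 * (1 / \<beta>) powr s) * diam_pow s U"
      using 3 Une by (simp add: diam_pow_def D_def ennreal_mult)
    finally show ?thesis using that[of ?I] near[OF Dm] by simp
  qed
qed

text \<open>Mass distribution: a cover of \<open>A\<close> with small sum would pull back to a cover
  of \<open>{0..<1}\<close> by intervals of total length below 1.\<close>

lemma hausdorff_measure_nonzero:
  assumes s: "0 \<le> s" "(1 / \<beta>) powr s \<le> real (n\<^sup>2)"
  shows "hausdorff_measure s A \<noteq> 0"
proof
  assume zero: "hausdorff_measure s A = 0"
  define C where "C = 2 * (1 / \<beta>) powr s"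
  have C: "0 < C" using \<beta>_bounds by (simp add: C_def)
  have "hausdorff_premeasure s 1 A \<le> hausdorff_measure s A"
    unfolding hausdorff_measure_def by (intro SUP_upper) auto
  then have "hausdorff_premeasure s 1 A < ennreal (1 / C)" using zero C by simp
  then obtain U :: "nat \<Rightarrow> (real \<times> real) set" where U: "A \<subseteq> (\<Union>i. U i)" "\<And>i. bounded (U i) \<and> diameter (U i) \<le> 1"
    "(\<Sum>i. diam_pow s (U i)) < ennreal (1 / C)"
    unfolding hausdorff_premeasure_def Inf_less_iff by blast
  have "\<forall>i. \<exists>I. I \<in> sets lborel \<and> {t \<in> {0..<1}. point t \<in> U i} \<subseteq> I \<and>
      emeasure lborel I \<le> ennreal C * diam_pow s (U i)"
  proof
    fix i
    obtain I where "I \<in> sets lborel" "{t \<in> {0..<1}. point t \<in> U i} \<subseteq> I"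
        "emeasure lborel I \<le> ennreal C * diam_pow s (U i)"
      using U(2)[of i] unfolding C_def by (elim conjE interval_of_small_set[OF s])
    then show "\<exists>I. I \<in> sets lborel \<and> {t \<in> {0..<1}. point t \<in> U i} \<subseteq> I \<and>
      emeasure lborel I \<le> ennreal C * diam_pow s (U i)" by blast
  qed
  from choice[OF this] obtain I where I: "\<And>i. I i \<in> sets lborel"
      "\<And>i. {t \<in> {0..<1}. point t \<in> U i} \<subseteq> I i"
      "\<And>i. emeasure lborel (I i) \<le> ennreal C * diam_pow s (U i)" by blast
  have "{0..<1} \<subseteq> (\<Union>i. I i)"
  proof
    fix t :: real assume t: "t \<in> {0..<1}"
    have "point t \<in> A" unfolding point_def using digit_less by (intro limit)
    then obtain i where "point t \<in> U i" using U by blast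
    then show "t \<in> (\<Union>i. I i)" using I(2)[of i] t by blast
  qed
  then have "emeasure lborel {0..<1::real} \<le> emeasure lborel (\<Union>i. I i)"
    using I by (intro emeasure_mono) auto
  also have "\<dots> \<le> (\<Sum>i. emeasure lborel (I i))"
    using I by (intro emeasure_subadditive_countably) auto
  also have "\<dots> \<le> (\<Sum>i. ennreal C * diam_pow s (U i))"
    using I by (intro suminf_le summableI) auto
  also have "\<dots> = ennreal C * (\<Sum>i. diam_pow s (U i))" by simp
  also have "\<dots> < ennreal C * ennreal (1 / C)"
    using U(3) C by (intro ennreal_mult_strict_left_mono) auto
  also have "\<dots> = 1" using C by (simp flip: ennreal_mult)
  finally show False by simp
qed

end

lemma HAW_hausdorff_dim:
  fixes A :: "(real \<times> real) set"
  assumes "HAW A"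
  shows "hausdorff_dim A = 2"
proof (rule antisym)
  have nz: "hausdorff_measure s A \<noteq> 0" if s: "0 \<le> s" "s < 2" for s
  proof -
    \<comment> \<open>As s < 2, some \<open>n\<close> satisfies
      \<open>(36 * n) powr s \<le> n\<^sup>2\<close>, the condition under which the Cantor family
      detects the exponent \<open>s\<close>.\<close>
    have "((\<lambda>x::real. 36 powr s * x powr (s - 2)) \<longlongrightarrow> 36 powr s * 0) at_top"
      using s by (intro tendsto_mult tendsto_const tendsto_neg_powr filterlim_ident) auto
    then have "\<forall>\<^sub>F x in at_top. 36 powr s * (x::real) powr (s - 2) < 1"
      by (simp add: order_tendstoD(2))
    then have "\<forall>\<^sub>F k in sequentially. 36 powr s * real k powr (s - 2) < 1"
      by (rule eventually_compose_filterlim[OF _ filterlim_real_sequentially])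
    moreover have "\<forall>\<^sub>F k in sequentially. 0 < (k::nat)" by (rule eventually_gt_at_top)
    ultimately have "\<forall>\<^sub>F k in sequentially. 36 powr s * real k powr (s - 2) < 1 \<and> 0 < k"
      by (intro eventually_conj)
    from eventually_happens[OF this]
    obtain n :: nat where large: "36 powr s * real n powr (s - 2) < 1" "0 < n" by auto
    define \<beta> where "\<beta> = 1 / (36 * real n)"
    have "0 < \<beta> \<and> \<beta> < 1/3" using large by (simp add: \<beta>_def field_simps)
    then obtain \<sigma> where "winning_strategy \<beta> A \<sigma>"
      using assms by (auto simp: HAW_def beta_HAW_def)
    then interpret cantor_play n \<beta> A \<sigma> using large by unfold_locales (auto simp: \<beta>_def)
    have "(1 / \<beta>) powr s = 36 powr s * real n powr s" by (simp add: \<beta>_def powr_mult)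
    also have "real n powr s = real n powr (s - 2) * real n powr 2"
      unfolding powr_add[symmetric] by simp
    also have "36 powr s * (real n powr (s - 2) * real n powr 2)
        = 36 powr s * real n powr (s - 2) * real (n\<^sup>2)"
      using large(2) by (simp add: powr_numeral)
    also have "\<dots> \<le> 1 * real (n\<^sup>2)" using large by (intro mult_right_mono) auto
    also have "\<dots> = real (n\<^sup>2)" by simp
    finally show ?thesis by (rule hausdorff_measure_nonzero[OF s(1)])
  qed
  have "2 \<le> s" if "0 \<le> s" "hausdorff_measure s A = 0" for s
    using nz[of s] that by linarith
  then show "2 \<le> hausdorff_dim A"
    unfolding hausdorff_dim_def by (intro Inf_greatest) auto
  have up: "hausdorff_dim A \<le> ereal s" if "2 < s" for s
    unfolding hausdorff_dim_def using that hausdorff_measure_eq_0[OF that, of A]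
    by (intro Inf_lower) auto
  have "hausdorff_dim A \<le> ereal 2 + ereal r" if "0 < r" for r
    unfolding plus_ereal.simps(1) by (rule up) (use that in simp)
  then have "hausdorff_dim A \<le> ereal 2" by (rule ereal_le_epsilon2)
  then show "hausdorff_dim A \<le> 2" by simp
qed

theorem theorem1p2:
  shows "HAW E_set \<and> hausdorff_dim E_set = 2"
  using HAW_E_set HAW_hausdorff_dim by blast

end
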